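(* Let $C\equiv f(x,y)=0$ be a plane branch with semigroup of values $\langle 4,s_1,s_2\rangle$, in coordinates such that $i_0(f,x)=\mathrm{ord} f=4$. Then the discriminant curve $D(u,v)=0$ of the morphism $(x,f)$ is non-degenerate (in the sense of Kouchnirenko, with respect to $(u,v)$). Moreover $D(u,v)=D_1(u,v)D_2(u,v)$, where $D_1=0$ is a smooth branch, $D_2=0$ is a singular branch with semigroup of values $\langle 2,s_2\rangle$, and the intersection multiplicity of both branches is $i_0(D_1,D_2)=2s_1$.
   Context: A plane branch is a germ at $0\in\mathbb C^2$ of a curve $f(x,y)=0$ with $f\in\mathbb C\{x,y\}$ irreducible; its multiplicity is the order of $f$; it is smooth if the multiplicity is $1$, singular otherwise. The intersection number is $i_0(f,h)=\dim_{\mathbb C}\mathbb C\{x,y\}/(f,h)$. The semigroup of values of $C$ is $S(C)=\{i_0(f,h): h\in\mathbb C\{x,y\},\ h\not\equiv0\bmod f\}$; $\langle s_0,\dots,s_g\rangle$ denotes the semigroup with minimal system of generators $s_0<s_1<\dots<s_g$, so the branch here has genus $g=2$. Discriminant: if $n$ is the order of $f$ and $\frac{\partial f}{\partial y}=(\text{unit})\cdot\prod_{j=1}^{n-1}(y-\gamma_j(x))$ is the Newton–Puiseux factorization, the discriminant curve of $(x,f):(\mathbb C^2,0)\to(\mathbb C^2,0)$, $(x,y)\mapsto(u,v)=(x,f(x,y))$, is $D(u,v)=0$ with $D(u,v)=\prod_{j=1}^{n-1}(v-f(u,\gamma_j(u)))$. Non-degeneracy: the Newton polygon $\mathcal N(h)$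 of $h=\sum a_{ij}u^iv^j$ is the convex hull of $\mathrm{supp}(h)+\mathbb R_{\ge0}^2$. $h$ is non degenerate if for every compact edge $L$ of $\mathcal N(h)$, with $h_L=\sum_{(i,j)\in L\cap\mathrm{supp}(h)}a_{ij}u^iv^j$ and $j_0=\min\{j:(i,j)\in L\}$, the polynomial $h_L(1,z)/z^{j_0}$ has no multiple roots. *)

theory Defs
  imports
    "HOL-Analysis.Analysis"
    "HOL-Computational_Algebra.Computational_Algebra"
    "HOL-Algebra.QuotRing"
    "HOL-Algebra.Ring_Divisibility"
    "HOL-Algebra.Embedded_Algebras"
begin

section \<open>Convergent power series in two variables\<close>

text \<open>
  A series \<open>h = (\<Sum>i j. a i j * x ^ i * y ^ j)\<close> is represented as an element of \<open>C[[x]][[y]]\<close>: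
  the outer variable is the second one, so \<open>a i j = h $ j $ i\<close>, and \<^term>\<open>fps_deriv h\<close> is the
  partial derivative with respect to \<open>y\<close>. The same type serves for series in \<open>(u, v)\<close>,
  with \<open>v\<close> outermost.
\<close>

type_synonym series2 = "complex fps fps"

definition coeff2 :: "series2 \<Rightarrow> nat \<Rightarrow> nat \<Rightarrow> complex" where
  "coeff2 h i j = h $ j $ i"

definition convergent2 :: "series2 \<Rightarrow> bool" where
  "convergent2 h \<longleftrightarrow>
     (\<exists>r>0. (\<lambda>(i, j). norm (coeff2 h i j) * (r::real) ^ i * r ^ j) summable_on UNIV)"

definition conv_ring :: "series2 ring" where
  "conv_ring =
     \<lparr>carrier = {h. convergent2 h}, mult = (*), one = 1, zero = 0, add = (+)\<rparr>"

definition var_x :: series2 where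
  "var_x = fps_const fps_X"

definition const2 :: "complex \<Rightarrow> series2" where
  "const2 c = fps_const (fps_const c)"

text \<open>The order is meaningful for \<open>h \<noteq> 0\<close> only.\<close>

definition ord2 :: "series2 \<Rightarrow> nat" where
  "ord2 h = (LEAST k. \<exists>i j. i + j = k \<and> coeff2 h i j \<noteq> 0)"

section \<open>Plane branches, intersection numbers, semigroups of values\<close>

definition plane_branch :: "series2 \<Rightarrow> bool" where
  "plane_branch f \<longleftrightarrow> f \<in> carrier conv_ring \<and> ring_irreducible\<^bsub>conv_ring\<^esub> f"

definition smooth_branch :: "series2 \<Rightarrow> bool" where
  "smooth_branch f \<longleftrightarrow> plane_branch f \<and> ord2 f = 1"

definition singular_branch :: "series2 \<Rightarrow> bool" where
  "singular_branch f \<longleftrightarrow> plane_branch f \<and> ord2 f \<noteq> 1"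

definition local_algebra :: "series2 \<Rightarrow> series2 \<Rightarrow> series2 set ring" where
  "local_algebra f h = conv_ring Quot (genideal conv_ring {f, h})"

text \<open>The image of the field of constants \<open>C\<close> in \<open>C{x,y}/(f,h)\<close>.\<close>

definition scalars :: "series2 \<Rightarrow> series2 \<Rightarrow> series2 set set" where
  "scalars f h =
     (\<lambda>c. genideal conv_ring {f, h} +>\<^bsub>conv_ring\<^esub> const2 c) ` UNIV"

text \<open>
  The dimension of \<open>C{x,y}/(f,h)\<close> over \<open>C\<close>, with value \<open>\<infinity>\<close> if it is infinite. If \<open>(f,h)\<close> is
  the unit ideal, the quotient is the zero ring and the value is \<open>0\<close>.
\<close>

definition intersection_number :: "series2 \<Rightarrow> series2 \<Rightarrow> enat" where
  "intersection_number f h =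
     (let A = local_algebra f h; K = scalars f h in
      if ring.finite_dimension A K (carrier A)
      then enat (ring.dim A K (carrier A)) else \<infinity>)"

text \<open>
  For an irreducible \<open>f\<close> all the intersection numbers that occur here are finite.
\<close>

definition semigroup_of_values :: "series2 \<Rightarrow> nat set" where
  "semigroup_of_values f =
     {n. \<exists>h \<in> carrier conv_ring. h \<notin> genideal conv_ring {f} \<and> intersection_number f h = enat n}"

definition generated_semigroup :: "nat set \<Rightarrow> nat set" where
  "generated_semigroup A = {(\<Sum>a\<in>A. c a * a) |c :: nat \<Rightarrow> nat. True}"

text \<open>
  \<open>S = \<langle>s\<^sub>0, \<dots>, s\<^sub>g\<rangle>\<close>: the list is strictly increasing and is a minimal system of generators.
\<close>

definition minimally_generated_by :: "nat set \<Rightarrow> nat list \<Rightarrow> bool" where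
  "minimally_generated_by S ss \<longleftrightarrow>
     sorted_wrt (<) ss \<and> S = generated_semigroup (set ss) \<and>
     (\<forall>B. B \<subset> set ss \<longrightarrow> generated_semigroup B \<noteq> S)"

section \<open>The discriminant of \<open>(x, f)\<close>\<close>

text \<open>
  Puiseux series in \<open>x\<close> with denominator \<open>N\<close> are represented as power series in \<open>t\<close>, where
  \<open>x = t ^ N\<close>. For \<open>h(x, y)\<close>, the series \<open>ramify N h\<close> is \<open>h(t ^ N, y)\<close>. For \<open>h(t, y)\<close> and \<open>g(t)\<close>
  with \<open>g(0) = 0\<close>, the series \<open>subst_y h g\<close> is \<open>h(t, g(t)) = (\<Sum>j. h\<^sub>j(t) * g(t) ^ j)\<close>, where only
  the terms \<open>j \<le> n\<close> contribute to the coefficient of \<open>t ^ n\<close>.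
\<close>

definition ramify :: "nat \<Rightarrow> series2 \<Rightarrow> series2" where
  "ramify N h = Abs_fps (\<lambda>j. fps_compose (h $ j) (fps_X ^ N))"

definition subst_y :: "series2 \<Rightarrow> complex fps \<Rightarrow> complex fps" where
  "subst_y h g = Abs_fps (\<lambda>n. \<Sum>j\<le>n. (h $ j * g ^ j) $ n)"

text \<open>
  With \<open>n\<close> the order of \<open>f\<close>: the derivative of \<open>f\<close> with respect to \<open>y\<close> is a unit \<open>w(x, y)\<close>
  times the product of the \<open>y - \<gamma>\<^sub>j(x)\<close> for \<open>1 \<le> j \<le> n - 1\<close>, where
  \<open>\<gamma>\<^sub>j(t ^ N) = \<gamma> j\<close> is a convergent series in \<open>t\<close> vanishing at the origin.
\<close>

definition Newton_Puiseux_polar :: "series2 \<Rightarrow> nat \<Rightarrow> series2 \<Rightarrow> (nat \<Rightarrow> complex fps) \<Rightarrow> bool" where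
  "Newton_Puiseux_polar f N w \<gamma> \<longleftrightarrow>
     N > 0 \<and> w \<in> Units conv_ring \<and>
     (\<forall>j\<in>{1..ord2 f - 1}. fps_conv_radius (\<gamma> j) > 0 \<and> \<gamma> j $ 0 = 0) \<and>
     ramify N (fps_deriv f) = ramify N w * (\<Prod>j=1..ord2 f - 1. fps_X - fps_const (\<gamma> j))"

text \<open>
  \<open>D(u, v)\<close> is the product of the \<open>v - f(u, \<gamma>\<^sub>j(u))\<close>, stated after the substitution \<open>u = t ^ N\<close>,
  which is injective.
\<close>

definition is_discriminant :: "series2 \<Rightarrow> series2 \<Rightarrow> bool" where
  "is_discriminant f D \<longleftrightarrow>
     D \<in> carrier conv_ring \<and>
     (\<exists>N w \<gamma>. Newton_Puiseux_polar f N w \<gamma> \<and>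
        ramify N D =
          (\<Prod>j=1..ord2 f - 1. fps_X - fps_const (subst_y (ramify N f) (\<gamma> j))))"

section \<open>Newton polygon and non-degeneracy\<close>

definition supp2 :: "series2 \<Rightarrow> (nat \<times> nat) set" where
  "supp2 h = {(i, j). coeff2 h i j \<noteq> 0}"

definition newton_polygon :: "series2 \<Rightarrow> (real \<times> real) set" where
  "newton_polygon h =
     convex hull {(real i + a, real j + b) |i j a b. (i, j) \<in> supp2 h \<and> 0 \<le> a \<and> 0 \<le> b}"

text \<open>\<open>h\<^sub>L(1, z)\<close>; the sum is finite if \<open>L\<close> is compact.\<close>

definition edge_poly :: "series2 \<Rightarrow> (real \<times> real) set \<Rightarrow> complex poly" where
  "edge_poly h L =
     (\<Sum>(i, j) \<in> {(i, j). (i, j) \<in> supp2 h \<and> (real i, real j) \<in> L}.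
        Polynomial.monom (coeff2 h i j) j)"

text \<open>
  The ends of a compact edge lie in the support, so the minimal second coordinate on \<open>L\<close> is
  attained at an integral point.
\<close>

definition edge_min :: "(real \<times> real) set \<Rightarrow> nat" where
  "edge_min L = (LEAST j. \<exists>i. (real i, real j) \<in> L)"

definition non_degenerate :: "series2 \<Rightarrow> bool" where
  "non_degenerate h \<longleftrightarrow>
     (\<forall>L. L edge_of newton_polygon h \<and> compact L \<longrightarrow>
        rsquarefree (edge_poly h L div Polynomial.monom 1 (edge_min L)))"

end

theory Submission
  imports Defs
begin

text \<open>
  A transversal branch \<open>f\<close> of multiplicity \<open>n\<close> has a Puiseux parametrization \<open>(t\<^sup>n, \<phi>(t))\<close>, and
  \<open>i\<^sub>0(f, h)\<close> is the order of \<open>h(t\<^sup>n, \<phi>(t))\<close>. For \<open>n = 4\<close> and three minimal generators, the first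
  exponent \<open>\<beta>\<^sub>1\<close> of \<open>\<phi>\<close> not divisible by \<open>4\<close> is \<open>2\<close> modulo \<open>4\<close>, and with the first odd exponent
  \<open>\<beta>\<^sub>2\<close> one gets \<open>s\<^sub>1 = \<beta>\<^sub>1\<close> and \<open>s\<^sub>2 = \<beta>\<^sub>1 + \<beta>\<^sub>2\<close>; in particular \<open>s\<^sub>2\<close> is odd and exceeds \<open>2 s\<^sub>1\<close>.

  At a root \<open>\<gamma>\<close> of the polar the sum of the \<open>1 / (\<gamma> - \<phi>\<^sub>k)\<close> over the four conjugates has nonnegative order,
  so no contact \<open>\<gamma> - \<phi>\<^sub>k\<close> may dominate. Hence either all contacts equal \<open>\<beta>\<^sub>1\<close>, or two of them equal
  \<open>\<beta>\<^sub>2\<close> and two \<open>\<beta>\<^sub>1\<close> (in units of \<open>t\<close>). Comparing with the order of \<open>\<partial>f/\<partial>y\<close> at the conjugates, the first case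
  occurs for exactly one of the three \<open>\<gamma>\<close>. So \<open>D\<close> has one root of order \<open>s\<^sub>1\<close>, which by Galois invariance is a
  power series in \<open>u\<close>, and two roots of order \<open>s\<^sub>2 / 2\<close>. The Newton polygon has vertices \<open>(0, 3)\<close>,
  \<open>(s\<^sub>1, 2)\<close>, \<open>(s\<^sub>1 + s\<^sub>2, 0)\<close>; as \<open>s\<^sub>2\<close> is odd, its edges contain no lattice point of height \<open>1\<close>, so the
  edge polynomials have simple roots.
\<close>

section \<open>Convergent power series and Weierstrass division\<close>

unbundle no vec_syntax

text \<open>The bound on the contacts comes from the logarithmic derivative: \<open>f_y / f\<close>
  is \<open>U_y / U\<close> plus the sum of the \<open>1 / (y - \<phi>_k)\<close>, with
  \<open>U\<close> a unit, and \<open>f_y\<close> vanishes at \<gamma>. Multiplied by the four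
  factors it becomes an identity between power series, so no negative exponents occur. For the
  count, the order of \<open>f_y\<close> at a conjugate is computed twice, from the factors of
  \<open>f\<close> and from the factors of \<open>f_y\<close>: exactly one \<gamma> has the higher
  contact with a given conjugate. Conjugates 0 and 2 share theirs, and so do 1 and 3, which leaves
  one \<gamma> of the first kind. Intersection numbers are defined as dimensions over convergent
  series. Reading them as orders needs a bound on the conductor, and division and inversion need
  explicit coefficient estimates. The singular factor is studied through its coefficients: it is
  \<open>v^2 - b1 v + b2\<close> with \<open>b2\<close> of order \<open>s2\<close> and
  \<open>b1\<close> of order above \<open>s2 / 2\<close>. It is irreducible because a root in
  \<open>u\<close> would have the non-integral order \<open>s2 / 2\<close>.\<close>

definition conv1 :: "complex fps \<Rightarrow> bool" where
  "conv1 a \<longleftrightarrow> (\<exists>C R. 0 < R \<and> (\<forall>k. norm (a $ k) \<le> C * R ^ k))"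

text \<open>The excess over 1 is linear in \<open>z\<close>, so a geometric sum without its constant
  term becomes small with \<open>z\<close>.\<close>

lemma sum_power_le_2:
  fixes z :: real assumes "0 \<le> z" "z \<le> 1/2" shows "(\<Sum>k\<le>n. z ^ k) \<le> 1 + 2 * z"
proof -
  have "(\<Sum>k\<le>n. z ^ k) = (1 - z ^ Suc n) / (1 - z)"
    using assms by (simp add: sum_gp0)
  also have "\<dots> \<le> 1 / (1 - z)"
    using assms by (intro divide_right_mono) auto
  also have "\<dots> \<le> 1 + 2 * z"
  proof -
    have "1 \<le> (1 + 2 * z) * (1 - z)"
      using mult_nonneg_nonneg[of z "1 - 2 * z"] assms by (simp add: algebra_simps)
    then show ?thesis using assms by (simp add: divide_le_eq)
  qed
  finally show ?thesis .
qed

lemma sum_scaled_product: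
  fixes f :: "'a \<Rightarrow> real"
  shows "(\<Sum>k\<in>A. \<Sum>l\<in>B. c * (f k * g l)) = c * (sum f A * sum g B)"
  by (subst sum_product) (simp add: sum_distrib_left)

text \<open>Every term of a summable nonnegative family is bounded by its sum. Conversely a
  geometric bound dominates the family by a geometric series at a smaller radius. All later
  estimates use this form.\<close>

lemma convergent2_iff:
  "convergent2 h \<longleftrightarrow> (\<exists>C R. 0 < R \<and> (\<forall>i j. norm (h $ j $ i) \<le> C * R ^ (i + j)))"
proof
  assume "convergent2 h"
  then obtain r where r: "r > 0"
    and s: "(\<lambda>(i, j). norm (coeff2 h i j) * r ^ i * r ^ j) summable_on UNIV"
    by (auto simp: convergent2_def)
  define C where "C = infsum (\<lambda>(i, j). norm (coeff2 h i j) * r ^ i * r ^ j) UNIV"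
  have "norm (h $ j $ i) \<le> C * (1/r) ^ (i + j)" for i j
  proof -
    have "sum (\<lambda>(i, j). norm (coeff2 h i j) * r ^ i * r ^ j) {(i, j)} \<le> C"
      unfolding C_def by (rule finite_sum_le_infsum[OF s]) (use r in auto)
    then have "norm (h $ j $ i) * r ^ (i + j) \<le> C"
      by (simp add: coeff2_def power_add mult.assoc)
    then show ?thesis
      using r by (simp add: power_divide field_simps)
  qed
  then show "\<exists>C R. 0 < R \<and> (\<forall>i j. norm (h $ j $ i) \<le> C * R ^ (i + j))"
    using r by (intro exI[of _ C] exI[of _ "1/r"]) auto
next
  assume "\<exists>C R. 0 < R \<and> (\<forall>i j. norm (h $ j $ i) \<le> C * R ^ (i + j))"
  then obtain C R where R: "0 < R" and b: "\<And>i j. norm (h $ j $ i) \<le> C * R ^ (i + j)" by blast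
  have C: "0 \<le> C" using order.trans[OF norm_ge_zero b[of 0 0]] by simp
  \<comment> \<open>Half of the critical radius: \<open>R * r = 1/2\<close>, so the terms are
    dominated by powers of one half.\<close>
  define r where "r = 1 / (2 * R)"
  let ?g = "\<lambda>(i, j). norm (coeff2 h i j) * r ^ i * r ^ j"
  have le: "?g (i, j) \<le> C * ((1/2) ^ i * (1/2) ^ j)" for i j
  proof -
    have "norm (coeff2 h i j) * (r ^ i * r ^ j) \<le> (C * R ^ (i + j)) * (r ^ i * r ^ j)"
      using b R by (intro mult_right_mono) (auto simp: coeff2_def r_def)
    also have "\<dots> = C * ((R * r) ^ i * (R * r) ^ j)"
      by (simp add: power_add power_mult_distrib)
    finally show ?thesis using R by (simp add: r_def mult.assoc)
  qed
  have "?g summable_on UNIV"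
  proof (rule nonneg_bdd_above_summable_on)
    show "0 \<le> ?g x" for x using R by (auto simp: r_def split: prod.splits)
    show "bdd_above (sum ?g ` {F. F \<subseteq> UNIV \<and> finite F})"
    proof (rule bdd_aboveI)
      fix s assume "s \<in> sum ?g ` {F. F \<subseteq> UNIV \<and> finite F}"
      then obtain F where F: "finite F" "s = sum ?g F" by auto
      define n where "n = Max (insert 0 (fst ` F \<union> snd ` F))"
      have sub: "F \<subseteq> {..n} \<times> {..n}"
      proof
        fix p assume "p \<in> F"
        then have "fst p \<le> n" "snd p \<le> n" unfolding n_def using F by (auto intro!: Max_ge)
        then show "p \<in> {..n} \<times> {..n}" by (cases p) auto
      qed
      have "s \<le> (\<Sum>p\<in>{..n} \<times> {..n}. ?g p)"
        unfolding F(2) using sub R by (intro sum_mono2) (auto simp: r_def)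
      also have "\<dots> \<le> (\<Sum>p\<in>{..n} \<times> {..n}. C * ((1/2) ^ fst p * (1/2) ^ snd p))"
        by (intro sum_mono) (use le in \<open>auto split: prod.splits\<close>)
      also have "\<dots> = C * ((\<Sum>i\<le>n. (1/2) ^ i) * (\<Sum>j\<le>n. (1/2) ^ j))"
        by (subst sum_distrib_left[symmetric]) (simp only: sum_product sum.cartesian_product case_prod_unfold)
      also have "\<dots> \<le> C * (2 * 2)"
        using C sum_power_le_2[of "1/2" n] by (intro mult_left_mono mult_mono) (auto simp: sum_nonneg)
      finally show "s \<le> C * (2 * 2)" .
    qed
  qed
  then show "convergent2 h" unfolding convergent2_def using R by (intro exI[of _ r]) (auto simp: r_def)
qed

text \<open>The bound is offered for every larger rate, so that two series can be estimated with a
  common one.\<close>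

lemma convergent2E:
  assumes "convergent2 h"
  obtains C R where "C > 0" "R \<ge> 1" "\<And>R' i j. R' \<ge> R \<Longrightarrow> norm (h $ j $ i) \<le> C * R' ^ (i + j)"
proof -
  from assms obtain C R where R: "0 < R" and b: "\<And>i j. norm (h $ j $ i) \<le> C * R ^ (i + j)"
    unfolding convergent2_iff by blast
  have "norm (h $ j $ i) \<le> (max C 1) * R' ^ (i + j)" if "R' \<ge> max R 1" for R' i j
  proof -
    have "norm (h $ j $ i) \<le> max C 1 * R ^ (i + j)"
      using b[of j i] R by (smt (verit, best) mult_right_mono zero_le_power)
    also have "\<dots> \<le> max C 1 * R' ^ (i + j)"
      using that R by (intro mult_left_mono power_mono) auto
    finally show ?thesis .
  qed
  then show ?thesis using that[of "max C 1" "max R 1"] by auto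
qed

lemma convergent2I:
  assumes "0 < R" "\<And>i j. norm (h $ j $ i) \<le> C * R ^ (i + j)"
  shows "convergent2 h"
  using assms unfolding convergent2_iff by blast

lemma convergent2_0 [simp]: "convergent2 0"
  by (rule convergent2I[of 1 _ 0]) auto

lemma conv1_const_iff [simp]: "convergent2 (fps_const a) \<longleftrightarrow> conv1 a"
proof
  assume "convergent2 (fps_const a)"
  then obtain C R where "C > 0" "R \<ge> 1"
    and b: "\<And>R' i j. R' \<ge> R \<Longrightarrow> norm (fps_const a $ j $ i) \<le> C * R' ^ (i + j)" by (rule convergent2E) blast
  have "norm (a $ k) \<le> C * R ^ k" for k using b[of R 0 k] by simp
  then show "conv1 a" unfolding conv1_def using \<open>R \<ge> 1\<close> by (intro exI[of _ C] exI[of _ R]) auto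
next
  assume "conv1 a"
  then obtain C R where R: "0 < R" "\<And>k. norm (a $ k) \<le> C * R ^ k" unfolding conv1_def by blast
  have "0 \<le> C" using order.trans[OF norm_ge_zero R(2)[of 0]] by simp
  then show "convergent2 (fps_const a)"
    using R by (intro convergent2I[of R _ C]) auto
qed

lemma convergent2_nth:
  assumes "convergent2 h" shows "conv1 (h $ j)"
proof -
  obtain C R where "C > 0" "R \<ge> 1"
    and b: "\<And>R' i j. R' \<ge> R \<Longrightarrow> norm (h $ j $ i) \<le> C * R' ^ (i + j)" using assms by (rule convergent2E) blast
  have "norm (h $ j $ k) \<le> (C * R ^ j) * R ^ k" for k using b[of R j k] by (simp add: power_add mult_ac)
  then show ?thesis unfolding conv1_def using \<open>R \<ge> 1\<close> by (intro exI[of _ "C * R ^ j"] exI[of _ R]) auto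
qed

lemma convergent2_finite_support:
  assumes "\<And>i j. i + j > N \<Longrightarrow> h $ j $ i = 0"
  shows "convergent2 h"
proof (rule convergent2I[of 1 _ "\<Sum>(i, j)\<in>{..N} \<times> {..N}. norm (h $ j $ i)"])
  fix i j
  show "norm (h $ j $ i) \<le> (\<Sum>(i, j)\<in>{..N} \<times> {..N}. norm (h $ j $ i)) * 1 ^ (i + j)"
  proof (cases "i + j \<le> N")
    case True
    then show ?thesis using member_le_sum[of "(i, j)" "{..N} \<times> {..N}" "\<lambda>(i, j). norm (h $ j $ i)"] by auto
  next
    case False
    then show ?thesis using assms[of i j] by (auto intro!: sum_nonneg)
  qed
qed auto

lemma convergent2_1 [simp]: "convergent2 1"
  by (rule convergent2_finite_support[of 0]) (auto simp: fps_one_nth)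

lemma convergent2_X [simp]: "convergent2 fps_X"
  by (rule convergent2_finite_support[of 1]) (auto simp: fps_X_def fps_one_nth)

lemma convergent2_add [intro]:
  assumes "convergent2 h" "convergent2 k" shows "convergent2 (h + k)"
proof -
  obtain C R where 1: "C > 0" "R \<ge> 1"
    "\<And>R' i j. R' \<ge> R \<Longrightarrow> norm (h $ j $ i) \<le> C * R' ^ (i + j)" using assms(1) by (rule convergent2E) blast
  obtain C' R2 where 2: "C' > 0" "R2 \<ge> 1"
    "\<And>R' i j. R' \<ge> R2 \<Longrightarrow> norm (k $ j $ i) \<le> C' * R' ^ (i + j)" using assms(2) by (rule convergent2E) blast
  show ?thesis
  proof (rule convergent2I)
    show "0 < max R R2" using 1 by auto
    show "norm ((h + k) $ j $ i) \<le> (C + C') * max R R2 ^ (i + j)" for i j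
      using norm_triangle_ineq[of "h $ j $ i" "k $ j $ i"] 1(3)[of "max R R2" j i] 2(3)[of "max R R2" j i]
      by (simp add: distrib_right)
  qed
qed

lemma Suc_le_power2: "real n + 1 \<le> 2 ^ n"
  by (induction n) auto

lemma convergent2_mult [intro]:
  assumes "convergent2 h" "convergent2 k" shows "convergent2 (h * k)"
proof -
  obtain C R where 1: "C > 0" "R \<ge> 1"
    "\<And>R' i j. R' \<ge> R \<Longrightarrow> norm (h $ j $ i) \<le> C * R' ^ (i + j)" using assms(1) by (rule convergent2E) blast
  obtain C' R2 where 2: "C' > 0" "R2 \<ge> 1"
    "\<And>R' i j. R' \<ge> R2 \<Longrightarrow> norm (k $ j $ i) \<le> C' * R' ^ (i + j)" using assms(2) by (rule convergent2E) blast
  define S where "S = max R R2"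
  have S: "S \<ge> 1" using 1 by (auto simp: S_def)
  show ?thesis
  proof (rule convergent2I)
    show "0 < 2 * S" using S by auto
    fix i j
    have "norm ((h * k) $ j $ i) \<le> (\<Sum>l=0..j. \<Sum>m=0..i. norm (h $ l $ m * k $ (j - l) $ (i - m)))"
      by (simp add: fps_mult_nth fps_sum_nth) (intro sum_norm_le order.trans[OF norm_sum] sum_mono, auto)
    also have "\<dots> \<le> (\<Sum>l=0..j. \<Sum>m=0..i. (C * C') * S ^ (i + j))"
    proof (intro sum_mono)
      fix l m assume lm: "l \<in> {0..j}" "m \<in> {0..i}"
      have "norm (h $ l $ m * k $ (j - l) $ (i - m)) \<le> (C * S ^ (m + l)) * (C' * S ^ ((i - m) + (j - l)))"
        unfolding norm_mult using 1 2 S by (intro mult_mono) (auto simp: S_def)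
      also have "\<dots> = (C * C') * S ^ ((m + l) + ((i - m) + (j - l)))"
        by (simp add: power_add mult_ac)
      also have "(m + l) + ((i - m) + (j - l)) = i + j" using lm by auto
      finally show "norm (h $ l $ m * k $ (j - l) $ (i - m)) \<le> (C * C') * S ^ (i + j)" .
    qed
    also have "\<dots> = (C * C') * S ^ (i + j) * ((real i + 1) * (real j + 1))"
      by (simp add: algebra_simps)
    \<comment> \<open>Doubling the rate absorbs the number of terms of the convolution.\<close>
    also have "\<dots> \<le> (C * C') * S ^ (i + j) * (2 ^ i * 2 ^ j)"
      using 1 2 S Suc_le_power2 by (intro mult_left_mono mult_mono) auto
    also have "\<dots> = (C * C') * (2 * S) ^ (i + j)" by (simp add: power_add power_mult_distrib mult_ac)
    finally show "norm ((h * k) $ j $ i) \<le> (C * C') * (2 * S) ^ (i + j)" .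
  qed
qed

lemma convergent2_minus1 [simp]: "convergent2 (- 1)"
  by (rule convergent2_finite_support[of 0]) (auto simp: fps_one_nth)

lemma convergent2_uminus [intro]: "convergent2 h \<Longrightarrow> convergent2 (- h)"
  using convergent2_mult[OF convergent2_minus1, of h] by simp

lemma convergent2_diff [intro]: "convergent2 h \<Longrightarrow> convergent2 k \<Longrightarrow> convergent2 (h - k)"
  using convergent2_add[OF _ convergent2_uminus, of h k] by simp

lemma convergent2_power [intro]: "convergent2 h \<Longrightarrow> convergent2 (h ^ n)"
  by (induction n) auto

lemma convergent2_sum [intro]: "(\<And>i. i \<in> A \<Longrightarrow> convergent2 (h i)) \<Longrightarrow> convergent2 (sum h A)"
  by (induction A rule: infinite_finite_induct) auto

lemma convergent2_prod [intro]: "(\<And>i. i \<in> A \<Longrightarrow> convergent2 (h i)) \<Longrightarrow> convergent2 (prod h A)"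
  by (induction A rule: infinite_finite_induct) auto

text \<open>The equation \<open>h * k = 1\<close> determines each coefficient of \<open>k\<close>
  from those of smaller total degree. The geometric bound passes through this recursion once its
  rate is large compared with that of \<open>h\<close>.\<close>

lemma convergent2_inverse:
  assumes "convergent2 h" "h $ 0 $ 0 \<noteq> 0"
  shows "\<exists>k. convergent2 k \<and> h * k = 1"
proof -
  define k where "k = fps_right_inverse h (inverse (h $ 0))"
  have hk: "h * k = 1"
    unfolding k_def by (rule fps_right_inverse) (use assms in \<open>simp add: inverse_mult_eq_1'\<close>)
  obtain C \<rho> where 1: "C > 0" "\<rho> \<ge> 1"
    "\<And>R' i j. R' \<ge> \<rho> \<Longrightarrow> norm (h $ j $ i) \<le> C * R' ^ (i + j)" using assms(1) by (rule convergent2E) blast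
  define a where "a = norm (h $ 0 $ 0)"
  have a: "a > 0" using assms by (auto simp: a_def)
  \<comment> \<open>The ratio of the rates of \<open>h\<close> and \<open>k\<close>. The geometric
    sum without its constant term is at most \<open>8 * z\<close>, so
    \<open>8 * C * z \<le> a\<close> lets the induction return the bound it started from.\<close>
  define z where "z = min (1/2) (a / (8 * C))"
  have z: "0 < z" "z \<le> 1/2" "8 * C * z \<le> a"
    using a 1 by (auto simp: z_def min_def field_simps)
  define R where "R = \<rho> / z"
  have R: "R > 0" "\<rho> = z * R" using 1 z by (auto simp: R_def)
  have bound: "norm (k $ j $ i) \<le> (1 / a) * R ^ (i + j)" for i j
  proof (induction "i + j" arbitrary: i j rule: less_induct)
    case less
    let ?T = "{0..j} \<times> {0..i} - {(0, 0)}"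
    have "(h * k) $ j $ i = (\<Sum>(l, m)\<in>{0..j} \<times> {0..i}. h $ l $ m * k $ (j - l) $ (i - m))"
      by (simp add: fps_mult_nth fps_sum_nth sum.cartesian_product)
    also have "\<dots> = h $ 0 $ 0 * k $ j $ i + (\<Sum>(l, m)\<in>?T. h $ l $ m * k $ (j - l) $ (i - m))"
      by (subst sum.remove[of _ "(0, 0)"]) auto
    finally have eq: "h $ 0 $ 0 * k $ j $ i =
        (1 :: series2) $ j $ i - (\<Sum>(l, m)\<in>?T. h $ l $ m * k $ (j - l) $ (i - m))"
      using hk by simp
    show ?case
    proof (cases "i = 0 \<and> j = 0")
      case True
      then have "h $ 0 $ 0 * k $ 0 $ 0 = 1" using eq by simp
      then have "a * norm (k $ 0 $ 0) = 1" by (metis a_def norm_mult norm_one)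
      then show ?thesis using a True by (simp add: field_simps)
    next
      case False
      then have one: "(1 :: series2) $ j $ i = 0" by (auto simp: fps_one_nth)
      have "(\<Sum>(l, m)\<in>?T. z ^ l * z ^ m) = (\<Sum>l\<le>j. z ^ l) * (\<Sum>m\<le>i. z ^ m) - 1"
      proof -
        have "(\<Sum>l\<le>j. z ^ l) * (\<Sum>m\<le>i. z ^ m) = (\<Sum>(l, m)\<in>{0..j} \<times> {0..i}. z ^ l * z ^ m)"
          by (simp add: sum_product sum.cartesian_product atLeast0AtMost)
        also have "\<dots> = 1 + (\<Sum>(l, m)\<in>?T. z ^ l * z ^ m)"
          by (subst sum.remove[of _ "(0, 0)"]) auto
        finally show ?thesis by simp
      qed
      also have "\<dots> \<le> (1 + 2 * z) * (1 + 2 * z) - 1"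
        using sum_power_le_2[of z] z by (intro diff_right_mono mult_mono) (auto simp: sum_nonneg)
      also have "\<dots> \<le> 8 * z"
        using mult_left_mono[of z "1/2" z] z by (simp add: algebra_simps)
      finally have T8: "(\<Sum>(l, m)\<in>?T. z ^ l * z ^ m) \<le> 8 * z" .
      then have "a * norm (k $ j $ i) = norm (\<Sum>(l, m)\<in>?T. h $ l $ m * k $ (j - l) $ (i - m))"
        using eq one by (simp add: a_def flip: norm_mult)
      also have "\<dots> \<le> (\<Sum>(l, m)\<in>?T. (C / a) * R ^ (i + j) * (z ^ l * z ^ m))"
      proof (rule sum_norm_le)
        fix p assume "p \<in> ?T"
        moreover obtain l m where p: "p = (l, m)" by (cases p)
        ultimately have lm: "l \<le> j" "m \<le> i" "l = 0 \<longrightarrow> 0 < m" by auto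
        have "norm (h $ l $ m * k $ (j - l) $ (i - m)) \<le> (C * \<rho> ^ (m + l)) * ((1 / a) * R ^ ((i - m) + (j - l)))"
          unfolding norm_mult using 1 lm a by (intro mult_mono less) auto
        also have "\<dots> = (C / a) * R ^ ((m + l) + ((i - m) + (j - l))) * (z ^ l * z ^ m)"
          by (simp add: power_add R(2) power_mult_distrib mult_ac)
        also have "(m + l) + ((i - m) + (j - l)) = i + j" using lm by auto
        finally show "norm (case p of (l, m) \<Rightarrow> h $ l $ m * k $ (j - l) $ (i - m))
            \<le> (case p of (l, m) \<Rightarrow> (C / a) * R ^ (i + j) * (z ^ l * z ^ m))" by (simp add: p)
      qed
      also have "\<dots> = (C / a) * R ^ (i + j) * (\<Sum>(l, m)\<in>?T. z ^ l * z ^ m)"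
        by (simp add: sum_distrib_left case_prod_unfold)
      also have "\<dots> \<le> (C / a) * R ^ (i + j) * (8 * z)"
        using T8 1 a R by (intro mult_left_mono) auto
      also have "\<dots> = (8 * C * z) * R ^ (i + j) / a" by simp
      also have "\<dots> \<le> a * R ^ (i + j) / a"
        using z a R by (intro divide_right_mono mult_right_mono) auto
      finally show ?thesis using a by (simp add: field_simps)
    qed
  qed
  have "convergent2 k" by (rule convergent2I[OF R(1) bound])
  with hk show ?thesis by blast
qed

text \<open>Coefficients, ordered by the degree in \<open>x\<close>, of the solution \<open>q\<close> of \<open>q = fps_shift n (h - q * B)\<close>.\<close>

function wdiv :: "nat \<Rightarrow> series2 \<Rightarrow> series2 \<Rightarrow> nat \<Rightarrow> nat \<Rightarrow> complex" where
  "wdiv n h B i j =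
     h $ (j + n) $ i - (\<Sum>k\<in>{..<i}. \<Sum>l\<le>j + n. B $ l $ (i - k) * wdiv n h B k (j + n - l))"
  by pat_completeness auto
termination by (relation "Wellfounded.measure (\<lambda>(n, h, B, i, j). i)") auto

declare wdiv.simps [simp del]

text \<open>As \<open>B\<close> vanishes at \<open>x = 0\<close>, the coefficient of
  \<open>x^i\<close> in \<open>B * q\<close> involves only lower coefficients of \<open>q\<close>.
  Hence \<open>q\<close> is found by recursion on \<open>i\<close>; convergence needs different
  rates in \<open>x\<close> and \<open>y\<close>.\<close>

lemma weierstrass_division_monic:
  assumes h: "convergent2 h" and B: "convergent2 B" and B0: "\<And>j. B $ j $ 0 = 0"
  shows "\<exists>q r. convergent2 q \<and> convergent2 r \<and> h = q * (fps_X ^ n + B) + r \<and> (\<forall>j\<ge>n. r $ j = 0)"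
proof -
  define q where "q = Abs_fps (\<lambda>j. Abs_fps (\<lambda>i. wdiv n h B i j))"
  have q_nth: "q $ j $ i = wdiv n h B i j" for i j by (simp add: q_def)
  have rec: "q $ j = (h - B * q) $ (j + n)" for j
  proof (rule fps_ext)
    fix i
    have rev: "(\<Sum>k\<le>i. g k) = (\<Sum>k\<le>i. g (i - k))" for g :: "nat \<Rightarrow> complex"
      using sum.atLeastAtMost_rev[of g 0 i] by (simp add: atLeast0AtMost)
    have inner: "(\<Sum>m\<le>i. B $ l $ m * q $ (j + n - l) $ (i - m)) =
        (\<Sum>k\<le>i. B $ l $ (i - k) * q $ (j + n - l) $ k)" for l
      by (subst rev) simp
    have "(B * q) $ (j + n) $ i = (\<Sum>l\<le>j + n. \<Sum>k\<le>i. B $ l $ (i - k) * q $ (j + n - l) $ k)"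
      by (simp add: fps_mult_nth fps_sum_nth atLeast0AtMost inner)
    also have "\<dots> = (\<Sum>k\<le>i. \<Sum>l\<le>j + n. B $ l $ (i - k) * q $ (j + n - l) $ k)"
      by (rule sum.swap)
    also have "\<dots> = (\<Sum>k<i. \<Sum>l\<le>j + n. B $ l $ (i - k) * q $ (j + n - l) $ k)"
      by (simp add: B0 flip: lessThan_Suc_atMost)
    finally show "q $ j $ i = (h - B * q) $ (j + n) $ i"
      by (simp add: q_nth) (subst wdiv.simps, simp)
  qed
  obtain H \<rho>1 where 1: "H > 0" "\<rho>1 \<ge> 1"
    "\<And>R' i j. R' \<ge> \<rho>1 \<Longrightarrow> norm (h $ j $ i) \<le> H * R' ^ (i + j)" using h by (rule convergent2E) blast
  obtain C \<rho>2 where 2: "C > 0" "\<rho>2 \<ge> 1"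
    "\<And>R' i j. R' \<ge> \<rho>2 \<Longrightarrow> norm (B $ j $ i) \<le> C * R' ^ (i + j)" using B by (rule convergent2E) blast
  define \<rho> where "\<rho> = max \<rho>1 \<rho>2"
  have \<rho>: "\<rho> \<ge> 1" "\<rho> \<ge> \<rho>1" "\<rho> \<ge> \<rho>2" using 1 by (auto simp: \<rho>_def)
  \<comment> \<open>The rate of \<open>q\<close> in \<open>y\<close> is twice that of
    \<open>B\<close>, which makes the sum over \<open>l\<close> a geometric series of ratio one
    half.\<close>
  define \<sigma> where "\<sigma> = 2 * \<rho>"
  have \<sigma>: "\<sigma> \<ge> 1" "\<rho> \<le> \<sigma>" using \<rho> by (auto simp: \<sigma>_def)
  \<comment> \<open>The shift by \<open>n\<close> in \<open>y\<close> costs a factor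
    \<open>\<sigma> ^ n\<close>; a large rate in \<open>x\<close>, that is a small \<open>z\<close>,
    pays for it.\<close>
  define z where "z = min (1/2) (1 / (8 * C * \<sigma> ^ n))"
  have z: "0 < z" "z \<le> 1/2" "8 * C * \<sigma> ^ n * z \<le> 1"
    using 2 \<sigma> by (auto simp: z_def min_def field_simps)
  define R where "R = \<rho> / z"
  have R: "\<rho> = z * R" "\<rho> \<le> R" using \<rho> z by (auto simp: R_def field_simps mult_le_one)
  \<comment> \<open>Half of \<open>K\<close> covers the contribution of \<open>h\<close>, the other
    half that of \<open>B * q\<close>.\<close>
  define K where "K = 2 * H * \<sigma> ^ n"
  have K: "K > 0" using 1 \<sigma> by (auto simp: K_def)
  have bound: "norm (q $ j $ i) \<le> K * R ^ i * \<sigma> ^ j" for i j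
  proof (induction i arbitrary: j rule: less_induct)
    case (less i)
    have "norm (h $ (j + n) $ i) \<le> H * \<rho> ^ (i + (j + n))" using 1 \<rho> by auto
    also have "\<dots> = H * (\<rho> ^ i * \<rho> ^ (j + n))" by (simp add: power_add)
    also have "\<dots> \<le> H * (R ^ i * \<sigma> ^ (j + n))"
      using 1 \<rho> \<sigma> R by (intro mult_left_mono mult_mono power_mono) auto
    finally have hb: "norm (h $ (j + n) $ i) \<le> (K / 2) * R ^ i * \<sigma> ^ j"
      by (simp add: K_def power_add mult_ac)
    have "norm (\<Sum>k<i. \<Sum>l\<le>j + n. B $ l $ (i - k) * q $ (j + n - l) $ k) \<le>
        (\<Sum>k<i. \<Sum>l\<le>j + n. C * K * R ^ i * \<sigma> ^ (j + n) * (z ^ (i - k) * (1/2) ^ l))"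
    proof (intro sum_norm_le)
      fix k l assume kl: "k \<in> {..<i}" "l \<in> {..j + n}"
      have "norm (B $ l $ (i - k) * q $ (j + n - l) $ k) \<le>
          (C * \<rho> ^ (i - k + l)) * (K * R ^ k * \<sigma> ^ (j + n - l))"
        unfolding norm_mult using 2(1) 2(3)[of \<rho> l "i - k"] \<rho> kl by (intro mult_mono less) auto
      also have "\<dots> = (C * K) * (\<rho> ^ (i - k) * R ^ k) * (\<rho> ^ l * \<sigma> ^ (j + n - l))"
        by (simp add: power_add mult_ac)
      also have "\<rho> ^ (i - k) * R ^ k = z ^ (i - k) * R ^ ((i - k) + k)"
        unfolding R(1) by (simp add: power_mult_distrib power_add)
      also have "(i - k) + k = i" using kl by auto
      also have "\<rho> ^ l * \<sigma> ^ (j + n - l) = (1/2) ^ l * \<sigma> ^ (l + (j + n - l))"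
        unfolding \<sigma>_def by (simp add: power_mult_distrib power_add power_divide)
      also have "l + (j + n - l) = j + n" using kl by auto
      finally show "norm (B $ l $ (i - k) * q $ (j + n - l) $ k) \<le>
          C * K * R ^ i * \<sigma> ^ (j + n) * (z ^ (i - k) * (1/2) ^ l)" by (simp add: mult_ac)
    qed
    also have "\<dots> = C * K * R ^ i * \<sigma> ^ (j + n) * ((\<Sum>k<i. z ^ (i - k)) * (\<Sum>l\<le>j + n. (1/2) ^ l))"
      by (rule sum_scaled_product)
    also have "\<dots> \<le> C * K * R ^ i * \<sigma> ^ (j + n) * (2 * z * 2)"
    proof -
      have "(\<Sum>k<i. z ^ (i - k)) + 1 = (\<Sum>k\<le>i. z ^ (i - k))"
        by (simp flip: lessThan_Suc_atMost)
      also have "\<dots> = (\<Sum>k\<le>i. z ^ k)"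
        using sum.atLeastAtMost_rev[of "\<lambda>k. z ^ k" 0 i] by (simp add: atLeast0AtMost)
      finally have "(\<Sum>k<i. z ^ (i - k)) \<le> 2 * z"
        using sum_power_le_2[of z i] z by linarith
      then show ?thesis
        using sum_power_le_2[of "1/2" "j + n"] 2 K R \<rho> \<sigma> z
        by (intro mult_left_mono mult_mono) (auto simp: sum_nonneg)
    qed
    also have "\<dots> = (8 * C * \<sigma> ^ n * z) * ((K / 2) * R ^ i * \<sigma> ^ j)"
      by (simp add: power_add)
    also have "\<dots> \<le> 1 * ((K / 2) * R ^ i * \<sigma> ^ j)"
      using z K R \<rho> \<sigma> by (intro mult_right_mono) auto
    finally have "norm (\<Sum>k<i. \<Sum>l\<le>j + n. B $ l $ (i - k) * q $ (j + n - l) $ k) \<le> (K / 2) * R ^ i * \<sigma> ^ j"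
      by simp
    moreover have "q $ j $ i = h $ (j + n) $ i - (\<Sum>k<i. \<Sum>l\<le>j + n. B $ l $ (i - k) * q $ (j + n - l) $ k)"
      unfolding q_nth by (subst wdiv.simps) simp
    ultimately show ?case
      using hb norm_triangle_ineq4[of "h $ (j + n) $ i" "\<Sum>k<i. \<Sum>l\<le>j + n. B $ l $ (i - k) * q $ (j + n - l) $ k"]
      by simp
  qed
  have q: "convergent2 q"
  proof (rule convergent2I)
    show "0 < max R \<sigma>" using \<sigma> by auto
    fix i j
    note bound[of j i]
    also have "K * R ^ i * \<sigma> ^ j \<le> K * (max R \<sigma> ^ i * max R \<sigma> ^ j)"
      unfolding mult.assoc using K \<sigma> R \<rho> by (intro mult_left_mono mult_mono power_mono) auto
    finally show "norm (q $ j $ i) \<le> K * max R \<sigma> ^ (i + j)" by (simp add: power_add)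
  qed
  define r where "r = h - q * (fps_X ^ n + B)"
  have "r $ j = 0" if "j \<ge> n" for j
  proof -
    have "(q * fps_X ^ n) $ j = q $ (j - n)"
      using that by (simp add: fps_X_power_mult_right_nth)
    then show ?thesis
      using rec[of "j - n"] that by (simp add: r_def distrib_left mult.commute)
  qed
  moreover have "convergent2 r"
    unfolding r_def using h B q by (intro convergent2_diff convergent2_mult convergent2_add convergent2_power) auto
  moreover have "h = q * (fps_X ^ n + B) + r" by (simp add: r_def)
  ultimately show ?thesis using q by blast
qed

definition y_order :: "series2 \<Rightarrow> nat \<Rightarrow> bool" where
  "y_order f n \<longleftrightarrow> (\<forall>j<n. f $ j $ 0 = 0) \<and> f $ n $ 0 \<noteq> 0"

text \<open>Write \<open>f = U y^n + A\<close> with \<open>U\<close> a unit and \<open>A\<close> of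
  degree below \<open>n\<close> in \<open>y\<close>, vanishing at \<open>x = 0\<close>.
  Multiplication by the inverse of \<open>U\<close> leads to the monic case.\<close>

theorem weierstrass_division:
  assumes f: "convergent2 f" and n: "y_order f n" and h: "convergent2 h"
  shows "\<exists>q r. convergent2 q \<and> convergent2 r \<and> h = q * f + r \<and> (\<forall>j\<ge>n. r $ j = 0)"
proof -
  define U where "U = fps_shift n f"
  define A where "A = fps_cutoff n f"
  have A: "convergent2 A"
  proof -
    have "A = (\<Sum>j<n. fps_const (f $ j) * fps_X ^ j)"
      by (rule fps_ext) (auto simp: A_def fps_sum_nth fps_X_power_nth if_distrib[of "\<lambda>x. _ * x"] cong: if_cong)
    then show ?thesis using f convergent2_nth by (auto intro!: convergent2_sum convergent2_mult)
  qed
  have U: "convergent2 U"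
  proof -
    obtain C R where "C > 0" "R \<ge> 1"
      and b: "\<And>R' i j. R' \<ge> R \<Longrightarrow> norm (f $ j $ i) \<le> C * R' ^ (i + j)" using f by (rule convergent2E) blast
    show ?thesis
    proof (rule convergent2I[of R _ "C * R ^ n"])
      show "norm (U $ j $ i) \<le> C * R ^ n * R ^ (i + j)" for i j
        using b[of R "j + n" i] by (simp add: U_def power_add mult_ac)
    qed (use \<open>R \<ge> 1\<close> in auto)
  qed
  have fUA: "f = U * fps_X ^ n + A"
    unfolding U_def A_def by (rule fps_ext) (simp add: fps_X_power_mult_right_nth)
  obtain V where V: "convergent2 V" "U * V = 1"
    using convergent2_inverse[OF U] n by (auto simp: U_def y_order_def)
  have fV: "f * V = fps_X ^ n + A * V"
    using V(2) by (simp add: fUA algebra_simps)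
  have "(A * V) $ j $ 0 = 0" for j
    using n by (auto simp: fps_mult_nth fps_sum_nth A_def y_order_def intro!: sum.neutral)
  from weierstrass_division_monic[OF h convergent2_mult[OF A V(1)] this, of n]
  obtain q r where "convergent2 q" "convergent2 r" "h = q * (f * V) + r" "\<forall>j\<ge>n. r $ j = 0"
    unfolding fV by blast
  then show ?thesis
    using V by (intro exI[of _ "q * V"] exI[of _ r]) (auto simp: mult_ac)
qed

section \<open>Substitutions\<close>

definition ram :: "nat \<Rightarrow> complex fps \<Rightarrow> complex fps" where
  "ram N a = fps_compose a (fps_X ^ N)"

text \<open>The substitution of \<open>e t\<close> for \<open>t\<close>. For a primitive
  \<open>N\<close>-th root of unity it generates the Galois group of the series in \<open>t\<close>
  over those in \<open>t^N\<close>.\<close>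

definition rot :: "complex \<Rightarrow> complex fps \<Rightarrow> complex fps" where
  "rot e a = Abs_fps (\<lambda>k. e ^ k * a $ k)"

definition lift :: "(complex fps \<Rightarrow> complex fps) \<Rightarrow> series2 \<Rightarrow> series2" where
  "lift \<sigma> h = Abs_fps (\<lambda>j. \<sigma> (h $ j))"

text \<open>Common frame for \<open>ram\<close> and \<open>rot\<close>, so that their action on
  coefficients and their compatibility with \<open>subst_y\<close> are proved once.\<close>

locale subst_hom =
  fixes \<sigma> :: "complex fps \<Rightarrow> complex fps"
  assumes add: "\<sigma> (a + b) = \<sigma> a + \<sigma> b"
    and mult: "\<sigma> (a * b) = \<sigma> a * \<sigma> b"
    and one: "\<sigma> 1 = 1"
    and nth_0: "\<sigma> a $ 0 = a $ 0"
    and inj: "\<sigma> a = 0 \<Longrightarrow> a = 0"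
begin

lemma zero [simp]: "\<sigma> 0 = 0"
  using add[of 0 0] by simp

lemma eq_0_iff [simp]: "\<sigma> a = 0 \<longleftrightarrow> a = 0"
  using inj by auto

lemma uminus: "\<sigma> (- a) = - \<sigma> a"
  using add[of a "- a"] by (simp add: eq_neg_iff_add_eq_0 add.commute)

lemma diff: "\<sigma> (a - b) = \<sigma> a - \<sigma> b"
  using add[of a "- b"] by (simp add: uminus)

lemma eq_iff: "\<sigma> a = \<sigma> b \<longleftrightarrow> a = b"
  using inj[of "a - b"] by (auto simp: diff)

lemma sum: "\<sigma> (sum a A) = (\<Sum>i\<in>A. \<sigma> (a i))"
  by (induction A rule: infinite_finite_induct) (auto simp: add)

lemma prod: "\<sigma> (prod a A) = (\<Prod>i\<in>A. \<sigma> (a i))"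
  by (induction A rule: infinite_finite_induct) (auto simp: mult one)

lemma power: "\<sigma> (a ^ n) = \<sigma> a ^ n"
  by (induction n) (auto simp: mult one)

lemma of_nat: "\<sigma> (of_nat n) = of_nat n"
  by (induction n) (auto simp: add one)

lemma lift_nth [simp]: "lift \<sigma> h $ j = \<sigma> (h $ j)"
  by (simp add: lift_def)

lemma lift_add: "lift \<sigma> (h + k) = lift \<sigma> h + lift \<sigma> k"
  by (rule fps_ext) (simp add: add)

lemma lift_diff: "lift \<sigma> (h - k) = lift \<sigma> h - lift \<sigma> k"
  by (rule fps_ext) (simp add: diff)

lemma lift_mult: "lift \<sigma> (h * k) = lift \<sigma> h * lift \<sigma> k"
  by (rule fps_ext) (simp add: fps_mult_nth sum mult)

lemma lift_const [simp]: "lift \<sigma> (fps_const a) = fps_const (\<sigma> a)"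
  by (rule fps_ext) simp

lemma lift_1 [simp]: "lift \<sigma> 1 = 1"
  by (rule fps_ext) (simp add: fps_one_nth one)

lemma lift_0 [simp]: "lift \<sigma> 0 = 0"
  by (rule fps_ext) simp

lemma lift_X [simp]: "lift \<sigma> fps_X = fps_X"
  by (rule fps_ext) (simp add: fps_X_nth one)

lemma lift_sum: "lift \<sigma> (sum a A) = (\<Sum>i\<in>A. lift \<sigma> (a i))"
  by (induction A rule: infinite_finite_induct) (auto simp: lift_add)

lemma lift_prod: "lift \<sigma> (prod a A) = (\<Prod>i\<in>A. lift \<sigma> (a i))"
  by (induction A rule: infinite_finite_induct) (auto simp: lift_mult)

lemma lift_power: "lift \<sigma> (a ^ n) = lift \<sigma> a ^ n"
  by (induction n) (auto simp: lift_mult)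

lemma lift_eq_iff: "lift \<sigma> h = lift \<sigma> k \<longleftrightarrow> h = k"
  by (auto simp: fps_eq_iff[of "lift \<sigma> h"] eq_iff fps_eq_iff[of h])

lemma lift_deriv: "lift \<sigma> (fps_deriv h) = fps_deriv (lift \<sigma> h)"
  by (rule fps_ext) (simp add: mult of_nat add one flip: of_nat_Suc)

end

lemma ram_nth: "N > 0 \<Longrightarrow> ram N a $ k = (if N dvd k then a $ (k div N) else 0)"
  by (simp add: ram_def fps_nth_compose_X_power)

lemma ram_nth_mult [simp]: "N > 0 \<Longrightarrow> ram N a $ (N * k) = a $ k"
  by (simp add: ram_nth)

lemma subst_hom_ram: assumes "N > 0" shows "subst_hom (ram N)"
proof
  have [simp]: "(fps_X ^ N :: complex fps) $ 0 = 0" using assms by simp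
  show "ram N (a + b) = ram N a + ram N b" for a b by (simp add: ram_def fps_compose_add_distrib)
  show "ram N (a * b) = ram N a * ram N b" for a b unfolding ram_def by (rule fps_compose_mult_distrib) fact
  show "ram N 1 = 1" by (simp add: ram_def)
  show "ram N a $ 0 = a $ 0" for a by (simp add: ram_def)
  show "a = 0" if "ram N a = 0" for a
    by (rule fps_ext) (metis that assms ram_nth_mult fps_zero_nth)
qed

lemma rot_nth [simp]: "rot e a $ k = e ^ k * a $ k"
  by (simp add: rot_def)

lemma subst_hom_rot: assumes "e \<noteq> 0" shows "subst_hom (rot e)"
proof
  show "rot e (a + b) = rot e a + rot e b" for a b
    by (rule fps_ext) (simp add: algebra_simps)
  show "rot e (a * b) = rot e a * rot e b" for a b
  proof (rule fps_ext)
    fix n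
    have "e ^ n * (a $ i * b $ (n - i)) = (e ^ i * a $ i) * (e ^ (n - i) * b $ (n - i))" if "i \<in> {0..n}" for i
    proof -
      have "e ^ n = e ^ i * e ^ (n - i)" using that by (simp flip: power_add)
      then show ?thesis by simp
    qed
    then show "rot e (a * b) $ n = (rot e a * rot e b) $ n"
      unfolding fps_mult_nth sum_distrib_left rot_nth by (rule sum.cong[OF refl])
  qed
  show "rot e 1 = 1" by (rule fps_ext) (simp add: fps_one_nth)
  show "rot e a $ 0 = a $ 0" for a by simp
  show "a = 0" if "rot e a = 0" for a
    by (rule fps_ext) (use that assms in \<open>auto simp: fps_eq_iff\<close>)
qed

lemma rot_rot: "rot e (rot e' a) = rot (e * e') a"
  by (rule fps_ext) (simp add: power_mult_distrib mult_ac)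

lemma rot_1 [simp]: "rot 1 a = a"
  by (rule fps_ext) simp

lemma ram_ram: "M > 0 \<Longrightarrow> N > 0 \<Longrightarrow> ram M (ram N a) = ram (M * N) a"
proof (rule fps_ext)
  fix k assume "M > 0" "N > 0"
  then show "ram M (ram N a) $ k = ram (M * N) a $ k"
  proof (cases "M dvd k")
    case True
    then obtain m where "k = M * m" ..
    then show ?thesis using \<open>M > 0\<close> \<open>N > 0\<close> by (simp add: ram_nth div_mult2_eq)
  next
    case False
    then have "\<not> M * N dvd k" using dvd_mult_left by blast
    then show ?thesis using False \<open>M > 0\<close> \<open>N > 0\<close> by (simp add: ram_nth)
  qed
qed

lemma ram_1 [simp]: "ram 1 a = a"
  by (rule fps_ext) (simp add: ram_nth)

lemma ram_X: "N > 0 \<Longrightarrow> ram N fps_X = fps_X ^ N"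
  by (simp add: ram_def)

lemma ramify_eq_lift: "ramify N = lift (ram N)"
  by (rule ext) (simp add: ramify_def lift_def ram_def)

lemma ramify_ramify: "M > 0 \<Longrightarrow> N > 0 \<Longrightarrow> ramify M (ramify N h) = ramify (M * N) h"
  by (rule fps_ext) (simp add: ramify_eq_lift lift_def ram_ram)

lemma subdegree_ram: assumes "N > 0" shows "subdegree (ram N a) = N * subdegree a"
proof (cases "a = 0")
  case True then show ?thesis by (simp add: subst_hom.zero[OF subst_hom_ram[OF assms]])
next
  case False
  then show ?thesis
  proof (intro subdegreeI)
    show "ram N a $ (N * subdegree a) \<noteq> 0" using False assms by simp
    show "ram N a $ k = 0" if "k < N * subdegree a" for k
    proof -
      have "a $ (k div N) = 0"
        using that by (intro nth_less_subdegree_zero) (simp add: less_mult_imp_div_less mult.commute)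
      then show ?thesis using assms by (simp add: ram_nth)
    qed
  qed
qed

lemma subdegree_rot: assumes "e \<noteq> 0" shows "subdegree (rot e a) = subdegree a"
proof (cases "a = 0")
  case True then show ?thesis by (simp add: subst_hom.zero[OF subst_hom_rot[OF assms]])
next
  case False
  then have "rot e a $ subdegree a \<noteq> 0" using assms by simp
  then show ?thesis by (rule subdegreeI) (auto intro: nth_less_subdegree_zero)
qed

section \<open>Convergent series in one variable\<close>

lemma conv1_bound:
  assumes "conv1 a"
  obtains C R where "C > 0" "R \<ge> 1" "\<And>R' k. R' \<ge> R \<Longrightarrow> norm (a $ k) \<le> C * R' ^ k"
proof -
  from assms have "convergent2 (fps_const a)" by simp
  then obtain C R where "C > 0" "R \<ge> 1"
    "\<And>R' i j. R' \<ge> R \<Longrightarrow> norm (fps_const a $ j $ i) \<le> C * R' ^ (i + j)" by (rule convergent2E) blast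
  from this(1,2) this(3)[of _ 0] show ?thesis by (intro that[of C R]) auto
qed

text \<open>Connects the coefficient bounds with the radius of convergence that appears in
  \<open>Newton_Puiseux_polar\<close>.\<close>

lemma conv1_iff_radius: "conv1 a \<longleftrightarrow> fps_conv_radius a > 0"
proof
  assume "conv1 a"
  then obtain C R where CR: "C > 0" "R \<ge> 1" "\<And>R' k. R' \<ge> R \<Longrightarrow> norm (a $ k) \<le> C * R' ^ k"
    by (rule conv1_bound) blast
  define r where "r = 1 / (2 * R)"
  have r: "norm (complex_of_real r) = r" using CR by (simp add: r_def norm_divide)
  have "summable (\<lambda>n. a $ n * of_real r ^ n)"
  proof (rule summable_comparison_test'[of "\<lambda>n. C * (1/2) ^ n" 0])
    show "summable (\<lambda>n. C * (1/2) ^ n)" by (intro summable_mult summable_geometric) auto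
    fix n
    have "norm (a $ n * of_real r ^ n) \<le> (C * R ^ n) * r ^ n"
      unfolding norm_mult norm_power r by (intro mult_mono CR order.refl) (use CR in \<open>auto simp: r_def\<close>)
    also have "\<dots> = C * (R * r) ^ n" by (simp add: power_mult_distrib)
    also have "R * r = 1/2" using CR by (simp add: r_def)
    finally show "norm (a $ n * of_real r ^ n) \<le> C * (1/2) ^ n" .
  qed
  then have "conv_radius (($) a) \<ge> norm (of_real r :: complex)"
    by (rule conv_radius_geI)
  moreover have r: "r > 0" using CR by (simp add: r_def)
  ultimately have "ereal r \<le> fps_conv_radius a" by (simp add: fps_conv_radius_def)
  moreover have "0 < ereal r" using r by simp
  ultimately show "fps_conv_radius a > 0" by (rule less_le_trans[rotated])
next
  assume "fps_conv_radius a > 0"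
  then obtain r where r: "0 < r" "ereal r < fps_conv_radius a"
    using ereal_dense2[of 0 "fps_conv_radius a"] by auto
  then have "summable (\<lambda>n. a $ n * of_real r ^ n)"
    unfolding fps_conv_radius_def by (intro summable_in_conv_radius) auto
  then have "Bseq (\<lambda>n. a $ n * of_real r ^ n)"
    by (intro convergent_imp_Bseq) (auto simp: convergent_def dest: summable_LIMSEQ_zero)
  then obtain K where K: "\<And>n. norm (a $ n * of_real r ^ n) \<le> K" by (auto simp: Bseq_def)
  have "norm (a $ n) \<le> K * (1 / r) ^ n" for n
    using K[of n] r by (simp add: norm_mult norm_power power_divide field_simps)
  then show "conv1 a" unfolding conv1_def using r by (intro exI[of _ K] exI[of _ "1 / r"]) auto
qed

lemma conv1_mult: "conv1 a \<Longrightarrow> conv1 b \<Longrightarrow> conv1 (a * b)"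
  using convergent2_mult[of "fps_const a" "fps_const b"] by (simp flip: conv1_const_iff)

lemma conv1_add: "conv1 a \<Longrightarrow> conv1 b \<Longrightarrow> conv1 (a + b)"
  using convergent2_add[of "fps_const a" "fps_const b"] by (simp flip: conv1_const_iff)

lemma conv1_diff: "conv1 a \<Longrightarrow> conv1 b \<Longrightarrow> conv1 (a - b)"
  using convergent2_diff[of "fps_const a" "fps_const b"] by (simp flip: conv1_const_iff)

lemma conv1_finite_support: "(\<And>k. k > N \<Longrightarrow> a $ k = 0) \<Longrightarrow> conv1 a"
  unfolding conv1_const_iff[symmetric]
  by (rule convergent2_finite_support[of N]) auto

lemma conv1_0 [simp]: "conv1 0" by (rule conv1_finite_support[of 0]) auto
lemma conv1_1 [simp]: "conv1 1" by (rule conv1_finite_support[of 0]) auto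
lemma conv1_const [simp]: "conv1 (fps_const c)" by (rule conv1_finite_support[of 0]) auto
lemma conv1_X_power [simp]: "conv1 (fps_X ^ n)" by (rule conv1_finite_support[of n]) auto
lemma conv1_X [simp]: "conv1 fps_X" by (rule conv1_finite_support[of 1]) (auto simp: fps_X_nth)

lemma conv1_prod: "(\<And>i. i \<in> A \<Longrightarrow> conv1 (a i)) \<Longrightarrow> conv1 (prod a A)"
  by (induction A rule: infinite_finite_induct) (auto intro: conv1_mult)

lemma conv1_shift: assumes "conv1 a" shows "conv1 (fps_shift n a)"
proof -
  obtain C R where CR: "C > 0" "R \<ge> 1" "\<And>R' k. R' \<ge> R \<Longrightarrow> norm (a $ k) \<le> C * R' ^ k"
    using assms by (rule conv1_bound) blast
  have "norm (fps_shift n a $ k) \<le> C * R ^ n * R ^ k" for k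
    using CR(3)[of R "k + n"] by (simp add: power_add mult_ac)
  then show ?thesis unfolding conv1_def using CR by (intro exI[of _ "C * R ^ n"] exI[of _ R]) auto
qed

text \<open>After removal of the power of the variable dividing \<open>b\<close>, a unit remains.
  The case \<open>a = 0\<close> is listed because \<open>subdegree 0 = 0\<close>.\<close>

lemma conv1_divide:
  assumes "conv1 a" "conv1 b" "b \<noteq> 0" "subdegree a \<ge> subdegree b \<or> a = 0"
  obtains c where "conv1 c" "a = c * b"
proof -
  define d where "d = subdegree b"
  define b' where "b' = fps_shift d b"
  have b: "b = b' * fps_X ^ d" unfolding b'_def d_def by (simp add: subdegree_decompose[symmetric])
  have a: "a = fps_shift d a * fps_X ^ d"
  proof (rule fps_ext)
    fix k
    have "a $ k = 0" if "k < d" using that assms(4) by (auto simp: d_def intro: nth_less_subdegree_zero)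
    then show "a $ k = (fps_shift d a * fps_X ^ d) $ k" by (simp add: fps_X_power_mult_right_nth)
  qed
  have "b' $ 0 \<noteq> 0" using assms(3) by (simp add: b'_def d_def)
  moreover have "conv1 b'" unfolding b'_def by (rule conv1_shift[OF assms(2)])
  ultimately obtain k where k: "convergent2 k" "fps_const b' * k = 1"
    using convergent2_inverse[of "fps_const b'"] by auto
  have "b' * k $ 0 = 1" using arg_cong[OF k(2), of "\<lambda>h. h $ 0"] by simp
  then have "a = (fps_shift d a * k $ 0) * b"
    by (subst a, subst b) (simp add: mult_ac)
  moreover have "conv1 (fps_shift d a * k $ 0)"
    by (intro conv1_mult conv1_shift assms convergent2_nth k)
  ultimately show ?thesis using that by blast
qed

lemma conv1_rot: assumes "conv1 a" "norm e = 1" shows "conv1 (rot e a)"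
  using assms unfolding conv1_def by (simp add: norm_mult norm_power)

lemma convergent2_ramify: assumes "convergent2 h" "N > 0" shows "convergent2 (ramify N h)"
proof -
  obtain C R where CR: "C > 0" "R \<ge> 1"
    "\<And>R' i j. R' \<ge> R \<Longrightarrow> norm (h $ j $ i) \<le> C * R' ^ (i + j)" using assms(1) by (rule convergent2E) blast
  show ?thesis
  proof (rule convergent2I)
    show "0 < R" using CR by auto
    fix i j
    show "norm (ramify N h $ j $ i) \<le> C * R ^ (i + j)"
    proof (cases "N dvd i")
      case True
      then obtain m where m: "i = N * m" by auto
      have "norm (h $ j $ m) \<le> C * R ^ (m + j)" using CR by auto
      also have "\<dots> \<le> C * R ^ (i + j)"
        using CR m assms(2) by (intro mult_left_mono power_increasing) auto
      finally show ?thesis using m assms by (simp add: ramify_eq_lift lift_def)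
    next
      case False
      then show ?thesis using assms CR by (simp add: ramify_eq_lift lift_def ram_nth)
    qed
  qed
qed

lemma conv1_ram: assumes "conv1 a" "N > 0" shows "conv1 (ram N a)"
  using convergent2_ramify[of "fps_const a" N] assms
  by (simp add: ramify_eq_lift subst_hom.lift_const[OF subst_hom_ram])

section \<open>Roots of unity and Galois descent\<close>

definition primitive_root :: "nat \<Rightarrow> complex \<Rightarrow> bool" where
  "primitive_root N e \<longleftrightarrow> N > 0 \<and> e ^ N = 1 \<and> (\<forall>k. e ^ k = 1 \<longrightarrow> N dvd k)"

lemma primitive_root_exists: assumes "N > 0" shows "\<exists>e. primitive_root N e"
proof -
  define e where "e = exp (2 * of_real pi * \<i> * of_nat 1 / of_nat N)"
  have pow: "e ^ k = exp (2 * of_real pi * \<i> * of_nat k / of_nat N)" for k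
    by (simp add: e_def mult_ac flip: exp_of_nat_mult)
  have "e ^ k = 1 \<longleftrightarrow> N dvd k" for k
    unfolding pow by (rule complex_root_unity_eq_1) (use assms in simp)
  then have "primitive_root N e" using assms by (simp add: primitive_root_def)
  then show ?thesis ..
qed

lemma primitive_root_norm: assumes "primitive_root N e" shows "norm e = 1"
proof -
  have e: "e ^ N = 1" "N > 0" using assms unfolding primitive_root_def by blast+
  have "norm e ^ N = norm (e ^ N)" by (rule norm_power[symmetric])
  also have "\<dots> = 1 ^ N" unfolding e(1) norm_one power_one ..
  finally show ?thesis by (rule power_eq_imp_eq_base) (use e in auto)
qed

text \<open>Invariance reads \<open>e^i * h_i = h_i\<close> on the coefficient of
  \<open>t^i\<close>, so only exponents divisible by \<open>N\<close> survive.\<close>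

lemma descent_lift:
  assumes e: "primitive_root N e" and h: "convergent2 h" and inv: "lift (rot e) h = h"
  obtains k where "convergent2 k" "h = ramify N k"
proof -
  have N: "N > 0" using e by (simp add: primitive_root_def)
  define k where "k = Abs_fps (\<lambda>j. Abs_fps (\<lambda>i. h $ j $ (N * i)))"
  have 0: "h $ j $ i = 0" if "\<not> N dvd i" for i j
  proof -
    have "e ^ i * h $ j $ i = h $ j $ i"
      using arg_cong[OF inv, of "\<lambda>h. h $ j $ i"] by (simp add: lift_def)
    moreover have "e ^ i \<noteq> 1" using e that by (auto simp: primitive_root_def)
    ultimately show ?thesis by simp
  qed
  have "h = ramify N k"
    by (intro fps_ext) (use N 0 in \<open>auto simp: ramify_eq_lift lift_def ram_nth k_def\<close>)
  moreover have "convergent2 k"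
  proof -
    obtain C R where CR: "C > 0" "R \<ge> 1"
      "\<And>R' i j. R' \<ge> R \<Longrightarrow> norm (h $ j $ i) \<le> C * R' ^ (i + j)" using h by (rule convergent2E) blast
    show ?thesis
    proof (rule convergent2I)
      show "0 < R ^ N" using CR by auto
      fix i j
      have "norm (k $ j $ i) \<le> C * R ^ (N * i + j)" using CR by (simp add: k_def)
      also have "\<dots> \<le> C * R ^ (N * (i + j))"
        using CR N by (intro mult_left_mono power_increasing) (auto simp: algebra_simps)
      finally show "norm (k $ j $ i) \<le> C * (R ^ N) ^ (i + j)" by (simp add: power_mult)
    qed
  qed
  ultimately show ?thesis using that by blast
qed

lemma descent:
  assumes e: "primitive_root N e" and a: "conv1 a" and inv: "rot e a = a"
  obtains b where "conv1 b" "a = ram N b"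
proof -
  have N: "N > 0" using e by (simp add: primitive_root_def)
  have "lift (rot e) (fps_const a) = fps_const a"
    using inv by (auto simp: fps_eq_iff lift_def)
  from descent_lift[OF e _ this] a obtain k where k: "convergent2 k" "fps_const a = ramify N k" by auto
  have "a = ram N (k $ 0)" using arg_cong[OF k(2), of "\<lambda>h. h $ 0"] by (simp add: ramify_eq_lift lift_def)
  with convergent2_nth[OF k(1)] that show ?thesis by blast
qed

section \<open>Evaluation at a series without constant term\<close>

lemma subst_y_nth:
  assumes "g $ 0 = 0" "n \<le> M"
  shows "subst_y h g $ n = (\<Sum>j\<le>M. h $ j * g ^ j) $ n"
proof -
  have "(h $ j * g ^ j) $ n = 0" if "n < j" for j
  proof -
    have "(g ^ j) $ i = 0" if "i \<le> n" for i
      using startsby_zero_power_prefix[OF assms(1), of j] that \<open>n < j\<close> by auto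
    then show ?thesis by (auto simp: fps_mult_nth intro!: sum.neutral)
  qed
  then have "(\<Sum>j\<le>M. (h $ j * g ^ j) $ n) = (\<Sum>j\<le>n. (h $ j * g ^ j) $ n)"
    using assms(2) by (intro sum.mono_neutral_right) auto
  then show ?thesis by (simp add: subst_y_def fps_sum_nth)
qed

lemma subst_y_add: "subst_y (h + k) g = subst_y h g + subst_y k g"
  by (rule fps_ext) (simp add: subst_y_def distrib_right sum.distrib)

lemma subst_y_const [simp]: "subst_y (fps_const a) g = a"
proof (rule fps_ext)
  fix n
  have "(\<Sum>j\<le>n. (fps_const a $ j * g ^ j) $ n) = (\<Sum>j\<in>{0}. (fps_const a $ j * g ^ j) $ n)"
    by (rule sum.mono_neutral_right) auto
  then show "subst_y (fps_const a) g $ n = a $ n" by (simp add: subst_y_def)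
qed

text \<open>The partial sums telescope to a single term containing \<open>g ^ Suc M\<close>, whose
  low coefficients vanish.\<close>

lemma subst_y_mult_linear:
  assumes g: "g $ 0 = 0"
  shows "subst_y ((fps_X - fps_const g) * q) g = 0"
proof (rule fps_ext)
  fix n
  have "(\<Sum>j\<le>M. ((fps_X - fps_const g) * q) $ j * g ^ j) = - (q $ M * g ^ Suc M)" for M
    by (induction M) (simp_all add: algebra_simps)
  then have "subst_y ((fps_X - fps_const g) * q) g $ n = - ((q $ n * g ^ Suc n) $ n)"
    by (simp add: subst_y_nth[OF g order.refl])
  also have "(q $ n * g ^ Suc n) $ n = 0"
    unfolding fps_mult_nth using startsby_zero_power_prefix[OF g, of "Suc n"]
    by (intro sum.neutral) auto
  finally show "subst_y ((fps_X - fps_const g) * q) g $ n = 0 $ n" by simp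
qed

lemma subst_y_unique:
  assumes "g $ 0 = 0" "h = (fps_X - fps_const g) * q + fps_const r"
  shows "subst_y h g = r"
  using assms by (simp add: subst_y_add subst_y_mult_linear)

lemma subst_y_shift:
  assumes g: "g $ 0 = 0"
  shows "subst_y h g = h $ 0 + g * subst_y (fps_shift 1 h) g"
proof (rule fps_ext)
  fix n
  have "subst_y h g $ n = (\<Sum>j\<le>Suc n. h $ j * g ^ j) $ n" using subst_y_nth[OF g, of n "Suc n"] by simp
  also have "(\<Sum>j\<le>Suc n. h $ j * g ^ j) = h $ 0 + g * (\<Sum>j\<le>n. fps_shift 1 h $ j * g ^ j)"
    by (subst sum.atMost_Suc_shift) (simp add: sum_distrib_left mult_ac)
  also have "\<dots> $ n = (h $ 0 + g * subst_y (fps_shift 1 h) g) $ n"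
    by (simp add: fps_mult_nth subst_y_nth[OF g, of _ n])
  finally show "subst_y h g $ n = (h $ 0 + g * subst_y (fps_shift 1 h) g) $ n" .
qed

text \<open>Together with \<open>subst_y_unique\<close> this characterizes evaluation as the
  remainder of division by \<open>y - g\<close>. Multiplicativity and compatibility with
  \<open>lift\<close> then need no double sums.\<close>

lemma subst_y_division:
  assumes g: "g $ 0 = 0"
  obtains q where "h = (fps_X - fps_const g) * q + fps_const (subst_y h g)"
proof
  \<comment> \<open>Horner's scheme: the coefficient \<open>k\<close> of the quotient is the tail of
    \<open>h\<close> beyond degree \<open>k\<close>, evaluated at \<open>g\<close>.\<close>
  define q where "q = Abs_fps (\<lambda>k. subst_y (fps_shift (Suc k) h) g)"
  show "h = (fps_X - fps_const g) * q + fps_const (subst_y h g)"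
  proof (rule fps_ext)
    fix k
    have "subst_y (fps_shift k h) g = h $ k + g * subst_y (fps_shift (Suc k) h) g"
    proof -
      have "fps_shift 1 (fps_shift k h) = fps_shift (Suc k) h" by (rule fps_ext) simp
      then show ?thesis using subst_y_shift[OF g, of "fps_shift k h"] by simp
    qed
    then show "h $ k = ((fps_X - fps_const g) * q + fps_const (subst_y h g)) $ k"
      by (cases k) (auto simp: left_diff_distrib q_def)
  qed
qed

lemma subst_y_mult:
  assumes g: "g $ 0 = 0"
  shows "subst_y (h * k) g = subst_y h g * subst_y k g"
proof -
  obtain q where h: "h = (fps_X - fps_const g) * q + fps_const (subst_y h g)"
    using subst_y_division[OF g] by blast
  obtain p where k: "k = (fps_X - fps_const g) * p + fps_const (subst_y k g)"
    using subst_y_division[OF g] by blast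
  have "(L * q + A) * (L * p + B) = L * (q * (L * p + B) + A * p) + A * B" for L A B :: series2
    by (simp add: algebra_simps)
  from this[of "fps_X - fps_const g" "fps_const (subst_y h g)" "fps_const (subst_y k g)"]
  have "h * k = (fps_X - fps_const g) * (q * k + fps_const (subst_y h g) * p)
      + fps_const (subst_y h g * subst_y k g)"
    unfolding h[symmetric] k[symmetric] by simp
  then show ?thesis by (rule subst_y_unique[OF g])
qed

lemma subst_y_X [simp]: "g $ 0 = 0 \<Longrightarrow> subst_y fps_X g = g"
  by (rule subst_y_unique[of _ _ 1]) auto

lemma subst_y_1 [simp]: "subst_y 1 g = 1"
  using subst_y_const[of 1 g] by simp

lemma subst_y_0 [simp]: "subst_y 0 g = 0"
  using subst_y_const[of 0 g] by simp

lemma subst_y_diff: "subst_y (h - k) g = subst_y h g - subst_y k g"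
  using subst_y_add[of "h - k" k g] by simp

lemma subst_y_sum: "subst_y (sum h A) g = (\<Sum>i\<in>A. subst_y (h i) g)"
  by (induction A rule: infinite_finite_induct) (auto simp: subst_y_add)

lemma subst_y_prod: "g $ 0 = 0 \<Longrightarrow> subst_y (prod h A) g = (\<Prod>i\<in>A. subst_y (h i) g)"
  by (induction A rule: infinite_finite_induct) (auto simp: subst_y_mult)

lemma subst_y_power: "g $ 0 = 0 \<Longrightarrow> subst_y (h ^ n) g = subst_y h g ^ n"
  by (induction n) (auto simp: subst_y_mult)

lemma subst_y_nth_0: "g $ 0 = 0 \<Longrightarrow> subst_y h g $ 0 = h $ 0 $ 0"
  using subst_y_nth[of g 0 0] by simp

lemma (in subst_hom) subst_y:
  assumes g: "g $ 0 = 0"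
  shows "\<sigma> (subst_y h g) = subst_y (lift \<sigma> h) (\<sigma> g)"
proof -
  obtain q where h: "h = (fps_X - fps_const g) * q + fps_const (subst_y h g)"
    using subst_y_division[OF g] by blast
  have "lift \<sigma> h = (fps_X - fps_const (\<sigma> g)) * lift \<sigma> q + fps_const (\<sigma> (subst_y h g))"
    by (subst h) (simp add: lift_add lift_mult lift_diff)
  then show ?thesis using subst_y_unique[of "\<sigma> g"] g nth_0 by simp
qed

lemma y_order_linear: "g $ 0 = 0 \<Longrightarrow> y_order (fps_X - fps_const g) 1"
  by (simp add: y_order_def)

text \<open>The value is the remainder of Weierstrass division by \<open>y - g\<close>, which
  converges.\<close>

lemma conv1_subst_y:
  assumes "convergent2 h" "conv1 g" "g $ 0 = 0"
  shows "conv1 (subst_y h g)"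
proof -
  obtain q r where qr: "convergent2 r" "h = q * (fps_X - fps_const g) + r" "\<forall>j\<ge>1. r $ j = 0"
    using weierstrass_division[OF _ y_order_linear[OF assms(3)] assms(1)] assms by (auto simp: convergent2_diff)
  have r: "r = fps_const (r $ 0)" using qr(3) by (intro fps_ext) auto
  have "subst_y h g = r $ 0"
  proof (rule subst_y_unique[OF assms(3)])
    show "h = (fps_X - fps_const g) * q + fps_const (r $ 0)"
      unfolding r[symmetric] by (subst qr(2)) (rule arg_cong[of _ _ "\<lambda>x. x + r"], rule mult.commute)
  qed
  then show ?thesis using convergent2_nth[OF qr(1)] by simp
qed

section \<open>Puiseux's theorem\<close>

definition at_x0 :: "series2 \<Rightarrow> complex fps" where
  "at_x0 h = Abs_fps (\<lambda>j. h $ j $ 0)"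

lemma at_x0_nth [simp]: "at_x0 h $ j = h $ j $ 0"
  by (simp add: at_x0_def)

lemma at_x0_add: "at_x0 (h + k) = at_x0 h + at_x0 k"
  by (rule fps_ext) simp

lemma at_x0_mult: "at_x0 (h * k) = at_x0 h * at_x0 k"
  by (rule fps_ext) (simp add: fps_mult_nth fps_sum_nth)

lemma at_x0_const [simp]: "at_x0 (fps_const a) = fps_const (a $ 0)"
  by (rule fps_ext) simp

lemma at_x0_X [simp]: "at_x0 fps_X = fps_X"
  by (rule fps_ext) (simp add: fps_X_nth)

lemma at_x0_1 [simp]: "at_x0 1 = 1"
  by (rule fps_ext) (simp add: fps_one_nth)

lemma at_x0_power: "at_x0 (h ^ n) = at_x0 h ^ n"
  by (induction n) (auto simp: at_x0_mult)

lemma at_x0_0 [simp]: "at_x0 0 = 0"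
  by (rule fps_ext) simp

lemma at_x0_sum: "at_x0 (sum h A) = (\<Sum>i\<in>A. at_x0 (h i))"
  by (induction A rule: infinite_finite_induct) (auto simp: at_x0_add)

lemma y_order_iff: "y_order h n \<longleftrightarrow> at_x0 h \<noteq> 0 \<and> subdegree (at_x0 h) = n"
proof
  assume "y_order h n"
  then have "at_x0 h $ n \<noteq> 0" "\<And>i. i < n \<Longrightarrow> at_x0 h $ i = 0" by (auto simp: y_order_def)
  then show "at_x0 h \<noteq> 0 \<and> subdegree (at_x0 h) = n" by (auto intro: subdegreeI simp del: at_x0_nth)
next
  assume *: "at_x0 h \<noteq> 0 \<and> subdegree (at_x0 h) = n"
  then have "at_x0 h $ n \<noteq> 0" using nth_subdegree_nonzero by blast
  moreover have "at_x0 h $ i = 0" if "i < n" for i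
    using * that by (intro nth_less_subdegree_zero) auto
  ultimately show "y_order h n" by (auto simp: y_order_def)
qed

lemma y_order_mult: "y_order h m \<Longrightarrow> y_order k n \<Longrightarrow> y_order (h * k) (m + n)"
  unfolding y_order_iff by (auto simp: at_x0_mult)

definition weierstrass_poly :: "nat \<Rightarrow> series2 \<Rightarrow> bool" where
  "weierstrass_poly n W \<longleftrightarrow> convergent2 W \<and> W $ n = 1 \<and> (\<forall>j>n. W $ j = 0) \<and> (\<forall>j<n. W $ j $ 0 = 0)"

text \<open>Divide \<open>y^n\<close> by \<open>h\<close> and take \<open>W = y^n - r\<close>.
  Comparing orders in \<open>y\<close> at \<open>x = 0\<close> forces the quotient to be a
  unit.\<close>

lemma weierstrass_preparation:
  assumes h: "convergent2 h" and n: "y_order h n"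
  obtains q W where "convergent2 q" "q $ 0 $ 0 \<noteq> 0" "weierstrass_poly n W" "W = q * h"
proof -
  obtain q r where qr: "convergent2 q" "convergent2 r" "fps_X ^ n = q * h + r" "\<forall>j\<ge>n. r $ j = 0"
    using weierstrass_division[OF h n convergent2_power[OF convergent2_X, of n]] by blast
  define W where "W = fps_X ^ n - r"
  have W: "W = q * h" using qr(3) by (simp add: W_def)
  have W0: "at_x0 W = at_x0 q * at_x0 h" by (simp add: W at_x0_mult)
  have h0: "at_x0 h \<noteq> 0" "subdegree (at_x0 h) = n" using n by (auto simp: y_order_iff)
  have Wn: "W $ n = 1" using qr(4) by (simp add: W_def)
  have "at_x0 W $ n \<noteq> 0" using Wn by simp
  then have q0: "at_x0 q \<noteq> 0" and sub: "subdegree (at_x0 W) \<le> n"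
    unfolding W0 by (auto intro: subdegree_leI)
  then have "subdegree (at_x0 q) = 0" unfolding W0 using h0 by simp
  then have "q $ 0 $ 0 \<noteq> 0" using q0 by (metis at_x0_nth nth_subdegree_nonzero)
  moreover have "weierstrass_poly n W"
    unfolding weierstrass_poly_def
  proof (intro conjI allI impI)
    show "convergent2 W" unfolding W using qr(1) h by (rule convergent2_mult)
    show "W $ j = 0" if "j > n" for j using qr(4) that by (simp add: W_def)
    show "W $ j $ 0 = 0" if "j < n" for j
    proof -
      have "subdegree (at_x0 W) = n" unfolding W0 using h0 q0 \<open>subdegree (at_x0 q) = 0\<close> by simp
      then have "at_x0 W $ j = 0" using that by (intro nth_less_subdegree_zero) simp
      then show ?thesis by simp
    qed
  qed (fact Wn)
  ultimately show ?thesis using that qr(1) W by blast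
qed

section \<open>Taylor shifts of polynomials in y\<close>

lemma fps_X_plus_const_power_nth:
  fixes c :: "'a :: comm_ring_1"
  shows "j > n \<Longrightarrow> (fps_X + fps_const c) ^ n $ j = 0"
    and "(fps_X + fps_const c) ^ n $ n = 1"
    and "(fps_X + fps_const c) ^ Suc n $ n = of_nat (Suc n) * c"
proof -
  have rec: "(fps_X + fps_const c) ^ Suc n $ j =
      (if j = 0 then 0 else (fps_X + fps_const c) ^ n $ (j - 1)) + c * (fps_X + fps_const c) ^ n $ j" for n j
    by (simp add: distrib_right)
  show 1: "(fps_X + fps_const c) ^ n $ j = 0" if "j > n" for n j
    using that
  proof (induction n arbitrary: j)
    case (Suc n)
    then show ?case unfolding rec by simp
  qed simp
  show 2: "(fps_X + fps_const c) ^ n $ n = 1" for n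
  proof (induction n)
    case (Suc n)
    then show ?case unfolding rec using 1[of n "Suc n"] by simp
  qed simp
  show "(fps_X + fps_const c) ^ Suc n $ n = of_nat (Suc n) * c"
  proof (induction n)
    case (Suc n)
    then show ?case unfolding rec[of "Suc n"] using 2[of "Suc n"] by (simp add: algebra_simps)
  qed (simp add: rec)
qed

text \<open>The last fact has two uses in Puiseux's theorem: a suitable \<open>c\<close> removes the
  subleading coefficient, and if this coefficient is zero before and after a shift of a monic
  polynomial, then \<open>c = 0\<close>.\<close>

lemma taylor_shift_nth:
  fixes a :: "nat \<Rightarrow> 'a :: comm_ring_1" and c :: 'a
  defines "T \<equiv> \<lambda>n. \<Sum>i\<le>n. fps_const (a i) * (fps_X + fps_const c) ^ i"
  shows "j > n \<Longrightarrow> T n $ j = 0"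
    and "T n $ n = a n"
    and "T (Suc n) $ n = a n + of_nat (Suc n) * c * a (Suc n)"
proof -
  show 1: "T n $ j = 0" if "j > n" for n j
    using that fps_X_plus_const_power_nth(1)[of _ j c]
    by (auto simp: T_def fps_sum_nth intro!: sum.neutral)
  show 2: "T n $ n = a n" for n
  proof (cases n)
    case (Suc m)
    have "T n = T m + fps_const (a n) * (fps_X + fps_const c) ^ n" by (simp add: T_def Suc)
    then show ?thesis using 1[of m n] fps_X_plus_const_power_nth(2)[of c n] Suc by simp
  qed (simp add: T_def)
  show "T (Suc n) $ n = a n + of_nat (Suc n) * c * a (Suc n)"
  proof -
    have "T (Suc n) = T n + fps_const (a (Suc n)) * (fps_X + fps_const c) ^ Suc n" by (simp add: T_def)
    then show ?thesis using 2[of n] fps_X_plus_const_power_nth(3)[of c n]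
      by (simp add: mult_ac del: power_Suc)
  qed
qed

lemma convergent2_taylor_shift:
  assumes "\<And>i. conv1 (a i)" "conv1 c"
  shows "convergent2 (\<Sum>i\<le>n. fps_const (a i) * (fps_X + fps_const c) ^ i)"
  using assms by (intro convergent2_sum convergent2_mult convergent2_power convergent2_add) auto

lemma subst_y_ramify_taylor_shift:
  assumes "N > 0" "g $ 0 = 0"
  shows "subst_y (ramify N (\<Sum>i\<le>n. fps_const (a i) * (fps_X + fps_const c) ^ i)) g =
    (\<Sum>i\<le>n. ram N (a i) * (g + ram N c) ^ i)"
proof -
  interpret subst_hom "ram N" by (rule subst_hom_ram[OF assms(1)])
  show ?thesis
    using assms(2) by (simp add: ramify_eq_lift lift_sum lift_mult lift_power lift_add subst_y_sum
        subst_y_mult subst_y_power subst_y_add)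
qed

lemma finite_y_degree:
  assumes "\<And>j. j > n \<Longrightarrow> h $ j = 0"
  shows "h = (\<Sum>i\<le>n. fps_const (h $ i) * fps_X ^ i)"
proof (rule fps_ext)
  fix j
  have "(\<Sum>i\<le>n. fps_const (h $ i) * fps_X ^ i) $ j = (\<Sum>i\<le>n. if i = j then h $ i else 0)"
    unfolding fps_sum_nth by (rule sum.cong) auto
  also have "\<dots> = h $ j" using assms[of j] by (cases "j \<le> n") auto
  finally show "h $ j = (\<Sum>i\<le>n. fps_const (h $ i) * fps_X ^ i) $ j" by simp
qed

lemma subst_y_ramify_finite:
  assumes "N > 0" "g $ 0 = 0" "\<And>j. j > n \<Longrightarrow> h $ j = 0"
  shows "subst_y (ramify N h) g = (\<Sum>i\<le>n. ram N (h $ i) * g ^ i)"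
proof -
  interpret subst_hom "ram N" by (rule subst_hom_ram[OF assms(1)])
  have "subst_y (ramify N h) g = subst_y (ramify N (\<Sum>i\<le>n. fps_const (h $ i) * fps_X ^ i)) g"
    using finite_y_degree[of n h] assms(3) by simp
  also have "\<dots> = (\<Sum>i\<le>n. ram N (h $ i) * g ^ i)"
    using subst_y_ramify_taylor_shift[OF assms(1,2), of "\<lambda>i. h $ i" 0 n] by simp
  finally show ?thesis .
qed

text \<open>Newton's algorithm as an induction on the order in \<open>y\<close>. Once the subleading
  coefficient is removed, the polynomial of the first edge is not a pure power
  \<open>(z - c)^n\<close>, so shifting to one of its roots lowers the order.\<close>

theorem puiseux_root:
  assumes "convergent2 h" "y_order h n" "n > 0"
  shows "\<exists>N \<phi>. N > 0 \<and> conv1 \<phi> \<and> \<phi> $ 0 = 0 \<and> subst_y (ramify N h) \<phi> = 0"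
  using assms
proof (induction n arbitrary: h rule: less_induct)
  case (less n h)
  obtain n' where n': "n = Suc n'" using \<open>n > 0\<close> gr0_implies_Suc by blast
  obtain q W where q: "convergent2 q" "q $ 0 $ 0 \<noteq> 0" and W: "weierstrass_poly n W" and qh: "W = q * h"
    using weierstrass_preparation[OF less.prems(1,2)] by blast
  \<comment> \<open>Tschirnhaus transformation: the shift by \<open>s\<close> removes the
    coefficient of \<open>y^(n-1)\<close>.\<close>
  define s where "s = fps_const (1 / of_nat n) * W $ n'"
  have conv_W: "conv1 (W $ i)" for i using W convergent2_nth by (auto simp: weierstrass_poly_def)
  have s: "conv1 s" "s $ 0 = 0"
    using W conv_W by (auto simp: s_def weierstrass_poly_def n' intro!: conv1_mult)
  define H where "H = (\<Sum>i\<le>n. fps_const (W $ i) * (fps_X + fps_const (- s)) ^ i)"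
  have "conv1 (- s)" using s conv1_diff[of 0 s] by simp
  then have convH: "convergent2 H" unfolding H_def by (intro convergent2_taylor_shift conv_W)
  have H_nth: "j > n \<Longrightarrow> H $ j = 0" "H $ n = 1" for j
    using taylor_shift_nth(1,2)[where a = "($) W" and c = "- s" and n = n] W
    by (auto simp: H_def weierstrass_poly_def)
  have H_n': "H $ n' = 0"
  proof -
    have "of_nat (Suc n') = fps_const (of_nat (Suc n') :: complex)" by (rule fps_of_nat[symmetric])
    then have "of_nat (Suc n') * s = W $ n'"
      unfolding s_def n' by (simp add: mult.assoc[symmetric] del: of_nat_Suc)
    then show ?thesis
      using taylor_shift_nth(3)[where a = "($) W" and c = "- s" and n = n'] W
      by (auto simp: H_def weierstrass_poly_def n' simp del: of_nat_Suc)
  qed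
  have H0: "H $ j $ 0 = 0" if "j < n" for j
  proof -
    have "at_x0 H = (\<Sum>i\<le>n. fps_const (W $ i $ 0) * fps_X ^ i)"
      using s by (simp add: H_def at_x0_sum at_x0_mult at_x0_power at_x0_add)
    then have "at_x0 H $ j = (\<Sum>i\<le>n. W $ i $ 0 * (if j = i then 1 else 0))"
      by (simp add: fps_sum_nth)
    also have "\<dots> = 0" using W that by (intro sum.neutral) (auto simp: weierstrass_poly_def)
    finally show ?thesis by simp
  qed
  \<comment> \<open>\<open>W(y - s) = H(y)\<close>, and the factor \<open>q\<close> in
    \<open>W = q * h\<close> stays nonzero after substitution.\<close>
  have root_transfer: "subst_y (ramify N h) (\<psi> - ram N s) = 0"
    if "N > 0" "\<psi> $ 0 = 0" "subst_y (ramify N H) \<psi> = 0" for N \<psi>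
  proof -
    interpret subst_hom "ram N" by (rule subst_hom_ram[OF that(1)])
    have 0: "(\<psi> - ram N s) $ 0 = 0" using that s by (simp add: nth_0)
    have "subst_y (ramify N W) (\<psi> - ram N s) = (\<Sum>i\<le>n. ram N (W $ i) * (\<psi> - ram N s) ^ i)"
      using that(1) 0 W by (intro subst_y_ramify_finite) (auto simp: weierstrass_poly_def)
    also have "\<dots> = subst_y (ramify N H) \<psi>"
      unfolding H_def using that by (simp add: subst_y_ramify_taylor_shift uminus)
    finally have "subst_y (ramify N W) (\<psi> - ram N s) = 0" using that by simp
    then have "subst_y (ramify N q) (\<psi> - ram N s) * subst_y (ramify N h) (\<psi> - ram N s) = 0"
      using 0 by (simp add: qh ramify_eq_lift lift_mult subst_y_mult)
    moreover have "subst_y (ramify N q) (\<psi> - ram N s) $ 0 \<noteq> 0"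
      using q 0 by (simp add: subst_y_nth_0 ramify_eq_lift nth_0)
    ultimately show ?thesis by (metis fps_zero_nth mult_eq_0_iff)
  qed
  have "\<exists>N \<psi>. N > 0 \<and> conv1 \<psi> \<and> \<psi> $ 0 = 0 \<and> subst_y (ramify N H) \<psi> = 0"
  proof (cases "\<forall>j<n. H $ j = 0")
    case True
    then have "H $ j = fps_X ^ n $ j" for j
      using H_nth by (cases j n rule: linorder_cases) auto
    then have "H = fps_X ^ n" by (rule fps_ext)
    then have "subst_y (ramify 1 H) 0 = 0"
      using \<open>n > 0\<close> by (simp add: ramify_eq_lift subst_hom.lift_power[OF subst_hom_ram]
          subst_hom.lift_X[OF subst_hom_ram] subst_y_power)
    then show ?thesis by (intro exI[of _ 1] exI[of _ 0]) auto
  next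
    case False
    define I where "I = {j. j < n \<and> H $ j \<noteq> 0}"
    have I: "finite I" "I \<noteq> {}" using False by (auto simp: I_def)
    \<comment> \<open>All \<open>n - j\<close> divide \<open>n!\<close>, so after this ramification
      every slope is an integer.\<close>
    define K :: nat where "K = fact n"
    have K: "K > 0" by (simp add: K_def)
    define slope where "slope j = K * subdegree (H $ j) div (n - j)" for j
    have slope: "slope j * (n - j) = K * subdegree (H $ j)" if "j < n" for j
    proof -
      have "(n - j) dvd K" unfolding K_def using that by (intro dvd_fact) auto
      then show ?thesis unfolding slope_def by simp
    qed
    \<comment> \<open>With the least slope, \<open>y = t^m z\<close> allows \<open>t^(m n)\<close>
      to be divided out, and the coefficient at \<open>j0\<close> keeps a nonzero constant
      term.\<close>
    define m where "m = Min (slope ` I)"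
    have "m \<in> slope ` I" unfolding m_def using I by (intro Min_in) auto
    then obtain j0 where j0: "j0 \<in> I" "m = slope j0" by blast
    have m_le: "m * (n - j) \<le> subdegree (ram K (H $ j))" if "j \<in> I" for j
    proof -
      have "m * (n - j) \<le> slope j * (n - j)"
        unfolding m_def using that I by (intro mult_right_mono Min_le) auto
      also have "\<dots> = subdegree (ram K (H $ j))" using slope[of j] that K by (simp add: I_def subdegree_ram)
      finally show ?thesis .
    qed
    have m_j0: "m * (n - j0) = subdegree (ram K (H $ j0))"
      using slope[of j0] j0 K by (simp add: I_def subdegree_ram)
    have m0: "m > 0"
    proof -
      have "subdegree (H $ j0) > 0"
        using j0 H0[of j0] by (auto simp: I_def subdegree_eq_0_iff intro!: gr0I)
      then show ?thesis using m_j0 K by (auto simp: subdegree_ram intro!: gr0I)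
    qed
    interpret K: subst_hom "ram K" by (rule subst_hom_ram[OF K])
    define b where "b j = fps_shift (m * (n - j)) (ram K (H $ j))" for j
    have b: "ram K (H $ j) = fps_X ^ (m * (n - j)) * b j" if "j \<le> n" for j
    proof (cases "j \<in> I")
      case True
      show ?thesis
      proof (rule fps_ext)
        fix k
        have "ram K (H $ j) $ k = 0" if "k < m * (n - j)"
          using that m_le[OF True] by (intro nth_less_subdegree_zero) simp
        then show "ram K (H $ j) $ k = (fps_X ^ (m * (n - j)) * b j) $ k"
          by (simp add: fps_X_power_mult_nth b_def)
      qed
    next
      case False
      with that consider "j = n" | "H $ j = 0" by (fastforce simp: I_def)
      then show ?thesis by cases (auto simp: b_def)
    qed
    have convb: "conv1 (b j)" for j
      unfolding b_def by (intro conv1_shift conv1_ram convergent2_nth convH K)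
    have bn: "b n = 1" by (simp add: b_def H_nth K.one)
    have bn': "b n' = 0" by (simp add: b_def H_n')
    have bj0: "b j0 $ 0 \<noteq> 0"
      using j0(1) unfolding b_def m_j0 fps_shift_nth by (simp add: I_def)
    \<comment> \<open>The polynomial of the chosen edge, that is the rescaled equation at
      \<open>t = 0\<close>.\<close>
    define p where "p = (\<Sum>j\<le>n. Polynomial.monom (b j $ 0) j)"
    have p_coeff: "Polynomial.coeff p j = (if j \<le> n then b j $ 0 else 0)" for j
      by (auto simp: p_def coeff_sum if_distrib cong: if_cong)
    have "Polynomial.degree p > 0"
      using le_degree[of p n] p_coeff[of n] bn \<open>n > 0\<close> by simp
    then obtain c where c: "poly p c = 0" using alg_closed_imp_poly_has_root by blast
    define F where "F = (\<Sum>j\<le>n. fps_const (b j) * (fps_X + fps_const (fps_const c)) ^ j)"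
    have convF: "convergent2 F" unfolding F_def by (intro convergent2_taylor_shift convb) simp
    have F0: "at_x0 F = (\<Sum>j\<le>n. fps_const (b j $ 0) * (fps_X + fps_const c) ^ j)"
      by (simp add: F_def at_x0_sum at_x0_mult at_x0_power at_x0_add)
    have F0_n: "at_x0 F $ n = 1"
      using taylor_shift_nth(2)[where a = "\<lambda>j. b j $ 0" and c = c and n = n] by (simp add: F0 bn)
    define k where "k = subdegree (at_x0 F)"
    have nz: "at_x0 F \<noteq> 0" using F0_n by (metis fps_zero_nth zero_neq_one)
    have "y_order F k" using nz by (simp add: y_order_iff k_def)
    moreover have "k > 0"
    proof -
      have "at_x0 F $ 0 = poly p c"
        by (simp add: F0 fps_sum_nth p_def poly_sum poly_monom fps_power_zeroth)
      then show ?thesis using c nz unfolding k_def by (metis gr0I nth_subdegree_nonzero)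
    qed
    \<comment> \<open>Otherwise \<open>p = (z - c)^n\<close>. The zero subleading coefficient of
      \<open>p\<close> gives \<open>c = 0\<close>, hence \<open>p = z^n\<close>, contrary to its
      nonzero coefficient at \<open>j0\<close>.\<close>
    moreover have "k < n"
    proof (rule ccontr)
      assume "\<not> k < n"
      then have 0: "at_x0 F $ j = 0" if "j < n" for j
        using that unfolding k_def by (intro nth_less_subdegree_zero) simp
      have "at_x0 F $ n' = of_nat n * c"
        using taylor_shift_nth(3)[where a = "\<lambda>j. b j $ 0" and c = c and n = n'] bn bn'
        by (simp add: F0 n' del: of_nat_Suc)
      then have "of_nat n * c = 0" using 0[of n'] n' by (metis lessI)
      then have "c = 0" using \<open>n > 0\<close> by simp
      then have "at_x0 F = (\<Sum>j\<le>n. fps_const (b j $ 0) * fps_X ^ j)" by (simp add: F0)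
      then have "at_x0 F $ j0 = (\<Sum>j\<le>n. b j $ 0 * (if j0 = j then 1 else 0))" by (simp add: fps_sum_nth)
      also have "\<dots> = b j0 $ 0"
        using j0 by (simp add: if_distrib I_def cong: if_cong)
      finally show False using bj0 0[of j0] j0 by (simp add: I_def)
    qed
    ultimately obtain N \<psi> where N: "N > 0" and \<psi>: "conv1 \<psi>" "\<psi> $ 0 = 0" "subst_y (ramify N F) \<psi> = 0"
      using less.IH[of k F] convF by blast
    interpret N: subst_hom "ram N" by (rule subst_hom_ram[OF N])
    have eq: "(\<Sum>j\<le>n. ram N (b j) * (\<psi> + ram N (fps_const c)) ^ j) = 0"
      using \<psi> N by (simp add: F_def subst_y_ramify_taylor_shift)
    \<comment> \<open>Undoes the shift by \<open>c\<close> and the scaling by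
      \<open>t^m\<close>.\<close>
    define \<theta> where "\<theta> = ram N (fps_X ^ m) * (\<psi> + ram N (fps_const c))"
    have \<theta>0: "\<theta> $ 0 = 0" using m0 by (simp add: \<theta>_def N.nth_0)
    have "conv1 \<theta>" unfolding \<theta>_def using N \<psi> by (intro conv1_mult conv1_add conv1_ram) auto
    moreover have "subst_y (ramify (N * K) H) \<theta> = 0"
    proof -
      have "subst_y (ramify (N * K) H) \<theta> = (\<Sum>i\<le>n. ram (N * K) (H $ i) * \<theta> ^ i)"
        using N K \<theta>0 H_nth by (intro subst_y_ramify_finite) auto
      also have "\<dots> = (\<Sum>i\<le>n. ram N (fps_X ^ m) ^ n * (ram N (b i) * (\<psi> + ram N (fps_const c)) ^ i))"
      proof (rule sum.cong[OF refl])
        fix i assume "i \<in> {..n}"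
        then have i: "i \<le> n" by simp
        have "ram (N * K) (H $ i) = ram N (fps_X ^ (m * (n - i)) * b i)"
          using b[OF i] ram_ram[OF N K] by metis
        also have "\<dots> = ram N (fps_X ^ m) ^ (n - i) * ram N (b i)"
          by (simp add: N.mult power_mult N.power)
        finally have "ram (N * K) (H $ i) * \<theta> ^ i = ram N (fps_X ^ m) ^ (n - i + i) * (ram N (b i) * (\<psi> + ram N (fps_const c)) ^ i)"
          unfolding \<theta>_def power_add power_mult_distrib by (simp only: mult_ac)
        then show "ram (N * K) (H $ i) * \<theta> ^ i = ram N (fps_X ^ m) ^ n * (ram N (b i) * (\<psi> + ram N (fps_const c)) ^ i)"
          using i by simp
      qed
      also have "\<dots> = 0" by (simp only: eq mult_zero_right flip: sum_distrib_left)
      finally show ?thesis .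
    qed
    ultimately show ?thesis using N K \<theta>0 by (intro exI[of _ "N * K"] exI[of _ \<theta>]) auto
  qed
  then obtain N \<psi> where N: "N > 0" "conv1 \<psi>" "\<psi> $ 0 = 0" "subst_y (ramify N H) \<psi> = 0" by blast
  then have "conv1 (\<psi> - ram N s)" "(\<psi> - ram N s) $ 0 = 0"
    using s by (auto simp: subst_hom.nth_0[OF subst_hom_ram] intro!: conv1_diff conv1_ram)
  then show ?case using root_transfer[OF N(1,3,4)] N(1) by blast
qed

section \<open>Branches and their parametrizations\<close>

lemma carrier_conv_ring [simp]: "h \<in> carrier conv_ring \<longleftrightarrow> convergent2 h"
  by (simp add: conv_ring_def)

lemma conv_ring_simps [simp]:
  "h \<otimes>\<^bsub>conv_ring\<^esub> k = h * k" "h \<oplus>\<^bsub>conv_ring\<^esub> k = h + k" "\<one>\<^bsub>conv_ring\<^esub> = 1" "\<zero>\<^bsub>conv_ring\<^esub> = 0"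
  by (simp_all add: conv_ring_def)

lemma cring_conv_ring: "cring conv_ring"
proof (rule cringI)
  show "abelian_group conv_ring"
  proof (rule abelian_groupI)
    fix x assume "x \<in> carrier conv_ring"
    then show "\<exists>y\<in>carrier conv_ring. y \<oplus>\<^bsub>conv_ring\<^esub> x = \<zero>\<^bsub>conv_ring\<^esub>"
      by (intro bexI[of _ "- x"]) auto
  qed (auto simp: add_ac)
  show "comm_monoid conv_ring"
    by (rule comm_monoidI) (auto simp: mult_ac)
qed (auto simp: algebra_simps)

lemma domain_conv_ring: "domain conv_ring"
  using cring_conv_ring by (rule domain.intro) (auto simp: domain_axioms_def)

lemma Units_conv_ring: "u \<in> Units conv_ring \<longleftrightarrow> convergent2 u \<and> u $ 0 $ 0 \<noteq> 0"
proof
  assume "u \<in> Units conv_ring"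
  then obtain v where "convergent2 u" "u * v = 1" by (auto simp: Units_def mult.commute)
  moreover from this have "u $ 0 $ 0 * v $ 0 $ 0 = 1" by (metis fps_mult_nth_0 fps_one_nth)
  ultimately show "convergent2 u \<and> u $ 0 $ 0 \<noteq> 0" by auto
next
  assume *: "convergent2 u \<and> u $ 0 $ 0 \<noteq> 0"
  then obtain v where "convergent2 v" "u * v = 1" using convergent2_inverse by blast
  then show "u \<in> Units conv_ring" using * by (auto simp: Units_def mult.commute)
qed

lemma plane_branch_iff:
  "plane_branch f \<longleftrightarrow> convergent2 f \<and> f \<noteq> 0 \<and> f $ 0 $ 0 = 0 \<and>
    (\<forall>a b. convergent2 a \<longrightarrow> convergent2 b \<longrightarrow> f = a * b \<longrightarrow> a $ 0 $ 0 \<noteq> 0 \<or> b $ 0 $ 0 \<noteq> 0)"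
proof
  assume f: "plane_branch f"
  then have "f \<in> carrier conv_ring" "ring_irreducible\<^bsub>conv_ring\<^esub> f" by (auto simp: plane_branch_def)
  from domain.ring_irreducibleE[OF domain_conv_ring this] this
  show "convergent2 f \<and> f \<noteq> 0 \<and> f $ 0 $ 0 = 0 \<and>
    (\<forall>a b. convergent2 a \<longrightarrow> convergent2 b \<longrightarrow> f = a * b \<longrightarrow> a $ 0 $ 0 \<noteq> 0 \<or> b $ 0 $ 0 \<noteq> 0)"
    by (simp add: Units_conv_ring)
next
  assume *: "convergent2 f \<and> f \<noteq> 0 \<and> f $ 0 $ 0 = 0 \<and>
    (\<forall>a b. convergent2 a \<longrightarrow> convergent2 b \<longrightarrow> f = a * b \<longrightarrow> a $ 0 $ 0 \<noteq> 0 \<or> b $ 0 $ 0 \<noteq> 0)"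
  have "ring_irreducible\<^bsub>conv_ring\<^esub> f"
    by (rule domain.ring_irreducibleI[OF domain_conv_ring]) (use * in \<open>auto simp: Units_conv_ring\<close>)
  then show "plane_branch f" using * by (simp add: plane_branch_def)
qed

text \<open>With \<open>x = t^n\<close>, the roots of \<open>f\<close> in \<open>y\<close> are the
  rotations of one series \<phi>. The assumption \<open>distinct\<close> says that the
  parametrization is primitive: no nontrivial rotation fixes \<phi>.\<close>

locale puiseux_parametrization =
  fixes f :: series2 and n :: nat and e :: complex and \<phi> :: "complex fps" and U :: series2
  assumes n: "n > 0" and e: "primitive_root n e"
    and conv_\<phi>: "conv1 \<phi>" and \<phi>_0: "\<phi> $ 0 = 0"
    and conv_f: "convergent2 f" and conv_U: "convergent2 U" and U_0: "U $ 0 $ 0 \<noteq> 0"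
    and distinct: "\<And>i j. i < n \<Longrightarrow> j < n \<Longrightarrow> rot (e ^ i) \<phi> = rot (e ^ j) \<phi> \<Longrightarrow> i = j"
    and factorization: "ramify n f = ramify n U * (\<Prod>k<n. fps_X - fps_const (rot (e ^ k) \<phi>))"

lemma lift_rot_ramify:
  assumes "e ^ N = 1" "N > 0" shows "lift (rot e) (ramify N h) = ramify N h"
proof (intro fps_ext)
  fix j i
  have "e ^ i = 1" if "N dvd i" using that assms by (auto simp: power_mult)
  then show "lift (rot e) (ramify N h) $ j $ i = ramify N h $ j $ i"
    using assms by (simp add: lift_def ramify_eq_lift ram_nth)
qed

lemma primitive_root_nonzero: "primitive_root N e \<Longrightarrow> e \<noteq> 0"
  using primitive_root_norm by force

lemma cyclic_shift_bij: "bij_betw (\<lambda>i. if Suc i = n then 0 else Suc i) {..<n} {..<n}"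
  by (rule bij_betw_byWitness[where f' = "\<lambda>i. if i = 0 then n - 1 else i - 1"]) auto

lemma lift_rot_conjugate_product:
  assumes e: "e ^ n = 1" "e \<noteq> 0"
  shows "lift (rot e) (\<Prod>k<n. fps_X - fps_const (rot (e ^ k) \<phi>)) = (\<Prod>k<n. fps_X - fps_const (rot (e ^ k) \<phi>))"
proof -
  interpret subst_hom "rot e" by (rule subst_hom_rot[OF e(2)])
  define s where "s i = (if Suc i = n then 0 else Suc i)" for i
  have "rot (e * e ^ k) \<phi> = rot (e ^ s k) \<phi>" for k
    using e by (auto simp: s_def simp flip: power_Suc)
  then have "lift (rot e) (\<Prod>k<n. fps_X - fps_const (rot (e ^ k) \<phi>)) = (\<Prod>k<n. fps_X - fps_const (rot (e ^ s k) \<phi>))"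
    by (simp add: lift_prod lift_diff rot_rot)
  also have "\<dots> = (\<Prod>k<n. fps_X - fps_const (rot (e ^ k) \<phi>))"
    using cyclic_shift_bij[of n] unfolding s_def[symmetric] by (rule prod.reindex_bij_betw)
  finally show ?thesis .
qed

text \<open>The power series form an integral domain, where a nonzero polynomial has at most as many
  roots as its degree; \<open>r\<close> is rewritten as a \<open>poly\<close> to apply this.\<close>

lemma zero_of_many_roots:
  assumes r: "\<And>j. j \<ge> n \<Longrightarrow> r $ j = 0"
    and g: "inj_on g {..<n}" "\<And>k. k < n \<Longrightarrow> g k $ 0 = 0" "\<And>k. k < n \<Longrightarrow> subst_y r (g k) = 0"
  shows "r = 0"
proof (rule ccontr)
  assume "r \<noteq> 0"
  define p where "p = (\<Sum>i<n. Polynomial.monom (r $ i) i)"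
  have coeff: "Polynomial.coeff p i = r $ i" for i
    using r[of i] by (auto simp: p_def coeff_sum if_distrib not_less cong: if_cong)
  then have "p \<noteq> 0" using \<open>r \<noteq> 0\<close> by (auto simp: fps_eq_iff)
  have "poly p (g k) = 0" if "k < n" for k
  proof -
    have "r = (\<Sum>i\<le>n. fps_const (r $ i) * fps_X ^ i)"
      by (rule finite_y_degree) (rule r, simp)
    then have "subst_y r (g k) = subst_y (\<Sum>i\<le>n. fps_const (r $ i) * fps_X ^ i) (g k)"
      by (rule arg_cong)
    also have "\<dots> = (\<Sum>i\<le>n. r $ i * g k ^ i)"
      by (simp add: subst_y_sum subst_y_mult subst_y_power g(2)[OF that])
    also have "\<dots> = poly p (g k)"
      using r[of n] by (simp add: p_def poly_sum poly_monom flip: lessThan_Suc_atMost)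
    finally show ?thesis using g(3)[OF that] by simp
  qed
  then have "card (g ` {..<n}) \<le> card {x. poly p x = 0}"
    using poly_roots_finite[OF \<open>p \<noteq> 0\<close>] by (intro card_mono) auto
  also have "\<dots> \<le> Polynomial.degree p" using \<open>p \<noteq> 0\<close> by (rule card_poly_roots_bound)
  also have "card (g ` {..<n}) = n" using g(1) by (simp add: card_image)
  finally have "Polynomial.coeff p (Polynomial.degree p) = 0" unfolding coeff by (rule r)
  then show False using \<open>p \<noteq> 0\<close> by simp
qed

lemma y_order_ramify: "N > 0 \<Longrightarrow> y_order (ramify N h) n \<longleftrightarrow> y_order h n"
  by (simp add: y_order_def ramify_eq_lift lift_def subst_hom.nth_0[OF subst_hom_ram])

lemma conjugate_product:
  fixes \<psi> :: "nat \<Rightarrow> complex fps"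
  assumes "\<And>k. \<psi> k $ 0 = 0"
  shows "y_order (\<Prod>k<n. fps_X - fps_const (\<psi> k)) n"
proof (induction n)
  case (Suc n)
  then show ?case using y_order_mult[OF Suc y_order_linear[OF assms[of n]]] by simp
qed (simp add: y_order_def)

text \<open>A root of least ramification \<open>N\<close> has \<open>N\<close> distinct conjugates.
  The product over them descends to a series in \<open>x\<close> dividing \<open>f\<close>;
  irreducibility makes the cofactor a unit, and the orders in \<open>y\<close> give
  \<open>N = n\<close>.\<close>

theorem branch_has_parametrization:
  assumes f: "plane_branch f" and ord: "y_order f n" and n: "n > 0" and e: "primitive_root n e"
  shows "\<exists>\<phi> U. puiseux_parametrization f n e \<phi> U"
proof -
  have conv_f: "convergent2 f" using f by (simp add: plane_branch_iff)
  define P where "P N \<longleftrightarrow> N > 0 \<and> (\<exists>\<phi>. conv1 \<phi> \<and> \<phi> $ 0 = 0 \<and> subst_y (ramify N f) \<phi> = 0)" for N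
  have "\<exists>N. P N" using puiseux_root[OF conv_f ord n] by (auto simp: P_def)
  define N where "N = (LEAST N. P N)"
  have "P N" unfolding N_def using \<open>\<exists>N. P N\<close> by (rule LeastI_ex)
  then obtain \<phi> where N: "N > 0" and \<phi>: "conv1 \<phi>" "\<phi> $ 0 = 0" "subst_y (ramify N f) \<phi> = 0"
    by (auto simp: P_def)
  have main: "N = n \<and> (\<exists>U. puiseux_parametrization f N e' \<phi> U)" if e': "primitive_root N e'" for e'
  proof -
    have e'N: "e' ^ N = 1" "e' \<noteq> 0" using e' primitive_root_nonzero by (auto simp: primitive_root_def)
    have no_stabilizer: False if ij: "i < j" "j < N" "rot (e' ^ i) \<phi> = rot (e' ^ j) \<phi>" for i j
    proof -
      \<comment> \<open>Two equal rotations confine the support of \<phi> to multiples of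
        \<open>d\<close>. Then \<phi> is a series in \<open>t^d\<close>, and \<open>f\<close> has a
        root with the smaller ramification \<open>N div d\<close>.\<close>
      define d where "d = N div gcd N (j - i)"
      have supp: "d dvd k" if "\<phi> $ k \<noteq> 0" for k
      proof -
        have "(e' ^ i) ^ k * \<phi> $ k = (e' ^ j) ^ k * \<phi> $ k"
          using arg_cong[OF ij(3), of "\<lambda>a. a $ k"] by simp
        then have "e' ^ (i * k) = e' ^ (i * k + (j - i) * k)"
          using that ij by (simp add: power_mult flip: add_mult_distrib)
        then have "e' ^ ((j - i) * k) = 1" using e'N by (simp add: power_add)
        then have "N dvd (j - i) * k" using e' by (simp add: primitive_root_def)
        then have "N div gcd N (j - i) dvd (j - i) div gcd N (j - i) * k"
          using N by (metis div_dvd_div dvd_mult2 gcd_dvd1 gcd_dvd2 dvd_div_mult)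
        moreover have "coprime (N div gcd N (j - i)) ((j - i) div gcd N (j - i))"
          using N by (intro div_gcd_coprime) auto
        ultimately show "d dvd k" by (simp add: d_def coprime_dvd_mult_right_iff)
      qed
      have Nd: "N = d * gcd N (j - i)" by (simp add: d_def)
      then have d0: "d > 0" and g0: "gcd N (j - i) > 0" using N by (auto intro!: gr0I)
      have "gcd N (j - i) \<le> j - i" using ij by (intro gcd_le2_nat) auto
      then have gN: "gcd N (j - i) < N" using ij by linarith
      obtain e2 where e2: "primitive_root d e2" using primitive_root_exists[OF d0] by blast
      have "e2 ^ k * \<phi> $ k = \<phi> $ k" for k
        using supp[of k] e2 by (cases "\<phi> $ k = 0") (auto simp: primitive_root_def power_mult)
      then have "rot e2 \<phi> = \<phi>" by (intro fps_ext) simp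
      from descent[OF e2 \<phi>(1) this] obtain \<phi>' where \<phi>': "conv1 \<phi>'" "\<phi> = ram d \<phi>'" by blast
      interpret d: subst_hom "ram d" by (rule subst_hom_ram[OF d0])
      have \<phi>'0: "\<phi>' $ 0 = 0" using \<phi>(2) \<phi>'(2) by (simp add: d.nth_0)
      have "ramify N f = lift (ram d) (ramify (gcd N (j - i)) f)"
        using ramify_ramify[OF d0 g0] Nd by (simp add: ramify_eq_lift)
      then have "ram d (subst_y (ramify (gcd N (j - i)) f) \<phi>') = 0"
        using \<phi>(3) d.subst_y[OF \<phi>'0] \<phi>'(2) by simp
      then have "P (gcd N (j - i))" using \<phi>' \<phi>'0 g0 by (auto simp: P_def)
      then show False using gN not_less_Least[of _ P] unfolding N_def by blast
    qed
    have dist: "i = j" if "i < N" "j < N" "rot (e' ^ i) \<phi> = rot (e' ^ j) \<phi>" for i j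
      using no_stabilizer[of i j] no_stabilizer[of j i] that by (metis linorder_cases)
    have conj0: "rot (e' ^ k) \<phi> $ 0 = 0" for k using \<phi> by simp
    have convk: "conv1 (rot (e' ^ k) \<phi>)" for k
      using \<phi>(1) primitive_root_norm[OF e'] by (intro conv1_rot) (auto simp: norm_power)
    have root: "subst_y (ramify N f) (rot (e' ^ k) \<phi>) = 0" for k
    proof -
      interpret k: subst_hom "rot (e' ^ k)" by (rule subst_hom_rot) (use e'N in auto)
      have "(e' ^ k) ^ N = 1" using e'N by (metis mult.commute power_mult power_one)
      then show ?thesis
        using k.subst_y[OF \<phi>(2), of "ramify N f"] \<phi>(3) N by (simp add: lift_rot_ramify)
    qed
    define Q where "Q = (\<Prod>k<N. fps_X - fps_const (rot (e' ^ k) \<phi>))"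
    have "convergent2 Q" unfolding Q_def using convk by (intro convergent2_prod convergent2_diff) auto
    moreover have "lift (rot e') Q = Q" unfolding Q_def using e'N by (rule lift_rot_conjugate_product)
    ultimately obtain Q0 where Q0: "convergent2 Q0" "Q = ramify N Q0" using descent_lift[OF e'] by blast
    have "y_order Q N" unfolding Q_def by (rule conjugate_product) (rule conj0)
    then have ordQ0: "y_order Q0 N" using Q0 y_order_ramify[OF N] by simp
    obtain q r where qr: "convergent2 q" "convergent2 r" "f = q * Q0 + r" "\<forall>j\<ge>N. r $ j = 0"
      using weierstrass_division[OF Q0(1) ordQ0 conv_f] by blast
    interpret N: subst_hom "ram N" by (rule subst_hom_ram[OF N])
    have rf: "ramify N f = ramify N q * Q + ramify N r"
      by (simp add: qr(3) ramify_eq_lift N.lift_add N.lift_mult Q0(2))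
    have "ramify N r = 0"
    proof (rule zero_of_many_roots[where g = "\<lambda>k. rot (e' ^ k) \<phi>" and n = N])
      show "inj_on (\<lambda>k. rot (e' ^ k) \<phi>) {..<N}" using dist by (auto intro!: inj_onI)
      show "ramify N r $ j = 0" if "j \<ge> N" for j using qr(4) that by (simp add: ramify_eq_lift)
      fix k assume k: "k < N"
      have "subst_y Q (rot (e' ^ k) \<phi>) = 0"
        unfolding Q_def using conj0 k by (auto simp: subst_y_prod subst_y_diff intro!: bexI[of _ k])
      then show "subst_y (ramify N r) (rot (e' ^ k) \<phi>) = 0"
        using root[of k] conj0 by (simp add: rf subst_y_add subst_y_mult)
    qed (rule conj0)
    then have "r = 0" using N.lift_eq_iff[of r 0] by (simp add: ramify_eq_lift)
    then have fq: "f = q * Q0" using qr(3) by simp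
    have "Q0 $ 0 $ 0 = 0" using ordQ0 N by (simp add: y_order_def)
    then have q0: "q $ 0 $ 0 \<noteq> 0" using f fq qr(1) Q0(1) unfolding plane_branch_iff by blast
    then have "y_order q 0" by (simp add: y_order_def)
    then have "y_order f N" using y_order_mult[OF _ ordQ0, of q 0] fq by simp
    then have "N = n" using ord by (simp add: y_order_iff)
    moreover have "puiseux_parametrization f N e' \<phi> q"
      by unfold_locales (use N e' \<phi> conv_f qr(1) q0 dist rf \<open>r = 0\<close> in \<open>auto simp: Q_def ramify_eq_lift\<close>)
    ultimately show ?thesis by blast
  qed
  \<comment> \<open>The given \<open>e\<close> has order \<open>n\<close>, so it can be used only
    after some primitive \<open>N\<close>-th root has shown \<open>N = n\<close>.\<close>
  obtain e' where "primitive_root N e'" using primitive_root_exists[OF N] by blast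
  then have "N = n" using main by blast
  with main e show ?thesis by blast
qed

context puiseux_parametrization
begin

definition val :: "series2 \<Rightarrow> complex fps" where
  "val h = subst_y (ramify n h) \<phi>"

abbreviation conj :: "nat \<Rightarrow> complex fps" where
  "conj k \<equiv> rot (e ^ k) \<phi>"

sublocale ram: subst_hom "ram n" by (rule subst_hom_ram[OF n])

lemma val_add: "val (h + k) = val h + val k"
  by (simp add: val_def ramify_eq_lift ram.lift_add subst_y_add)

lemma val_diff: "val (h - k) = val h - val k"
  by (simp add: val_def ramify_eq_lift ram.lift_diff subst_y_diff)

lemma val_mult: "val (h * k) = val h * val k"
  by (simp add: val_def ramify_eq_lift ram.lift_mult subst_y_mult \<phi>_0)

lemma val_const [simp]: "val (fps_const a) = ram n a"
  by (simp add: val_def ramify_eq_lift)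

lemma val_X [simp]: "val fps_X = \<phi>"
  by (simp add: val_def ramify_eq_lift \<phi>_0)

lemma val_0 [simp]: "val 0 = 0" using val_const[of 0] by simp

lemma val_1 [simp]: "val 1 = 1" using val_const[of 1] by (simp add: ram.one)

lemma val_power: "val (h ^ k) = val h ^ k"
  by (induction k) (auto simp: val_mult)

lemma val_sum: "val (sum h A) = (\<Sum>i\<in>A. val (h i))"
  by (induction A rule: infinite_finite_induct) (auto simp: val_add)

lemma conv1_val: "convergent2 h \<Longrightarrow> conv1 (val h)"
  unfolding val_def using n conv_\<phi> \<phi>_0 by (intro conv1_subst_y convergent2_ramify)

lemma e_power_n: "e ^ n = 1" and e_nonzero: "e \<noteq> 0"
  using e primitive_root_nonzero by (auto simp: primitive_root_def)

lemma conj_0 [simp]: "conj k $ 0 = 0" by (simp add: \<phi>_0)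

lemma conv1_conj: "conv1 (conj k)"
  using conv_\<phi> primitive_root_norm[OF e] by (intro conv1_rot) (auto simp: norm_power)

text \<open>A series in \<open>t^n\<close> is invariant under the rotation, so only the argument
  \<phi> moves.\<close>

lemma rot_val: "rot (e ^ k) (val h) = subst_y (ramify n h) (conj k)"
proof -
  interpret k: subst_hom "rot (e ^ k)" by (rule subst_hom_rot) (use e_nonzero in auto)
  have "(e ^ k) ^ n = 1" using e_power_n by (metis mult.commute power_mult power_one)
  then show ?thesis
    using k.subst_y[OF \<phi>_0, of "ramify n h"] n by (simp add: val_def lift_rot_ramify)
qed

lemma y_order_f: "y_order f n"
proof -
  have "y_order (ramify n U) 0" using U_0 y_order_ramify[OF n, of U 0] by (simp add: y_order_def)
  from y_order_mult[OF this conjugate_product[of conj n, OF conj_0]] show ?thesis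
    using y_order_ramify[OF n, of f n] by (simp add: factorization)
qed

lemma val_f [simp]: "val f = 0"
  using n by (auto simp: val_def factorization subst_y_mult subst_y_prod subst_y_diff \<phi>_0 intro!: bexI[of _ 0])

text \<open>The remainder of division by \<open>f\<close> has degree below \<open>n\<close> in
  \<open>y\<close> and, after rotation, vanishes at all \<open>n\<close> conjugates.\<close>

lemma val_eq_0_iff:
  assumes h: "convergent2 h"
  shows "val h = 0 \<longleftrightarrow> (\<exists>q. convergent2 q \<and> h = q * f)"
proof
  assume 0: "val h = 0"
  obtain q r where qr: "convergent2 q" "h = q * f + r" "\<forall>j\<ge>n. r $ j = 0"
    using weierstrass_division[OF conv_f y_order_f h] by blast
  then have "val r = 0" using 0 by (simp add: val_add val_mult)
  have "ramify n r = 0"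
  proof (rule zero_of_many_roots[where g = conj and n = n])
    show "inj_on conj {..<n}" using distinct by (auto intro!: inj_onI)
    show "ramify n r $ j = 0" if "j \<ge> n" for j using qr(3) that by (simp add: ramify_eq_lift)
    fix k
    have "subst_hom (rot (e ^ k))" by (rule subst_hom_rot) (use e_nonzero in auto)
    then show "subst_y (ramify n r) (conj k) = 0"
      using rot_val[of k r] \<open>val r = 0\<close> subst_hom.zero by metis
  qed (simp add: \<phi>_0)
  then have "r = 0" using ram.lift_eq_iff[of r 0] by (simp add: ramify_eq_lift)
  then show "\<exists>q. convergent2 q \<and> h = q * f" using qr by auto
qed (auto simp: val_mult)

text \<open>
  A multiple of \<open>\<Prod>k\<noteq>0. \<phi> - conj k\<close> is the value at \<open>\<phi>\<close> of its Lagrange interpolation polynomial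
  at the conjugates, which descends to \<open>x\<close>. Hence the order of that product bounds the conductor.
\<close>

lemma conductor: "\<exists>c. \<forall>g. conv1 g \<longrightarrow> g = 0 \<or> subdegree g \<ge> c \<longrightarrow> (\<exists>h. convergent2 h \<and> val h = g)"
proof -
  define \<delta> where "\<delta> = (\<Prod>k\<in>{..<n} - {0}. \<phi> - conj k)"
  have "\<phi> \<noteq> conj k" if "k \<in> {..<n} - {0}" for k
    using distinct[of k 0] that n by auto
  then have \<delta>0: "\<delta> \<noteq> 0" by (auto simp: \<delta>_def)
  have conv\<delta>: "conv1 \<delta>" unfolding \<delta>_def using conv_\<phi> conv1_conj by (intro conv1_prod conv1_diff)
  have "\<exists>h. convergent2 h \<and> val h = g" if g: "conv1 g" "g = 0 \<or> subdegree g \<ge> subdegree \<delta>" for g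
  proof -
    obtain g' where g': "conv1 g'" "g = g' * \<delta>"
      using conv1_divide[OF g(1) conv\<delta> \<delta>0] g(2) by blast
    define L where "L i = (\<Prod>k\<in>{..<n} - {i}. fps_X - fps_const (conj k))" for i
    define G where "G = (\<Sum>i<n. fps_const (rot (e ^ i) g') * L i)"
    define s where "s i = (if Suc i = n then 0 else Suc i)" for i
    have s: "bij_betw s {..<n} {..<n}" unfolding s_def by (rule cyclic_shift_bij)
    have es: "e * e ^ k = e ^ s k" for k using e_power_n by (auto simp: s_def simp flip: power_Suc)
    interpret e: subst_hom "rot e" by (rule subst_hom_rot[OF e_nonzero])
    have Ls: "lift (rot e) (L i) = L (s i)" if "i < n" for i
    proof -
      have "bij_betw s ({..<n} - {i}) ({..<n} - {s i})"
        using s that by (intro bij_betw_DiffI) (auto simp: s_def)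
      from prod.reindex_bij_betw[OF this, of "\<lambda>k. fps_X - fps_const (conj k)"]
      show ?thesis by (simp add: L_def e.lift_prod e.lift_diff rot_rot es)
    qed
    have "lift (rot e) G = (\<Sum>i<n. fps_const (rot (e ^ s i) g') * L (s i))"
      by (simp add: G_def e.lift_sum e.lift_mult rot_rot es Ls)
    also have "\<dots> = G" unfolding G_def by (rule sum.reindex_bij_betw[OF s])
    finally have "lift (rot e) G = G" .
    moreover have "convergent2 G"
      unfolding G_def L_def using conv1_conj g' primitive_root_norm[OF e]
      by (intro convergent2_sum convergent2_mult convergent2_prod convergent2_diff)
        (auto intro!: conv1_rot simp: norm_power)
    ultimately obtain h where h: "convergent2 h" "G = ramify n h" using descent_lift[OF e] by blast
    have "val h = (\<Sum>i<n. rot (e ^ i) g' * (\<Prod>k\<in>{..<n} - {i}. \<phi> - conj k))"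
      unfolding val_def h(2)[symmetric] G_def L_def
      by (simp add: subst_y_sum subst_y_mult subst_y_prod subst_y_diff \<phi>_0)
    \<comment> \<open>Every summand with \<open>i\<close> other than 0 contains the factor
      \<open>\<phi> - conj 0 = 0\<close>.\<close>
    also have "\<dots> = (\<Sum>i\<in>{0}. rot (e ^ i) g' * (\<Prod>k\<in>{..<n} - {i}. \<phi> - conj k))"
      using n by (intro sum.mono_neutral_right) (auto intro!: bexI[of _ 0])
    also have "\<dots> = g" by (simp add: g' \<delta>_def)
    finally show ?thesis using h(1) by blast
  qed
  then show ?thesis by blast
qed

end

section \<open>Intersection numbers as orders\<close>

lemma uminus_conv_ring: "convergent2 h \<Longrightarrow> \<ominus>\<^bsub>conv_ring\<^esub> h = - h"
proof -
  interpret cring conv_ring by (rule cring_conv_ring)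
  show "convergent2 h \<Longrightarrow> \<ominus>\<^bsub>conv_ring\<^esub> h = - h" by (rule minus_equality) auto
qed

lemma minus_conv_ring: "convergent2 h \<Longrightarrow> convergent2 k \<Longrightarrow> h \<ominus>\<^bsub>conv_ring\<^esub> k = h - k"
  by (simp add: a_minus_def uminus_conv_ring)

lemma const2_simps:
  "const2 0 = 0" "const2 1 = 1" "const2 (a + b) = const2 a + const2 b" "const2 (a * b) = const2 a * const2 b"
  "const2 (- a) = - const2 a"
  by (simp_all add: const2_def fps_const_neg[symmetric] del: fps_const_neg)

lemma convergent2_const2 [simp]: "convergent2 (const2 c)"
  by (simp add: const2_def)

lemma genideal_two:
  assumes "convergent2 f" "convergent2 h"
  shows "genideal conv_ring {f, h} = {a * f + b * h |a b. convergent2 a \<and> convergent2 b}" (is "_ = ?I")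
proof -
  interpret cring conv_ring by (rule cring_conv_ring)
  have "ideal ?I conv_ring"
  proof (rule idealI)
    show "subgroup ?I (add_monoid conv_ring)"
    proof (rule add.subgroupI)
      show "?I \<subseteq> carrier conv_ring"
        using convergent2_add[OF convergent2_mult[OF _ assms(1)] convergent2_mult[OF _ assms(2)]] by auto
      show "?I \<noteq> {}" using convergent2_0 by blast
      show "\<ominus>\<^bsub>conv_ring\<^esub> x \<in> ?I" if "x \<in> ?I" for x
      proof -
        obtain a b where ab: "x = a * f + b * h" "convergent2 a" "convergent2 b" using \<open>x \<in> ?I\<close> by blast
        then have "- x = (- a) * f + (- b) * h" "convergent2 (- a)" "convergent2 (- b)" by auto
        moreover have "convergent2 x" unfolding ab(1) using ab(2,3) assms by (intro convergent2_add convergent2_mult)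
        ultimately show ?thesis unfolding uminus_conv_ring[OF \<open>convergent2 x\<close>] by blast
      qed
      show "x \<oplus>\<^bsub>conv_ring\<^esub> y \<in> ?I" if "x \<in> ?I" "y \<in> ?I" for x y
      proof -
        obtain a b where ab: "x = a * f + b * h" "convergent2 a" "convergent2 b" using \<open>x \<in> ?I\<close> by blast
        obtain a' b' where ab': "y = a' * f + b' * h" "convergent2 a'" "convergent2 b'" using \<open>y \<in> ?I\<close> by blast
        have "x + y = (a + a') * f + (b + b') * h" using ab ab' by (simp add: algebra_simps)
        then show ?thesis using ab ab' unfolding conv_ring_simps by blast
      qed
    qed
    show 1: "x \<otimes>\<^bsub>conv_ring\<^esub> z \<in> ?I" if "z \<in> ?I" "x \<in> carrier conv_ring" for z x
    proof -
      obtain a b where ab: "z = a * f + b * h" "convergent2 a" "convergent2 b" using \<open>z \<in> ?I\<close> by blast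
      have "x * z = (x * a) * f + (x * b) * h" using ab by (simp add: algebra_simps)
      moreover have "convergent2 (x * a)" "convergent2 (x * b)" using ab that by auto
      ultimately show ?thesis unfolding conv_ring_simps by blast
    qed
    show "z \<otimes>\<^bsub>conv_ring\<^esub> x \<in> ?I" if "z \<in> ?I" "x \<in> carrier conv_ring" for z x
      using 1[OF that] by (simp add: mult.commute)
  qed (rule ring_axioms)
  moreover have "f = 1 * f + 0 * h" "h = 0 * f + 1 * h" by auto
  then have "{f, h} \<subseteq> ?I" using convergent2_0 convergent2_1 by blast
  ultimately have "genideal conv_ring {f, h} \<subseteq> ?I" by (rule genideal_minimal)
  moreover have "?I \<subseteq> genideal conv_ring {f, h}"
  proof
    fix x assume "x \<in> ?I"
    then obtain a b where ab: "x = a * f + b * h" "convergent2 a" "convergent2 b" by blast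
    interpret J: ideal "genideal conv_ring {f, h}" conv_ring
      using assms by (intro genideal_ideal) auto
    have "{f, h} \<subseteq> genideal conv_ring {f, h}" using assms by (intro genideal_self) auto
    then have "a * f \<in> genideal conv_ring {f, h}" "b * h \<in> genideal conv_ring {f, h}"
      using J.I_l_closed[of f a] J.I_l_closed[of h b] ab by auto
    then show "x \<in> genideal conv_ring {f, h}" using J.a_closed[of "a * f" "b * h"] ab(1) by simp
  qed
  ultimately show ?thesis by blast
qed

lemma genideal_one:
  assumes "convergent2 f"
  shows "genideal conv_ring {f} = {q * f |q. convergent2 q}"
  using cring.cgenideal_eq_genideal[OF cring_conv_ring, of f] assms by (simp add: cgenideal_def)

text \<open>Over a subfield the dimension is unique; the scalars of the local algebra are the image
  of this one.\<close>

lemma subfield_constants: "subfield (range const2) conv_ring"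
proof -
  interpret cring conv_ring by (rule cring_conv_ring)
  have "subring (range const2) conv_ring"
    by (rule subringI) (auto simp: uminus_conv_ring const2_simps[symmetric])
  then have "subcring (range const2) conv_ring"
    by (rule subcringI) (auto simp: mult.commute)
  moreover have "Units (conv_ring\<lparr>carrier := range const2\<rparr>) = range const2 - {\<zero>\<^bsub>conv_ring\<^esub>}"
  proof -
    have "\<exists>y. const2 y * const2 x = 1 \<and> const2 x * const2 y = 1" if "const2 x \<noteq> 0" for x
      using that by (intro exI[of _ "1 / x"]) (auto simp: const2_simps[symmetric])
    then show ?thesis by (auto simp: Units_def)
  qed
  ultimately show ?thesis by (rule subfieldI)
qed

text \<open>Serves the case where \<open>(f, h)\<close> is the unit ideal: in the zero quotient the
  scalars are not a field, so uniqueness of the dimension is shown directly.\<close>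

lemma (in ring) dimension_trivial_ring:
  assumes "dimension n K E" "carrier R = {\<zero>}"
  shows "n = 0 \<and> E = {\<zero>}"
  using assms by (induction rule: dimension.induct) auto

text \<open>The hypotheses say that the classes of the \<open>g k\<close> are a basis of the local
  algebra. The dimension is built up by adjoining one class at a time.\<close>

lemma intersection_number_eqI:
  assumes f: "convergent2 f" and h: "convergent2 h" and g: "\<And>k. k < d \<Longrightarrow> convergent2 (g k)"
    and spanning: "\<And>r. convergent2 r \<Longrightarrow>
      \<exists>c a b. convergent2 a \<and> convergent2 b \<and> r = (\<Sum>k<d. const2 (c k) * g k) + (a * f + b * h)"
    and independent: "\<And>c a b. convergent2 a \<Longrightarrow> convergent2 b \<Longrightarrow>
      (\<Sum>k<d. const2 (c k) * g k) = a * f + b * h \<Longrightarrow> \<forall>k<d. c k = 0"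
  shows "intersection_number f h = enat d"
proof -
  interpret cring conv_ring by (rule cring_conv_ring)
  define I where "I = genideal conv_ring {f, h}"
  have I_iff: "x \<in> I \<longleftrightarrow> (\<exists>a b. convergent2 a \<and> convergent2 b \<and> x = a * f + b * h)" for x
    unfolding I_def genideal_two[OF f h] by blast
  interpret I: ideal I conv_ring unfolding I_def using f h by (intro genideal_ideal) auto
  define A where "A = conv_ring Quot I"
  define cl where "cl = (+>\<^bsub>conv_ring\<^esub>) I"
  interpret cl: ring_hom_ring conv_ring A cl unfolding A_def cl_def by (rule I.rcos_ring_hom_ring)
  have carrier_A: "carrier A = cl ` {h. convergent2 h}"
    by (auto simp: A_def cl_def FactRing_def A_RCOSETS_def')
  have cl_eq: "cl x = cl y \<longleftrightarrow> x - y \<in> I" if "convergent2 x" "convergent2 y" for x y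
    using quotient_eq_iff_same_a_r_cos[OF I.ideal_axioms, of x y] that
    by (simp add: cl_def minus_conv_ring)
  have cl_add: "cl x \<oplus>\<^bsub>A\<^esub> cl y = cl (x + y)" if "convergent2 x" "convergent2 y" for x y
    using cl.hom_add[of x y] that by simp
  have cl_mult: "cl x \<otimes>\<^bsub>A\<^esub> cl y = cl (x * y)" if "convergent2 x" "convergent2 y" for x y
    using cl.hom_mult[of x y] that by simp
  have cl_0: "cl 0 = \<zero>\<^bsub>A\<^esub>" using cl.hom_zero by simp
  define K where "K = range (\<lambda>c. cl (const2 c))"
  define lin where "lin m c = (\<Sum>k<m. const2 (c k) * g k)" for m c
  have conv_lin: "convergent2 (lin m c)" if "m \<le> d" for m c
    unfolding lin_def using g that by (intro convergent2_sum convergent2_mult) auto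
  have dim: "cl.S.dimension m K (range (\<lambda>c. cl (lin m c)))" if "m \<le> d" for m
    using that
  proof (induction m)
    case 0
    have "range (\<lambda>c. cl (lin 0 c)) = {\<zero>\<^bsub>A\<^esub>}" by (auto simp: lin_def cl_0)
    then show ?case by simp
  next
    case (Suc m)
    have not_in: "cl (g m) \<notin> range (\<lambda>c. cl (lin m c))"
    proof
      assume "cl (g m) \<in> range (\<lambda>c. cl (lin m c))"
      then obtain c where "cl (g m) = cl (lin m c)" by auto
      then have "g m - lin m c \<in> I" using cl_eq g conv_lin Suc.prems by auto
      then obtain a b where ab: "convergent2 a" "convergent2 b" "g m - lin m c = a * f + b * h"
        unfolding I_iff by blast
      \<comment> \<open>Turns an expression of \<open>g m\<close> by its predecessors into a
        relation whose coefficient at \<open>m\<close> is 1.\<close>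
      define c' where "c' k = (if k < m then - c k else if k = m then 1 else 0)" for k
      have "(\<Sum>k<d. const2 (c' k) * g k) = (\<Sum>k<Suc m. const2 (c' k) * g k)"
        using Suc.prems by (intro sum.mono_neutral_right) (auto simp: c'_def const2_simps)
      also have "\<dots> = g m - lin m c"
        by (simp add: c'_def const2_simps lin_def sum_negf)
      finally have "\<forall>k<d. c' k = 0" using independent[OF ab(1,2)] ab(3) by simp
      then have "c' m = 0" using Suc.prems by auto
      then show False by (simp add: c'_def)
    qed
    have "cl.S.line_extension K (cl (g m)) (range (\<lambda>c. cl (lin m c))) = range (\<lambda>c. cl (lin (Suc m) c))"
    proof -
      have "cl (const2 x) \<otimes>\<^bsub>A\<^esub> cl (g m) \<oplus>\<^bsub>A\<^esub> cl (lin m c) = cl (const2 x * g m + lin m c)" for x c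
        using g conv_lin[of m] Suc.prems by (simp add: cl_add cl_mult convergent2_mult)
      then have "cl.S.line_extension K (cl (g m)) (range (\<lambda>c. cl (lin m c))) =
          {cl (const2 x * g m + lin m c) |x c. True}"
        by (auto simp: cl.S.line_extension_def set_add_def' r_coset_def K_def)
      also have "\<dots> = range (\<lambda>c. cl (lin (Suc m) c))"
      proof (intro equalityI subsetI)
        fix z assume "z \<in> {cl (const2 x * g m + lin m c) |x c. True}"
        then obtain x c where "z = cl (const2 x * g m + lin m c)" by blast
        moreover have "const2 x * g m + lin m c = lin (Suc m) (c(m := x))"
          by (simp add: lin_def)
        ultimately show "z \<in> range (\<lambda>c. cl (lin (Suc m) c))" by auto
      next
        fix z assume "z \<in> range (\<lambda>c. cl (lin (Suc m) c))"
        then obtain c where "z = cl (lin (Suc m) c)" by blast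
        moreover have "lin (Suc m) c = const2 (c m) * g m + lin m c" by (simp add: lin_def)
        ultimately show "z \<in> {cl (const2 x * g m + lin m c) |x c. True}" by auto
      qed
      finally show ?thesis .
    qed
    moreover have "cl (g m) \<in> carrier A" using g Suc.prems by (auto simp: carrier_A)
    ultimately show ?case using cl.S.dimension.Suc_dim[OF _ not_in Suc.IH] Suc.prems by simp
  qed
  have "range (\<lambda>c. cl (lin d c)) = carrier A"
  proof (intro equalityI subsetI)
    show "z \<in> carrier A" if "z \<in> range (\<lambda>c. cl (lin d c))" for z
      using that conv_lin by (auto simp: carrier_A)
    fix z assume "z \<in> carrier A"
    then obtain r where r: "convergent2 r" "z = cl r" by (auto simp: carrier_A)
    obtain c a b where ab: "convergent2 a" "convergent2 b" "r = lin d c + (a * f + b * h)"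
      using spanning[OF r(1)] unfolding lin_def by blast
    then have "r - lin d c = a * f + b * h" by simp
    then have "r - lin d c \<in> I" unfolding I_iff using ab(1,2) by blast
    then have "z = cl (lin d c)" using cl_eq r conv_lin by simp
    then show "z \<in> range (\<lambda>c. cl (lin d c))" by simp
  qed
  with dim[of d] have dim_A: "cl.S.dimension d K (carrier A)" by simp
  have "cl.S.dim K (carrier A) = d"
  proof (cases "\<one>\<^bsub>A\<^esub> = \<zero>\<^bsub>A\<^esub>")
    case True
    then have "carrier A = {\<zero>\<^bsub>A\<^esub>}" using cl.S.one_zeroD by simp
    then have "n = 0" if "cl.S.dimension n K (carrier A)" for n
      using cl.S.dimension_trivial_ring[OF that] by simp
    then show ?thesis unfolding cl.S.dim_def using dim_A by (intro the_equality) auto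
  next
    case False
    have "K = cl ` range const2" by (auto simp: K_def)
    then have "subfield K A" using cl.img_is_subfield(2)[OF subfield_constants False] by simp
    then show ?thesis using cl.S.dimI[OF _ dim_A] by (simp add: over_def)
  qed
  moreover have "cl.S.finite_dimension K (carrier A)" using dim_A by (rule cl.S.finite_dimensionI)
  moreover have "local_algebra f h = A" by (simp add: local_algebra_def A_def I_def)
  moreover have "scalars f h = K" by (simp add: scalars_def K_def cl_def I_def)
  ultimately show ?thesis by (simp add: intersection_number_def Let_def)
qed

section \<open>Bases read off from orders\<close>

lemma subdegree_sum_distinct:
  fixes t :: "'a \<Rightarrow> complex fps"
  assumes A: "finite A" and inj: "inj_on (\<lambda>k. subdegree (t k)) {k \<in> A. t k \<noteq> 0}"
    and k0: "k0 \<in> A" "t k0 \<noteq> 0"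
  obtains k where "k \<in> A" "t k \<noteq> 0" "sum t A \<noteq> 0" "subdegree (sum t A) = subdegree (t k)"
proof -
  define B where "B = {k \<in> A. t k \<noteq> 0}"
  have B: "finite B" "B \<noteq> {}" using A k0 by (auto simp: B_def)
  define \<mu> where "\<mu> = Min ((\<lambda>k. subdegree (t k)) ` B)"
  have "\<mu> \<in> (\<lambda>k. subdegree (t k)) ` B" unfolding \<mu>_def using B by (intro Min_in) auto
  then obtain k where k: "k \<in> B" "\<mu> = subdegree (t k)" by blast
  have min: "subdegree (t k) \<le> subdegree (t l)" if "l \<in> B" for l
    unfolding k(2)[symmetric] \<mu>_def using B that by (intro Min_le) auto
  have zero: "t l $ i = 0" if "l \<in> A" "l \<noteq> k" "i \<le> subdegree (t k)" for l i
  proof (cases "l \<in> B")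
    case True
    then have "subdegree (t l) \<noteq> subdegree (t k)"
      using inj k(1) that(2) by (auto simp: B_def inj_on_def)
    then show ?thesis using min[OF True] that by (intro nth_less_subdegree_zero) simp
  qed (use that in \<open>auto simp: B_def\<close>)
  have nth: "sum t A $ i = t k $ i" if "i \<le> subdegree (t k)" for i
  proof -
    have "sum t A $ i = (\<Sum>l\<in>{k}. t l $ i)"
      unfolding fps_sum_nth using A k(1) zero that by (intro sum.mono_neutral_right) (auto simp: B_def)
    then show ?thesis by simp
  qed
  have "t k \<noteq> 0" "k \<in> A" using k(1) by (auto simp: B_def)
  have "subdegree (sum t A) = subdegree (t k)"
    by (rule subdegreeI) (use nth \<open>t k \<noteq> 0\<close> in \<open>auto intro: nth_less_subdegree_zero\<close>)
  moreover have "sum t A \<noteq> 0" using nth[of "subdegree (t k)"] \<open>t k \<noteq> 0\<close> by auto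
  ultimately show ?thesis using that \<open>t k \<noteq> 0\<close> \<open>k \<in> A\<close> by blast
qed

lemma subdegree_cancel:
  fixes a b :: "complex fps"
  assumes "b \<noteq> 0" "subdegree a = subdegree b"
  obtains c where "a - fps_const c * b = 0 \<or> subdegree (a - fps_const c * b) > subdegree a"
proof
  define c where "c = a $ subdegree a / b $ subdegree b"
  have b: "b $ subdegree b \<noteq> 0" using assms by simp
  show "a - fps_const c * b = 0 \<or> subdegree (a - fps_const c * b) > subdegree a"
  proof (rule disjCI)
    assume not_less: "\<not> subdegree a < subdegree (a - fps_const c * b)"
    show "a - fps_const c * b = 0"
    proof (rule ccontr)
      assume nz: "a - fps_const c * b \<noteq> 0"
      have "(a - fps_const c * b) $ i = 0" if "i \<le> subdegree a" for i
      proof (cases "i = subdegree a")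
        case True
        then show ?thesis using b assms(2) by (simp add: c_def)
      next
        case False
        then have "i < subdegree a" "i < subdegree b" using that assms by auto
        then show ?thesis by (simp add: nth_less_subdegree_zero[of i a] nth_less_subdegree_zero[of i b])
      qed
      then have "subdegree a < subdegree (a - fps_const c * b)"
        by (rule subdegree_greaterI[OF nz])
      then show False using not_less by simp
    qed
  qed
qed

text \<open>Below \<open>c + d\<close> the set \<open>S\<close> has \<open>d\<close> more elements
  than its translate, and from there on both contain everything. For a value semigroup the
  difference indexes a basis of the local algebra.\<close>

lemma card_numerical_set_diff_shift:
  fixes S :: "nat set"
  assumes "\<And>s. s \<in> S \<Longrightarrow> d + s \<in> S" and "\<And>m. m \<ge> c \<Longrightarrow> m \<in> S"
  shows "finite (S - (+) d ` S) \<and> card (S - (+) d ` S) = d"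
proof -
  define T where "T = S \<inter> {..<c}"
  have "S - (+) d ` S = T \<union> {c..<c + d} - (+) d ` T"
  proof (intro equalityI subsetI)
    fix m assume m: "m \<in> S - (+) d ` S"
    have "m < c + d"
    proof (rule ccontr)
      assume "\<not> m < c + d"
      then have "m = d + (m - d)" "m - d \<in> S" using assms(2) by auto
      then show False using m by blast
    qed
    then show "m \<in> T \<union> {c..<c + d} - (+) d ` T" using m by (auto simp: T_def)
  next
    fix m assume "m \<in> T \<union> {c..<c + d} - (+) d ` T"
    then show "m \<in> S - (+) d ` S" using assms(2) by (auto simp: T_def)
  qed
  moreover have "(+) d ` T \<subseteq> T \<union> {c..<c + d}"
    using assms(1) by (auto simp: T_def)
  moreover have "card (T \<union> {c..<c + d}) = card T + d"
    by (subst card_Un_disjoint) (auto simp: T_def)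
  moreover have "card ((+) d ` T) = card T" by (rule card_image) auto
  moreover have "finite T" by (simp add: T_def)
  ultimately show ?thesis by (simp add: card_Diff_subset)
qed

context puiseux_parametrization
begin

definition value_set :: "nat set" where
  "value_set = {subdegree (val h) |h. convergent2 h \<and> val h \<noteq> 0}"

lemma val_const2 [simp]: "val (const2 c) = fps_const c"
  using n by (simp add: const2_def) (auto simp: fps_eq_iff ram_nth elim: dvdE)

text \<open>Choose one series for each value in \<open>S\<close> outside \<open>d + S\<close>.
  Leading terms with other values are cancelled by multiples of \<open>h\<close>, so these series
  span. They are independent because their orders are distinct and lie outside the values of
  multiples of \<open>h\<close>.\<close>

theorem intersection_number_eq_subdegree:
  assumes h: "convergent2 h" and h0: "val h \<noteq> 0"
  shows "intersection_number f h = enat (subdegree (val h))"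
proof -
  define d where "d = subdegree (val h)"
  obtain c where c: "\<And>g. conv1 g \<Longrightarrow> g = 0 \<or> subdegree g \<ge> c \<Longrightarrow> \<exists>h. convergent2 h \<and> val h = g"
    using conductor by blast
  define B where "B = value_set - (+) d ` value_set"
  have "finite B \<and> card B = d"
    unfolding B_def
  proof (rule card_numerical_set_diff_shift)
    fix s assume "s \<in> value_set"
    then obtain k where "convergent2 k" "val k \<noteq> 0" "s = subdegree (val k)" by (auto simp: value_set_def)
    then have "convergent2 (h * k)" "val (h * k) \<noteq> 0" "d + s = subdegree (val (h * k))"
      using h h0 by (auto simp: val_mult d_def)
    then show "d + s \<in> value_set" unfolding value_set_def by blast
  next
    fix m assume "c \<le> m"
    then obtain k where "convergent2 k" "val k = fps_X ^ m"
      using c[of "fps_X ^ m"] by (auto simp: fps_X_power_subdegree)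
    then show "m \<in> value_set" unfolding value_set_def
      by (auto intro!: exI[of _ k] simp: fps_X_power_subdegree)
  qed
  then have "finite B" "card B = d" by auto
  obtain b where b: "bij_betw b {..<d} B"
    using ex_bij_betw_nat_finite[OF \<open>finite B\<close>] unfolding \<open>card B = d\<close> atLeast0LessThan by blast
  have "\<exists>g. convergent2 g \<and> val g \<noteq> 0 \<and> subdegree (val g) = b k" if "k < d" for k
  proof -
    have "b k \<in> value_set" using bij_betwE[OF b] that unfolding B_def by blast
    then show ?thesis unfolding value_set_def by (smt (verit) mem_Collect_eq)
  qed
  then obtain g where g: "\<And>k. k < d \<Longrightarrow> convergent2 (g k)" "\<And>k. k < d \<Longrightarrow> val (g k) \<noteq> 0"
    "\<And>k. k < d \<Longrightarrow> subdegree (val (g k)) = b k" by metis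
  have val_lin: "val (\<Sum>k<d. const2 (x k) * g k) = (\<Sum>k<d. fps_const (x k) * val (g k))" for x
    by (simp add: val_sum val_mult)
  have "intersection_number f h = enat d"
  proof (rule intersection_number_eqI[OF conv_f h])
    show "convergent2 (g k)" if "k < d" for k using g that by blast
    have approx: "\<exists>x s. convergent2 s \<and> val r = (\<Sum>k<d. fps_const (x k) * val (g k)) + val s * val h"
      if "convergent2 r" for r
      using that
    proof (induction "c + d - subdegree (val r)" arbitrary: r rule: less_induct)
      case less
      \<comment> \<open>One cancellation raises the order, and the coefficients are accumulated. The
        outcome \<open>val r' = 0\<close> is treated apart because
        \<open>subdegree 0 = 0\<close>.\<close>
      have step: "\<exists>x s. convergent2 s \<and> val r = (\<Sum>k<d. fps_const (x k) * val (g k)) + val s * val h"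
        if r': "convergent2 r'" "val r' = 0 \<or> subdegree (val r') > subdegree (val r)"
          and s': "convergent2 s'" and eq: "val r = val r' + (\<Sum>k<d. fps_const (x' k) * val (g k)) + val s' * val h"
          and lt: "subdegree (val r) < c + d"
        for r' x' s'
      proof -
        have "\<exists>x s. convergent2 s \<and> val r' = (\<Sum>k<d. fps_const (x k) * val (g k)) + val s * val h"
        proof (cases "val r' = 0")
          case True
          then show ?thesis by (intro exI[of _ "\<lambda>_. 0"] exI[of _ 0]) auto
        next
          case False
          then show ?thesis using r' lt by (intro less) auto
        qed
        then obtain x s where "convergent2 s" "val r' = (\<Sum>k<d. fps_const (x k) * val (g k)) + val s * val h"
          by blast
        then have "convergent2 (s + s')"
          "val r = (\<Sum>k<d. fps_const (x k + x' k) * val (g k)) + val (s + s') * val h"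
          using s' by (auto simp: eq val_add distrib_right sum.distrib simp flip: fps_const_add)
        then show ?thesis by (intro exI[of _ "\<lambda>k. x k + x' k"] exI[of _ "s + s'"]) simp
      qed
      consider "val r = 0" | "val r \<noteq> 0" "subdegree (val r) \<ge> c + d"
        | "val r \<noteq> 0" "subdegree (val r) < c + d" "subdegree (val r) \<in> B"
        | "val r \<noteq> 0" "subdegree (val r) < c + d" "subdegree (val r) \<notin> B" by linarith
      then show ?case
      proof cases
        case 1
        then show ?thesis by (intro exI[of _ "\<lambda>_. 0"] exI[of _ 0]) auto
      next
        case 2
        \<comment> \<open>Beyond \<open>c + d\<close> the quotient by \<open>val h\<close> has order
          at least the conductor bound \<open>c\<close>, so it is itself a value.\<close>
        then obtain w where w: "conv1 w" "val r = w * val h"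
          using conv1_divide[OF conv1_val[OF less.prems] conv1_val[OF h] h0] by (auto simp: d_def)
        then have "subdegree w \<ge> c" using 2 h0 by (auto simp: d_def)
        then obtain s where "convergent2 s" "val s = w" using c[OF w(1)] by blast
        then show ?thesis using w by (intro exI[of _ "\<lambda>_. 0"] exI[of _ s]) auto
      next
        case 3
        then obtain k where k: "k < d" "b k = subdegree (val r)"
          using bij_betw_imp_surj_on[OF b] by (metis imageE lessThan_iff)
        obtain \<mu> where \<mu>: "val r - fps_const \<mu> * val (g k) = 0 \<or>
            subdegree (val r - fps_const \<mu> * val (g k)) > subdegree (val r)"
          using subdegree_cancel[OF g(2)[OF k(1)], of "val r"] g(3)[OF k(1)] k(2) by (metis (no_types))
        have sum: "(\<Sum>l<d. fps_const (if l = k then \<mu> else 0) * val (g l)) =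
            (\<Sum>l\<in>{k}. fps_const (if l = k then \<mu> else 0) * val (g l))"
          using k(1) by (intro sum.mono_neutral_right) auto
        show ?thesis
        proof (rule step)
          show "convergent2 (r - const2 \<mu> * g k)"
            by (rule convergent2_diff[OF less.prems convergent2_mult[OF convergent2_const2 g(1)[OF k(1)]]])
          show "val (r - const2 \<mu> * g k) = 0 \<or> subdegree (val (r - const2 \<mu> * g k)) > subdegree (val r)"
            unfolding val_diff val_mult val_const2 by (rule \<mu>)
          show "val r = val (r - const2 \<mu> * g k) +
              (\<Sum>l<d. fps_const (if l = k then \<mu> else 0) * val (g l)) + val 0 * val h"
            unfolding sum by (simp add: val_diff val_mult)
        qed (rule convergent2_0, fact 3(2))
      next
        case 4
        have "subdegree (val r) \<in> value_set" using 4 less.prems by (auto simp: value_set_def)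
        then have "subdegree (val r) \<in> (+) d ` value_set" using 4 by (auto simp: B_def)
        then obtain s where s: "convergent2 s" "val s \<noteq> 0" "subdegree (val r) = d + subdegree (val s)"
          by (auto simp: value_set_def)
        then have sh: "subdegree (val r) = subdegree (val s * val h)" "val s * val h \<noteq> 0"
          using h0 by (auto simp: d_def)
        then obtain \<mu> where \<mu>: "val r - fps_const \<mu> * (val s * val h) = 0 \<or>
            subdegree (val r - fps_const \<mu> * (val s * val h)) > subdegree (val r)"
          using subdegree_cancel[OF sh(2,1)] by blast
        show ?thesis
        proof (rule step)
          show "convergent2 (r - const2 \<mu> * (s * h))"
            by (rule convergent2_diff[OF less.prems convergent2_mult[OF convergent2_const2 convergent2_mult[OF s(1) h]]])
          show "convergent2 (const2 \<mu> * s)" by (rule convergent2_mult[OF convergent2_const2 s(1)])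
          show "val (r - const2 \<mu> * (s * h)) = 0 \<or> subdegree (val (r - const2 \<mu> * (s * h))) > subdegree (val r)"
            unfolding val_diff val_mult val_const2 by (rule \<mu>)
          show "val r = val (r - const2 \<mu> * (s * h)) +
              (\<Sum>l<d. fps_const 0 * val (g l)) + val (const2 \<mu> * s) * val h"
            by (simp add: val_diff val_mult mult.assoc)
        qed (fact 4(2))
      qed
    qed
    show "\<exists>x p s. convergent2 p \<and> convergent2 s \<and> r = (\<Sum>k<d. const2 (x k) * g k) + (p * f + s * h)"
      if r: "convergent2 r" for r
    proof -
      obtain x s where s: "convergent2 s" "val r = (\<Sum>k<d. fps_const (x k) * val (g k)) + val s * val h"
        using approx[OF r] by blast
      define r' where "r' = r - ((\<Sum>k<d. const2 (x k) * g k) + s * h)"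
      have "convergent2 r'" unfolding r'_def using r s h g
        by (intro convergent2_diff convergent2_add convergent2_sum convergent2_mult) auto
      moreover have "val r' = 0" by (simp add: r'_def val_diff val_add val_mult val_lin s)
      ultimately obtain p where "convergent2 p" "r' = p * f" using val_eq_0_iff by blast
      then show ?thesis using s(1) by (intro exI[of _ x] exI[of _ p] exI[of _ s]) (auto simp: r'_def algebra_simps)
    qed
    show "\<forall>k<d. x k = 0"
      if ps: "convergent2 p" "convergent2 s" and eq: "(\<Sum>k<d. const2 (x k) * g k) = p * f + s * h" for x p s
    proof (rule ccontr)
      assume "\<not> (\<forall>k<d. x k = 0)"
      then obtain k0 where k0: "k0 < d" "x k0 \<noteq> 0" by blast
      define t where "t k = fps_const (x k) * val (g k)" for k
      have sub: "subdegree (t k) = b k" if "k < d" "t k \<noteq> 0" for k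
        using that g by (auto simp: t_def)
      have "inj_on (\<lambda>k. subdegree (t k)) {k \<in> {..<d}. t k \<noteq> 0}"
        using sub bij_betw_imp_inj_on[OF b] by (auto simp: inj_on_def)
      moreover have "t k0 \<noteq> 0" using k0 g by (auto simp: t_def)
      ultimately obtain k where k: "k \<in> {..<d}" "t k \<noteq> 0" "sum t {..<d} \<noteq> 0"
          "subdegree (sum t {..<d}) = subdegree (t k)"
        using subdegree_sum_distinct[of "{..<d}" t k0] k0 by auto
      have "sum t {..<d} = val s * val h"
        using arg_cong[OF eq, of val] by (simp add: val_lin val_add val_mult t_def)
      then have "val s \<noteq> 0" "b k = d + subdegree (val s)"
        using k sub[of k] h0 by (auto simp: d_def)
      then have "b k \<in> (+) d ` value_set" using ps by (auto simp: value_set_def)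
      moreover have "b k \<in> B" using k bij_betwE[OF b] by auto
      ultimately show False by (auto simp: B_def)
    qed
  qed
  then show ?thesis by (simp add: d_def)
qed

lemma semigroup_of_values_eq: "semigroup_of_values f = value_set"
proof -
  have "h \<notin> genideal conv_ring {f} \<longleftrightarrow> val h \<noteq> 0" if "convergent2 h" for h
    using val_eq_0_iff[OF that] genideal_one[OF conv_f] by auto
  then show ?thesis
    unfolding semigroup_of_values_def value_set_def
    using intersection_number_eq_subdegree by auto
qed

section \<open>Apery sets from monic polynomials in y\<close>

lemma monic_basis_expansion:
  assumes E: "\<And>k. k < m \<Longrightarrow> convergent2 (E k) \<and> E k $ k = 1 \<and> (\<forall>j>k. E k $ j = 0)"
    and H: "convergent2 H" "\<And>j. j \<ge> m \<Longrightarrow> H $ j = 0"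
  shows "\<exists>a. H = (\<Sum>k<m. fps_const (a k) * E k)"
  using assms
proof (induction m arbitrary: H)
  case 0
  then show ?case by (auto intro: fps_ext)
next
  case (Suc m)
  define H' where "H' = H - fps_const (H $ m) * E m"
  have "convergent2 H'" unfolding H'_def using Suc.prems convergent2_nth
    by (intro convergent2_diff convergent2_mult) auto
  moreover have "H' $ j = 0" if "j \<ge> m" for j
    using Suc.prems(1)[of m] Suc.prems(3)[of j] that by (cases "j = m") (auto simp: H'_def)
  ultimately obtain a where a: "H' = (\<Sum>k<m. fps_const (a k) * E k)"
    using Suc.IH[of H'] Suc.prems(1) by auto
  have "(\<Sum>k<Suc m. fps_const ((a(m := H $ m)) k) * E k) = H' + fps_const (H $ m) * E m"
    by (simp add: a)
  then show ?case by (intro exI[of _ "a(m := H $ m)"]) (simp add: H'_def)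
qed

text \<open>Modulo \<open>f\<close> every series is a combination of the \<open>E k\<close> with
  coefficients in \<open>x\<close>, which contribute multiples of \<open>n\<close> to the orders.
  The residues of the \<open>w k\<close> being distinct, leading terms cannot cancel: the
  \<open>w k\<close> are the Apery set with respect to \<open>n\<close>.\<close>

theorem semigroup_of_values_apery:
  assumes E: "\<And>k. k < n \<Longrightarrow> convergent2 (E k) \<and> E k $ k = 1 \<and> (\<forall>j>k. E k $ j = 0)"
    and w: "\<And>k. k < n \<Longrightarrow> val (E k) \<noteq> 0 \<and> subdegree (val (E k)) = w k"
    and inj: "inj_on (\<lambda>k. w k mod n) {..<n}"
  shows "semigroup_of_values f = {w k + n * m |k m. k < n}"
proof (intro equalityI subsetI)
  fix s assume "s \<in> semigroup_of_values f"
  then obtain h where h: "convergent2 h" "val h \<noteq> 0" "s = subdegree (val h)"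
    by (auto simp: semigroup_of_values_eq value_set_def)
  obtain q r where qr: "convergent2 r" "h = q * f + r" "\<forall>j\<ge>n. r $ j = 0"
    using weierstrass_division[OF conv_f y_order_f h(1)] by blast
  obtain a where a: "r = (\<Sum>k<n. fps_const (a k) * E k)"
    using monic_basis_expansion[OF E qr(1)] qr(3) by blast
  define t where "t k = ram n (a k) * val (E k)" for k
  have vh: "val h = sum t {..<n}"
    by (simp add: qr(2) a val_add val_mult val_sum t_def)
  have sub: "subdegree (t k) = w k + n * subdegree (a k)" if "k < n" "t k \<noteq> 0" for k
    using that w[of k] n by (auto simp: t_def subdegree_ram)
  have "k = l" if "k < n" "t k \<noteq> 0" "l < n" "t l \<noteq> 0" "subdegree (t k) = subdegree (t l)" for k l
  proof -
    have "(w k + n * subdegree (a k)) mod n = (w l + n * subdegree (a l)) mod n"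
      using that(5) unfolding sub[OF that(1,2)] sub[OF that(3,4)] by (rule arg_cong)
    then have "w k mod n = w l mod n" unfolding mod_mult_self2 .
    then show ?thesis by (rule inj_onD[OF inj]) (use that(1,3) in simp_all)
  qed
  then have "inj_on (\<lambda>k. subdegree (t k)) {k \<in> {..<n}. t k \<noteq> 0}"
    unfolding inj_on_def by blast
  moreover obtain k0 where "k0 \<in> {..<n}" "t k0 \<noteq> 0"
    using h(2) unfolding vh by (meson sum.neutral)
  ultimately obtain k where "k \<in> {..<n}" "t k \<noteq> 0" "subdegree (sum t {..<n}) = subdegree (t k)"
    using subdegree_sum_distinct[of "{..<n}" t k0] by auto
  then have "k < n" "s = w k + n * subdegree (a k)" using sub h(3) vh by auto
  then show "s \<in> {w k + n * m |k m. k < n}" by blast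
next
  fix s assume "s \<in> {w k + n * m |k m. k < n}"
  then obtain k m where km: "k < n" "s = w k + n * m" by blast
  define h where "h = E k * fps_const (fps_X ^ m)"
  have "val h = val (E k) * fps_X ^ (n * m)"
    using n by (simp add: h_def val_mult ram.power ram_X power_mult)
  then have "val h \<noteq> 0" "subdegree (val h) = s"
    using w[OF km(1)] km(2) by (auto simp: fps_X_power_subdegree)
  moreover have "convergent2 h" unfolding h_def using E[OF km(1)] by (intro convergent2_mult) auto
  ultimately show "s \<in> semigroup_of_values f"
    by (auto simp: semigroup_of_values_eq value_set_def)
qed

end

section \<open>Branches of multiplicity four\<close>

lemma generated_semigroup_2:
  assumes "x \<noteq> y" shows "generated_semigroup {x, y} = {a * x + b * y |a b. True}"
proof (intro equalityI subsetI)
  fix s assume "s \<in> generated_semigroup {x, y}"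
  then show "s \<in> {a * x + b * y |a b. True}" using assms by (auto simp: generated_semigroup_def)
next
  fix s assume "s \<in> {a * x + b * y |a b. True}"
  then obtain a b where "s = a * x + b * y" by blast
  then have "s = (\<Sum>z\<in>{x, y}. (if z = x then a else b) * z)" using assms by simp
  then show "s \<in> generated_semigroup {x, y}"
    unfolding generated_semigroup_def by (auto intro!: exI[of _ "\<lambda>z. if z = x then a else b"])
qed

lemma generated_semigroup_3:
  assumes "x \<noteq> y" "x \<noteq> z" "y \<noteq> z"
  shows "generated_semigroup {x, y, z} = {a * x + b * y + c * z |a b c. True}"
proof (intro equalityI subsetI)
  fix s assume "s \<in> generated_semigroup {x, y, z}"
  then show "s \<in> {a * x + b * y + c * z |a b c. True}"
    using assms by (auto simp: generated_semigroup_def add.assoc)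
next
  fix s assume "s \<in> {a * x + b * y + c * z |a b c. True}"
  then obtain a b c where "s = a * x + b * y + c * z" by blast
  then have "s = (\<Sum>t\<in>{x, y, z}. (if t = x then a else if t = y then b else c) * t)" using assms by simp
  then show "s \<in> generated_semigroup {x, y, z}"
    unfolding generated_semigroup_def by (auto intro!: exI[of _ "\<lambda>t. if t = x then a else if t = y then b else c"])
qed

text \<open>The summand with 4 is divisible by \<open>d\<close>, so another one is not. Its
  coefficient is then positive, which bounds the generator by \<open>x\<close>.\<close>

lemma small_generator_not_divisible:
  fixes x :: nat
  assumes "x = a * 4 + b * s1 + c * s2" "\<not> d dvd x" "d dvd 4"
  obtains t where "t \<in> {s1, s2}" "\<not> d dvd t" "t \<le> x"
proof -
  have "\<not> d dvd b * s1 \<or> \<not> d dvd c * s2" using assms by (metis dvd_add dvd_mult)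
  then show ?thesis
  proof
    assume *: "\<not> d dvd b * s1"
    then have "b > 0" by (auto intro!: gr0I)
    then have "s1 \<le> b * s1" by (cases b) auto
    then have "s1 \<le> x" using assms(1) by linarith
    then show ?thesis using * that[of s1] dvd_mult[of d s1 b] by auto
  next
    assume *: "\<not> d dvd c * s2"
    then have "c > 0" by (auto intro!: gr0I)
    then have "s2 \<le> c * s2" by (cases c) auto
    then have "s2 \<le> x" using assms(1) by linarith
    then show ?thesis using * that[of s2] dvd_mult[of d s2 c] by auto
  qed
qed

lemma minimally_generated_3_not_2:
  assumes min: "minimally_generated_by S [4, s1, s2]"
    and S: "S = {k * \<beta> + 4 * m |k m. k < 4}" and \<beta>: "\<not> 4 dvd \<beta>"
  shows False
proof -
  have less: "4 < s1" "s1 < s2" and S3: "S = generated_semigroup {4, s1, s2}"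
    and minimal: "\<And>B. B \<subset> {4, s1, s2} \<Longrightarrow> generated_semigroup B \<noteq> S"
    using min by (auto simp: minimally_generated_by_def)
  have S3': "S = {a * 4 + b * s1 + c * s2 |a b c. True}"
    using S3 less by (simp add: generated_semigroup_3)
  have S3_iff: "x \<in> S \<longleftrightarrow> (\<exists>a b c. x = a * 4 + b * s1 + c * s2)" for x
    unfolding S3' by simp
  have "\<beta> \<in> S" unfolding S by (intro CollectI exI[of _ 1] exI[of _ 0]) simp
  then obtain a b c where "\<beta> = a * 4 + b * s1 + c * s2" unfolding S3_iff by (elim exE)
  then obtain t where t: "t \<in> {s1, s2}" "\<not> 4 dvd t" "t \<le> \<beta>"
    using small_generator_not_divisible[OF _ \<beta> dvd_refl] by metis
  have "0 * 4 + 1 * s1 + 0 * s2 \<in> S" "0 * 4 + 0 * s1 + 1 * s2 \<in> S" unfolding S3' by blast+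
  then have "t \<in> S" using t(1) by auto
  then obtain k m where km: "t = k * \<beta> + 4 * m" unfolding S by blast
  then have "k > 0" using t(2) by (auto intro!: gr0I)
  then have "\<beta> \<le> k * \<beta>" by (cases k) auto
  then have "t = \<beta>" using km t(3) by linarith
  have "generated_semigroup {4, t} = S"
  proof -
    have "4 \<noteq> t" using t(1) less by auto
    then have "generated_semigroup {4, t} = {a * 4 + b * \<beta> |a b. True}"
      using \<open>t = \<beta>\<close> by (simp add: generated_semigroup_2)
    also have "\<dots> = S"
    proof (intro equalityI subsetI)
      fix s assume "s \<in> {a * 4 + b * \<beta> |a b. True}"
      then obtain a b where s: "s = a * 4 + b * \<beta>" by blast
      obtain q r where b: "b = r + 4 * q" "r < 4"
        by (metis mod_less_divisor mod_mult_div_eq zero_less_numeral)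
      have "s = r * \<beta> + 4 * (a + q * \<beta>)" unfolding s b(1) by (simp add: algebra_simps)
      then show "s \<in> S" unfolding S using b(2) by blast
    next
      fix s assume "s \<in> S"
      then obtain k m where "s = k * \<beta> + 4 * m" unfolding S by blast
      then have "s = m * 4 + k * \<beta>" by simp
      then show "s \<in> {a * 4 + b * \<beta> |a b. True}" by blast
    qed
    finally show ?thesis .
  qed
  moreover have "s2 \<notin> {4, s1}" "s1 \<notin> {4, s2}" using less by auto
  then have "{4, t} \<subset> {4, s1, s2}" using t(1) by blast
  ultimately show False using minimal by blast
qed

text \<open>The least element not divisible by 4 is \<beta>1 and the least odd one is \<sigma>. Each
  representation contains a generator with the same property that is no larger, so both are
  generators.\<close>

lemma minimal_generators_unique_4:
  fixes \<beta>1 \<sigma> :: nat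
  assumes min: "minimally_generated_by S [4, s1, s2]"
    and S: "S = {w k + 4 * m |k m. k < (4 :: nat)}"
    and w: "w 0 = 0" "w 1 = \<beta>1" "w 2 = \<sigma>" "w 3 = \<beta>1 + \<sigma>"
    and \<beta>: "\<beta>1 mod 4 = 2" "odd \<sigma>" "\<beta>1 < \<sigma>"
  shows "s1 = \<beta>1 \<and> s2 = \<sigma>"
proof -
  have less: "4 < s1" "s1 < s2" and S3: "S = generated_semigroup {4, s1, s2}"
    using min by (auto simp: minimally_generated_by_def)
  have S3': "S = {a * 4 + b * s1 + c * s2 |a b c. True}"
    using S3 less by (simp add: generated_semigroup_3)
  have S3_iff: "x \<in> S \<longleftrightarrow> (\<exists>a b c. x = a * 4 + b * s1 + c * s2)" for x
    unfolding S3' by simp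
  have gens: "t \<in> S" if "t \<in> {s1, s2}" for t
  proof -
    have "0 * 4 + 1 * s1 + 0 * s2 \<in> S" "0 * 4 + 0 * s1 + 1 * s2 \<in> S" unfolding S3' by blast+
    then show ?thesis using that by auto
  qed
  have S_cases: "\<exists>m. s = 4 * m \<or> s = \<beta>1 + 4 * m \<or> s = \<sigma> + 4 * m \<or> s = \<beta>1 + \<sigma> + 4 * m" if s: "s \<in> S" for s
  proof -
    obtain k m where km: "s = w k + 4 * m" "k < 4" using s unfolding S by blast
    then have "k = 0 \<or> k = 1 \<or> k = 2 \<or> k = 3" by linarith
    then show ?thesis using km(1) w by auto
  qed
  have "even \<beta>1" using \<beta>(1) by presburger
  have wS: "w k \<in> S" if "k < 4" for k
    unfolding S using that by (intro CollectI exI[of _ k] exI[of _ 0]) simp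
  have "\<beta>1 \<in> S" "\<sigma> \<in> S" using wS[of 1] wS[of 2] w by auto
  then obtain a b c a' b' c' where eq: "\<beta>1 = a * 4 + b * s1 + c * s2" "\<sigma> = a' * 4 + b' * s1 + c' * s2"
    unfolding S3_iff by (elim exE)
  have "\<not> 4 dvd \<beta>1" using \<beta>(1) by presburger
  then obtain t where t: "t \<in> {s1, s2}" "\<not> 4 dvd t" "t \<le> \<beta>1"
    using small_generator_not_divisible[OF eq(1) _ dvd_refl] by metis
  obtain t' where t': "t' \<in> {s1, s2}" "\<not> 2 dvd t'" "t' \<le> \<sigma>"
    using small_generator_not_divisible[OF eq(2) \<beta>(2)] by auto
  have "t \<ge> \<beta>1" using S_cases[OF gens[OF t(1)]] t(2) \<beta>(3) by auto
  have "t' \<ge> \<sigma>" using S_cases[OF gens[OF t'(1)]] t'(2) \<open>even \<beta>1\<close> by auto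
  have "t = \<beta>1" "t' = \<sigma>" using \<open>t \<ge> \<beta>1\<close> \<open>t' \<ge> \<sigma>\<close> t(3) t'(3) by auto
  then show ?thesis using t(1) t'(1) less \<beta>(3) by auto
qed

lemma primitive_root_power_eq_1: "primitive_root N e \<Longrightarrow> e ^ k = 1 \<longleftrightarrow> N dvd k"
  unfolding primitive_root_def by (auto simp: power_mult)

lemma subdegree_eqI:
  assumes "a $ d \<noteq> 0" "\<And>i. i < d \<Longrightarrow> a $ i = 0"
  shows "a \<noteq> 0 \<and> subdegree a = d"
proof -
  have "a \<noteq> 0" using assms(1) by auto
  then show ?thesis using subdegreeI[OF assms] by simp
qed

text \<open>
  \<open>\<beta>1 < \<beta>2\<close> are the characteristic exponents of \<open>\<phi>\<close>. The polynomial \<open>G\<close> of degree \<open>2\<close> below is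
  the minimal polynomial of the truncation of \<open>\<phi>\<close> at \<open>\<beta>2\<close>.
\<close>

theorem characteristic_exponents:
  assumes param: "puiseux_parametrization f 4 e \<phi> U"
    and min: "minimally_generated_by (semigroup_of_values f) [4, s1, s2]"
  obtains \<beta>1 \<beta>2 where "s1 = \<beta>1" "s2 = \<beta>1 + \<beta>2" "\<beta>1 mod 4 = 2" "odd \<beta>2" "\<beta>1 < \<beta>2"
    "\<phi> $ \<beta>1 \<noteq> 0" "\<phi> $ \<beta>2 \<noteq> 0" "\<And>k. k < \<beta>1 \<Longrightarrow> \<not> 4 dvd k \<Longrightarrow> \<phi> $ k = 0"
    "\<And>k. k < \<beta>2 \<Longrightarrow> odd k \<Longrightarrow> \<phi> $ k = 0"
proof -
  interpret puiseux_parametrization f 4 e \<phi> U by (rule param)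
  note e_pow = primitive_root_power_eq_1[OF e]
  have "\<exists>k. \<not> 4 dvd k \<and> \<phi> $ k \<noteq> 0"
  proof (rule ccontr)
    assume "\<not> ?thesis"
    then have "e ^ k * \<phi> $ k = \<phi> $ k" for k using e_pow[of k] by (cases "4 dvd k") auto
    then have "rot (e ^ 1) \<phi> = rot (e ^ 0) \<phi>" by (intro fps_ext) simp
    then have "(1 :: nat) = 0" by (rule distinct[rotated 2]) auto
    then show False by simp
  qed
  define \<beta>1 where "\<beta>1 = (LEAST k. \<not> 4 dvd k \<and> \<phi> $ k \<noteq> 0)"
  have \<beta>1: "\<not> 4 dvd \<beta>1" "\<phi> $ \<beta>1 \<noteq> 0"
    using LeastI_ex[OF \<open>\<exists>k. \<not> 4 dvd k \<and> \<phi> $ k \<noteq> 0\<close>] unfolding \<beta>1_def by auto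
  have \<beta>1_least: "\<phi> $ k = 0" if "k < \<beta>1" "\<not> 4 dvd k" for k
    using not_less_Least[of k "\<lambda>k. \<not> 4 dvd k \<and> \<phi> $ k \<noteq> 0"] that unfolding \<beta>1_def by blast
  \<comment> \<open>The part of \<phi> below \<beta>1 is a series in \<open>x\<close>; subtracting
    it from \<open>y\<close> gives a series of value \<beta>1.\<close>
  define p where "p = Abs_fps (\<lambda>i. if 4 * i < \<beta>1 then \<phi> $ (4 * i) else 0)"
  have conv_p: "conv1 p" by (rule conv1_finite_support[of \<beta>1]) (auto simp: p_def)
  define E1 where "E1 = fps_X + fps_const (- p)"
  have "conv1 (- p)" using conv1_diff[of 0 p] conv_p by simp
  then have conv_E1: "convergent2 E1" unfolding E1_def by (intro convergent2_add) auto
  have val_E1: "val E1 = \<phi> - ram 4 p" by (simp add: E1_def val_add ram.uminus)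
  have E1: "val E1 \<noteq> 0 \<and> subdegree (val E1) = \<beta>1"
  proof (rule subdegree_eqI)
    show "val E1 $ \<beta>1 \<noteq> 0" unfolding val_E1 using \<beta>1 by (simp add: ram_nth)
    show "val E1 $ k = 0" if "k < \<beta>1" for k
      unfolding val_E1 using \<beta>1_least[of k] that by (cases "4 dvd k") (auto simp: ram_nth p_def)
  qed
  \<comment> \<open>For odd \<beta>1 the powers of \<open>E1\<close> already have values in all
    classes modulo 4, so two generators would suffice.\<close>
  have "even \<beta>1"
  proof (rule ccontr)
    assume odd: "odd \<beta>1"
    have "semigroup_of_values f = {k * \<beta>1 + 4 * m |k m. k < 4}"
    proof (rule semigroup_of_values_apery[where E = "\<lambda>k. E1 ^ k"])
      show "convergent2 (E1 ^ k) \<and> E1 ^ k $ k = 1 \<and> (\<forall>j>k. E1 ^ k $ j = 0)" for k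
        using fps_X_plus_const_power_nth(1)[of k _ "- p"] fps_X_plus_const_power_nth(2)[of "- p" k]
          convergent2_power[OF conv_E1, of k]
        unfolding E1_def by blast
      show "val (E1 ^ k) \<noteq> 0 \<and> subdegree (val (E1 ^ k)) = k * \<beta>1" for k
        using E1 by (simp add: val_power)
      show "inj_on (\<lambda>k. k * \<beta>1 mod 4) {..<4}"
      proof (rule inj_onI)
        fix k l :: nat assume "k \<in> {..<4}" "l \<in> {..<4}" and eq: "k * \<beta>1 mod 4 = l * \<beta>1 mod 4"
        then have kl: "k < 4" "l < 4" by auto
        have "k * (\<beta>1 mod 4) mod 4 = l * (\<beta>1 mod 4) mod 4"
          using eq by (simp only: mod_mult_right_eq)
        moreover have "\<beta>1 mod 4 = 1 \<or> \<beta>1 mod 4 = 3" using odd by presburger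
        moreover have "k = 0 \<or> k = 1 \<or> k = 2 \<or> k = 3" "l = 0 \<or> l = 1 \<or> l = 2 \<or> l = 3"
          using kl by linarith+
        ultimately show "k = l" by (elim disjE) simp_all
      qed
    qed
    then show False using minimally_generated_3_not_2[OF min] \<beta>1(1) by blast
  qed
  then have mod2: "\<beta>1 mod 4 = 2" using \<beta>1(1) by presburger
  have "\<exists>k. odd k \<and> \<phi> $ k \<noteq> 0"
  proof (rule ccontr)
    assume no: "\<not> ?thesis"
    have "(e ^ 2) ^ k * \<phi> $ k = \<phi> $ k" for k
    proof (cases "even k")
      case True
      then have "4 dvd 2 * k" by presburger
      then show ?thesis using e_pow[of "2 * k"] by (simp add: power_mult)
    qed (use no in auto)
    then have "rot (e ^ 2) \<phi> = rot (e ^ 0) \<phi>" by (intro fps_ext) simp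
    then have "(2 :: nat) = 0" by (rule distinct[rotated 2]) auto
    then show False by simp
  qed
  define \<beta>2 where "\<beta>2 = (LEAST k. odd k \<and> \<phi> $ k \<noteq> 0)"
  have \<beta>2: "odd \<beta>2" "\<phi> $ \<beta>2 \<noteq> 0"
    using LeastI_ex[OF \<open>\<exists>k. odd k \<and> \<phi> $ k \<noteq> 0\<close>] unfolding \<beta>2_def by auto
  have \<beta>2_least: "\<phi> $ k = 0" if "k < \<beta>2" "odd k" for k
    using not_less_Least[of k "\<lambda>k. odd k \<and> \<phi> $ k \<noteq> 0"] that unfolding \<beta>2_def by blast
  have "\<not> 4 dvd \<beta>2" using \<beta>2(1) by presburger
  then have less: "\<beta>1 < \<beta>2"
    using \<beta>1_least[of \<beta>2] \<beta>2 \<open>even \<beta>1\<close> by (cases \<beta>1 \<beta>2 rule: linorder_cases) auto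
  \<comment> \<open>Below \<beta>2 only even exponents occur, so the truncation is fixed by the
    square of the rotation and has the two conjugates that enter \<open>G'\<close>.\<close>
  define \<phi>0 where "\<phi>0 = Abs_fps (\<lambda>k. if k < \<beta>2 then \<phi> $ k else 0)"
  have conv_\<phi>0: "conv1 \<phi>0" by (rule conv1_finite_support[of \<beta>2]) (auto simp: \<phi>0_def)
  have rot2: "rot (e * e) \<phi>0 = \<phi>0"
  proof (rule fps_ext)
    fix k
    show "rot (e * e) \<phi>0 $ k = \<phi>0 $ k"
    proof (cases "even k")
      case True
      then have "4 dvd 2 * k" by presburger
      then show ?thesis using e_pow[of "2 * k"] by (simp add: power_mult power2_eq_square)
    qed (use \<beta>2_least in \<open>auto simp: \<phi>0_def\<close>)
  qed
  define G' where "G' = (fps_X - fps_const \<phi>0) * (fps_X - fps_const (rot e \<phi>0))"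
  have conv_G': "convergent2 G'"
    unfolding G'_def using conv_\<phi>0 primitive_root_norm[OF e]
    by (intro convergent2_mult convergent2_diff) (auto intro: conv1_rot)
  interpret e: subst_hom "rot e" by (rule subst_hom_rot[OF e_nonzero])
  have "lift (rot e) G' = G'"
    by (simp add: G'_def e.lift_mult e.lift_diff rot_rot rot2 mult.commute)
  then obtain G where G: "convergent2 G" "G' = ramify 4 G" using descent_lift[OF e conv_G'] by blast
  have val_G: "val G = (\<phi> - \<phi>0) * (\<phi> - rot e \<phi>0)"
    unfolding val_def G(2)[symmetric] G'_def using \<phi>_0 by (simp add: subst_y_mult subst_y_diff)
  have "\<phi> - \<phi>0 \<noteq> 0 \<and> subdegree (\<phi> - \<phi>0) = \<beta>2"
    by (rule subdegree_eqI) (use \<beta>2 in \<open>auto simp: \<phi>0_def\<close>)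
  moreover have "\<phi> - rot e \<phi>0 \<noteq> 0 \<and> subdegree (\<phi> - rot e \<phi>0) = \<beta>1"
  proof (rule subdegree_eqI)
    show "(\<phi> - rot e \<phi>0) $ \<beta>1 \<noteq> 0" using \<beta>1 less e_pow[of \<beta>1] by (auto simp: \<phi>0_def)
    show "(\<phi> - rot e \<phi>0) $ k = 0" if "k < \<beta>1" for k
      using that less \<beta>1_least[of k] e_pow[of k] by (cases "4 dvd k") (auto simp: \<phi>0_def)
  qed
  ultimately have G_val: "val G \<noteq> 0 \<and> subdegree (val G) = \<beta>1 + \<beta>2" by (simp add: val_G)
  have G'_nth: "G' $ j = (if j = 2 then 1 else 0)" if "j \<ge> 2" for j
  proof -
    have "G' $ j = (fps_X - fps_const (rot e \<phi>0)) $ (j - 1) - \<phi>0 * (fps_X - fps_const (rot e \<phi>0)) $ j"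
      using that by (simp add: G'_def left_diff_distrib)
    then show ?thesis using that by (auto simp: fps_X_nth)
  qed
  have G_nth: "G $ j = (if j = 2 then 1 else 0)" if "j \<ge> 2" for j
  proof -
    have "ram 4 (G $ j) = ram 4 (if j = 2 then 1 else 0)"
      using G'_nth[OF that] by (simp add: G(2) ramify_eq_lift ram.one)
    then show ?thesis using ram.eq_iff by blast
  qed
  \<comment> \<open>Products of \<open>E1\<close> and \<open>G\<close> of degrees 0 to 3; their
    values have residues 0, 2 and the two odd ones modulo 4.\<close>
  define E where "E k = (if k = 0 then 1 else if k = 1 then E1 else if k = 2 then G else E1 * G)" for k :: nat
  define w where "w k = (if k = 0 then 0 else if k = 1 then \<beta>1 else if k = 2 then \<beta>1 + \<beta>2 else \<beta>1 + (\<beta>1 + \<beta>2))" for k :: nat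
  have S: "semigroup_of_values f = {w k + 4 * m |k m. k < 4}"
  proof (rule semigroup_of_values_apery[where E = E])
    fix k :: nat assume "k < 4"
    then have k: "k = 0 \<or> k = 1 \<or> k = 2 \<or> k = 3" by linarith
    have "convergent2 (E1 * G)" using conv_E1 G(1) by (rule convergent2_mult)
    then show "convergent2 (E k) \<and> E k $ k = 1 \<and> (\<forall>j>k. E k $ j = 0)"
      using k conv_E1 G(1) G_nth
      by (auto simp: E_def E1_def fps_X_nth fps_one_nth distrib_right)
    show "val (E k) \<noteq> 0 \<and> subdegree (val (E k)) = w k"
      using k E1 G_val by (auto simp: E_def w_def val_mult)
  next
    have res: "(\<beta>1 + \<beta>2) mod 4 = 1 \<and> (\<beta>1 + (\<beta>1 + \<beta>2)) mod 4 = 3 \<or>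
        (\<beta>1 + \<beta>2) mod 4 = 3 \<and> (\<beta>1 + (\<beta>1 + \<beta>2)) mod 4 = 1"
      using mod2 \<beta>2(1) by presburger
    define v where "v k = w k mod 4" for k
    have v: "v 0 = 0" "v 1 = 2" "v 2 = 1 \<and> v 3 = 3 \<or> v 2 = 3 \<and> v 3 = 1"
      using mod2 res by (simp_all add: v_def w_def)
    have "inj_on v {..<4}"
    proof (rule inj_onI)
      fix k l :: nat assume "k \<in> {..<4}" "l \<in> {..<4}" and eq: "v k = v l"
      then have "k = 0 \<or> k = 1 \<or> k = 2 \<or> k = 3" "l = 0 \<or> l = 1 \<or> l = 2 \<or> l = 3"
        unfolding lessThan_iff by linarith+
      then show "k = l" using eq v by (metis numeral_eq_iff numeral_eq_one_iff semiring_norm(86,89) zero_neq_numeral zero_neq_one)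
    qed
    moreover have "v = (\<lambda>k. w k mod 4)" by (rule ext) (rule v_def)
    ultimately show "inj_on (\<lambda>k. w k mod 4) {..<4}" by simp
  qed
  have "odd (\<beta>1 + \<beta>2)" using \<open>even \<beta>1\<close> \<beta>2(1) by simp
  then have "s1 = \<beta>1 \<and> s2 = \<beta>1 + \<beta>2"
    using less mod2 by (intro minimal_generators_unique_4[OF min S]) (auto simp: w_def)
  then show ?thesis using that[of \<beta>1 \<beta>2] mod2 \<beta>1 \<beta>2 less \<beta>1_least \<beta>2_least by blast
qed

section \<open>Orders of the roots of the polar\<close>

text \<open>Unlike \<open>subdegree\<close> this fails for the zero series, so statements about
  orders include being nonzero.\<close>

definition has_order :: "complex fps \<Rightarrow> nat \<Rightarrow> bool" where
  "has_order a k \<longleftrightarrow> a $ k \<noteq> 0 \<and> (\<forall>i<k. a $ i = 0)"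

lemma has_order_iff: "has_order a k \<longleftrightarrow> a \<noteq> 0 \<and> subdegree a = k"
proof
  show "a \<noteq> 0 \<and> subdegree a = k \<Longrightarrow> has_order a k"
    unfolding has_order_def by (auto intro: nth_less_subdegree_zero)
qed (auto simp: has_order_def intro: subdegreeI)

lemma has_order_subdegree: "a \<noteq> 0 \<Longrightarrow> has_order a (subdegree a)"
  by (simp add: has_order_iff)

lemma has_order_unique: "has_order a k \<Longrightarrow> has_order a l \<Longrightarrow> k = l"
  by (simp add: has_order_iff)

lemma has_order_mult: "has_order a k \<Longrightarrow> has_order b l \<Longrightarrow> has_order (a * b) (k + l)"
  by (simp add: has_order_iff)

lemma has_order_uminus: "has_order (- a) k \<longleftrightarrow> has_order a k"
  by (simp add: has_order_def)

lemma has_order_minus_commute: "has_order (a - b) k \<longleftrightarrow> has_order (b - a) k"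
  using has_order_uminus[of "a - b" k] by simp

lemma has_order_add_less: "has_order a k \<Longrightarrow> has_order b l \<Longrightarrow> k < l \<Longrightarrow> has_order (a + b) k"
  by (auto simp: has_order_def)

lemma has_order_diff_less: "has_order a k \<Longrightarrow> has_order b l \<Longrightarrow> k < l \<Longrightarrow> has_order (a - b) k"
  using has_order_add_less[of a k "- b" l] by (simp add: has_order_uminus)

lemma has_order_diff_greater: "has_order a k \<Longrightarrow> has_order b l \<Longrightarrow> l < k \<Longrightarrow> has_order (a - b) l"
  using has_order_diff_less[of b l a k] by (simp add: has_order_minus_commute)

text \<open>A difference of higher order means equal leading terms; these double in the sum instead
  of cancelling.\<close>

lemma has_order_close:
  assumes "has_order a k" "has_order (a - b) l" "k < l"
  shows "has_order b k" "has_order (a + b) k" "b $ k = a $ k"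
proof -
  have eq: "a $ i = b $ i" if "i < l" for i
    using assms(2) that by (simp add: has_order_def)
  show "has_order b k" "has_order (a + b) k" "b $ k = a $ k"
    using assms(1,3) eq by (auto simp: has_order_def)
qed

lemma has_order_mult_nth:
  assumes "has_order a k" "has_order b l"
  shows "(a * b) $ (k + l) = a $ k * b $ l"
  using assms by (auto simp: has_order_iff)

lemma not_has_order_low:
  assumes "has_order a k" "a = w * b" "has_order b l" "k < l"
  shows False
proof -
  have "w \<noteq> 0" using assms(1,2) by (auto simp: has_order_iff)
  then have "has_order a (subdegree w + l)"
    unfolding assms(2) by (intro has_order_mult has_order_subdegree assms(3))
  then show False using has_order_unique[OF assms(1)] assms(4) by auto
qed

text \<open>
  \<open>x\<^sub>k = \<gamma> - \<phi>\<^sub>k\<close> for a root \<open>\<gamma>\<close> of the polar and the four conjugates \<open>\<phi>\<^sub>k\<close>; the third elementary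
  symmetric polynomial of the \<open>x\<^sub>k\<close> is a multiple of their product, as \<open>\<partial>f/\<partial>y\<close> vanishes at \<open>\<gamma>\<close>.
\<close>

lemma polar_contact_less:
  fixes x0 x1 x2 x3 :: "complex fps"
  assumes d: "has_order (x0 - x1) \<alpha>" "has_order (x0 - x3) \<alpha>" "has_order (x0 - x2) \<beta>" and "\<alpha> < \<beta>"
    and e3: "(x0 + x2) * (x1 * x3) + (x0 * x2) * (x1 + x3) = w * ((x0 * x2) * (x1 * x3))"
    and o0: "has_order x0 k" "k < \<alpha>" "k > 0"
  shows False
proof -
  note 1 = has_order_close[OF o0(1) d(1) o0(2)]
  note 3 = has_order_close[OF o0(1) d(2) o0(2)]
  note 2 = has_order_close[OF o0(1) d(3) less_trans[OF o0(2) \<open>\<alpha> < \<beta>\<close>]]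
  have o13: "has_order (x1 + x3) k"
    using 1 3 o0(1) by (auto simp: has_order_def)
  have t1: "has_order ((x0 + x2) * (x1 * x3)) (k + (k + k))"
    by (intro has_order_mult 1 2 3)
  have t2: "has_order ((x0 * x2) * (x1 + x3)) ((k + k) + k)"
    by (intro has_order_mult o13 2 o0)
  have "((x0 + x2) * (x1 * x3)) $ (k + (k + k)) = (x0 + x2) $ k * (x1 $ k * x3 $ k)"
    using has_order_mult_nth[OF 2(2) has_order_mult[OF 1(1) 3(1)]] has_order_mult_nth[OF 1(1) 3(1)] by simp
  moreover have "((x0 * x2) * (x1 + x3)) $ ((k + k) + k) = (x0 $ k * x2 $ k) * (x1 + x3) $ k"
    using has_order_mult_nth[OF has_order_mult[OF o0(1) 2(1)] o13] has_order_mult_nth[OF o0(1) 2(1)] by simp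
  \<comment> \<open>All four series have the same leading coefficient \<open>c\<close>, so the left
    side of \<open>e3\<close> starts with \<open>4 c^3\<close> in degree \<open>3 k\<close>, below
    the order \<open>4 k\<close> of the product.\<close>
  ultimately have "((x0 + x2) * (x1 * x3) + (x0 * x2) * (x1 + x3)) $ (k + (k + k)) = 4 * (x0 $ k) ^ 3"
    using 1(3) 2(3) 3(3) by (simp add: add.assoc power3_eq_cube)
  moreover have "x0 $ k \<noteq> 0" using o0(1) by (simp add: has_order_def)
  ultimately have "has_order ((x0 + x2) * (x1 * x3) + (x0 * x2) * (x1 + x3)) (k + (k + k))"
    using t1 t2 by (simp add: has_order_def add.assoc)
  moreover have "has_order ((x0 * x2) * (x1 * x3)) ((k + k) + (k + k))"
    by (intro has_order_mult 1 2 3 o0)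
  ultimately show False using not_has_order_low[OF _ e3] o0(3) by (metis add.assoc less_add_same_cancel1)
qed

text \<open>Here \<open>1/x1 + 1/x3\<close> has order exactly \<open>-\<alpha>\<close>. So
  \<open>1/x0 + 1/x2\<close> cannot have smaller order, and its two terms must cancel to a large
  extent; only contacts \<beta> with both conjugates of the pair allow this.\<close>

lemma polar_contact_greater:
  fixes x0 x1 x2 x3 :: "complex fps"
  assumes d: "has_order (x0 - x1) \<alpha>" "has_order (x0 - x3) \<alpha>" "has_order (x0 - x2) \<beta>" "has_order (x1 - x3) \<beta>"
    and "\<alpha> < \<beta>"
    and e3: "(x0 + x2) * (x1 * x3) + (x0 * x2) * (x1 + x3) = w * ((x0 * x2) * (x1 * x3))"
    and o0: "has_order x0 k" "\<alpha> < k" and "x2 \<noteq> 0"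
  shows "has_order x0 \<beta> \<and> has_order x2 \<beta> \<and> has_order x1 \<alpha> \<and> has_order x3 \<alpha>"
proof -
  have 1: "has_order x1 \<alpha>" using has_order_diff_greater[OF o0(1) d(1) o0(2)] by simp
  have 3: "has_order x3 \<alpha>" using has_order_diff_greater[OF o0(1) d(2) o0(2)] by simp
  have 13: "has_order (x1 + x3) \<alpha>" using has_order_close(2)[OF 1 d(4) \<open>\<alpha> < \<beta>\<close>] .
  obtain l where 2: "has_order x2 l" using has_order_subdegree[OF \<open>x2 \<noteq> 0\<close>] by blast
  \<comment> \<open>If \<open>x0 + x2\<close> had such a small order \<open>m\<close>, the left side
    of \<open>e3\<close> would have order \<open>m + 2 \<alpha>\<close>, below the order of the
    product.\<close>
  have contra: False if "has_order (x0 + x2) m" "m + \<alpha> < k + l" for m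
  proof -
    have "has_order ((x0 + x2) * (x1 * x3)) (m + (\<alpha> + \<alpha>))"
      by (intro has_order_mult that 1 3)
    moreover have "has_order ((x0 * x2) * (x1 + x3)) ((k + l) + \<alpha>)"
      by (intro has_order_mult o0 2 13)
    ultimately have "has_order ((x0 + x2) * (x1 * x3) + (x0 * x2) * (x1 + x3)) (m + (\<alpha> + \<alpha>))"
      using that by (intro has_order_add_less) auto
    moreover have "has_order ((x0 * x2) * (x1 * x3)) ((k + l) + (\<alpha> + \<alpha>))"
      by (intro has_order_mult o0 1 2 3)
    ultimately show False by (rule not_has_order_low[OF _ e3]) (use that(2) in simp)
  qed
  consider "k < \<beta>" | "k > \<beta>" | "k = \<beta>" "l > \<beta>" | "k = \<beta>" "l < \<beta>" | "k = \<beta>" "l = \<beta>" by linarith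
  then show ?thesis
  proof cases
    case 1
    note close = has_order_close[OF o0(1) d(3) 1]
    have "l = k" using has_order_unique[OF 2 close(1)] .
    then show ?thesis using contra[OF close(2)] o0(2) by simp
  next
    case k: 2
    have "has_order x2 \<beta>" using has_order_diff_greater[OF o0(1) d(3) k] by simp
    then have "l = \<beta>" using has_order_unique[OF 2] by blast
    have "has_order (x0 + x2) \<beta>"
      using has_order_add_less[OF \<open>has_order x2 \<beta>\<close> o0(1) k] by (simp add: add.commute)
    then show ?thesis using contra[of \<beta>] k \<open>l = \<beta>\<close> \<open>\<alpha> < \<beta>\<close> by simp
  next
    case kl: 3
    have "has_order (x0 + x2) \<beta>" using has_order_add_less[OF o0(1) 2] kl by simp
    then show ?thesis using contra[of \<beta>] kl \<open>\<alpha> < \<beta>\<close> by simp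
  next
    case kl: 4
    then have "has_order (x0 - x2) l" using has_order_diff_greater[OF o0(1) 2] by simp
    then show ?thesis using has_order_unique[OF d(3)] kl by simp
  next
    case 5
    then show ?thesis using o0 1 2 3 by simp
  qed
qed

text \<open>The pairs \<open>{0, 2}\<close> and \<open>{1, 3}\<close> play symmetric roles, so
  \<open>polar_contact_greater\<close> applies to whichever contains a contact above \<alpha>;
  otherwise all contacts are \<alpha>.\<close>

lemma polar_contact:
  fixes x0 x1 x2 x3 :: "complex fps"
  assumes \<alpha>: "has_order (x0 - x1) \<alpha>" "has_order (x0 - x3) \<alpha>" "has_order (x1 - x2) \<alpha>"
    and \<beta>: "has_order (x0 - x2) \<beta>" "has_order (x1 - x3) \<beta>" and "\<alpha> < \<beta>"
    and e3: "(x0 + x2) * (x1 * x3) + (x0 * x2) * (x1 + x3) = w * ((x0 * x2) * (x1 * x3))"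
    and nz: "x0 \<noteq> 0" "x1 \<noteq> 0" "x2 \<noteq> 0" "x3 \<noteq> 0" and pos: "x0 $ 0 = 0"
  shows "has_order x0 \<alpha> \<and> has_order x1 \<alpha> \<and> has_order x2 \<alpha> \<and> has_order x3 \<alpha> \<or>
    has_order x0 \<beta> \<and> has_order x2 \<beta> \<and> has_order x1 \<alpha> \<and> has_order x3 \<alpha> \<or>
    has_order x1 \<beta> \<and> has_order x3 \<beta> \<and> has_order x0 \<alpha> \<and> has_order x2 \<alpha>"
proof -
  obtain k l where k: "has_order x0 k" and l: "has_order x1 l"
    using has_order_subdegree nz by blast
  have "k > 0" using k pos by (auto simp: has_order_def intro!: gr0I)
  have "\<not> k < \<alpha>" using polar_contact_less[OF \<alpha>(1,2) \<beta>(1) \<open>\<alpha> < \<beta>\<close> e3 k _ \<open>k > 0\<close>] by blast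
  have l_ge: "\<not> l < \<alpha>"
  proof
    assume "l < \<alpha>"
    have "has_order (x1 - x0) \<alpha>" using \<alpha>(1) has_order_minus_commute by blast
    then have "has_order x0 l" using has_order_close(1)[OF l _ \<open>l < \<alpha>\<close>] by blast
    then show False using has_order_unique[OF k] \<open>\<not> k < \<alpha>\<close> \<open>l < \<alpha>\<close> by blast
  qed
  consider "k > \<alpha>" | "l > \<alpha>" | "k = \<alpha>" "l = \<alpha>" using \<open>\<not> k < \<alpha>\<close> l_ge by linarith
  then show ?thesis
  proof cases
    case 1
    then show ?thesis using polar_contact_greater[OF \<alpha>(1,2) \<beta> \<open>\<alpha> < \<beta>\<close> e3 k _ nz(3)] by blast
  next
    case 2
    have e3': "(x1 + x3) * (x2 * x0) + (x1 * x3) * (x2 + x0) = w * ((x1 * x3) * (x2 * x0))"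
      using e3 by (simp add: mult_ac add_ac)
    have "has_order (x1 - x0) \<alpha>" "has_order (x2 - x0) \<beta>"
      using \<alpha>(1) \<beta>(1) has_order_minus_commute by blast+
    from polar_contact_greater[OF \<alpha>(3) this(1) \<beta>(2) this(2) \<open>\<alpha> < \<beta>\<close> e3' l 2 nz(4)]
    show ?thesis by blast
  next
    case 3
    then show ?thesis
      using has_order_close(1)[OF k \<beta>(1)] has_order_close(1)[OF l \<beta>(2)] k l \<open>\<alpha> < \<beta>\<close> by simp
  qed
qed

section \<open>Contacts of the polar roots with the conjugates\<close>

lemma has_order_ram: "N > 0 \<Longrightarrow> has_order a k \<Longrightarrow> has_order (ram N a) (N * k)"
  by (simp add: has_order_iff subdegree_ram subst_hom.eq_0_iff[OF subst_hom_ram])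

text \<open>The coefficient of \<open>t^k\<close> is that of \<phi> times
  \<open>e^(i k) - e^(j k)\<close>, which vanishes iff 4 divides \<open>(j - i) k\<close>. For
  \<open>j - i = 2\<close> this means even \<open>k\<close>, otherwise 4 divides
  \<open>k\<close>.\<close>

lemma conjugate_difference:
  assumes e: "primitive_root 4 e" and ij: "i < j" "j < 4"
    and \<beta>1: "\<not> 4 dvd \<beta>1" "even \<beta>1" "\<phi> $ \<beta>1 \<noteq> 0" "\<And>k. k < \<beta>1 \<Longrightarrow> \<not> 4 dvd k \<Longrightarrow> \<phi> $ k = 0"
    and \<beta>2: "odd \<beta>2" "\<phi> $ \<beta>2 \<noteq> 0" "\<And>k. k < \<beta>2 \<Longrightarrow> odd k \<Longrightarrow> \<phi> $ k = 0"
  shows "has_order (rot (e ^ i) \<phi> - rot (e ^ j) \<phi>) (if j = i + 2 then \<beta>2 else \<beta>1)"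
proof -
  have nth: "(rot (e ^ i) \<phi> - rot (e ^ j) \<phi>) $ k = 0 \<longleftrightarrow> \<phi> $ k = 0 \<or> 4 dvd (j - i) * k" for k
  proof -
    have "(rot (e ^ i) \<phi> - rot (e ^ j) \<phi>) $ k = (e ^ (i * k) - e ^ (j * k)) * \<phi> $ k"
      by (simp add: power_mult algebra_simps)
    also have "j * k = i * k + (j - i) * k" using ij by (simp flip: add_mult_distrib)
    finally have "(rot (e ^ i) \<phi> - rot (e ^ j) \<phi>) $ k = e ^ (i * k) * (1 - e ^ ((j - i) * k)) * \<phi> $ k"
      by (simp add: power_add algebra_simps)
    then show ?thesis
      using primitive_root_power_eq_1[OF e, of "(j - i) * k"] primitive_root_nonzero[OF e] by auto
  qed
  show ?thesis
  proof (cases "j = i + 2")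
    case True
    have "4 dvd 2 * k \<longleftrightarrow> even k" for k :: nat by presburger
    then show ?thesis using True \<beta>2 nth by (auto simp: has_order_def)
  next
    case False
    then have "j - i = 1 \<or> j - i = 3" using ij by linarith
    then have "4 dvd (j - i) * k \<longleftrightarrow> 4 dvd k" for k by (elim disjE) (simp_all, presburger)
    then show ?thesis using False \<beta>1 nth unfolding has_order_def by auto
  qed
qed

lemma one_of_three:
  fixes a b x y z :: nat
  assumes "a < b" "x + y + z = 2 * a + b" "x = a \<or> x = b" "y = a \<or> y = b" "z = a \<or> z = b"
  shows "x = b \<and> y = a \<and> z = a \<or> x = a \<and> y = b \<and> z = a \<or> x = a \<and> y = a \<and> z = b"
  using assms(3-5) assms(1,2) by (elim disjE) auto

theorem polar_root_orders:
  fixes f w :: series2 and \<gamma> :: "nat \<Rightarrow> complex fps" and N :: nat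
  assumes param: "puiseux_parametrization f 4 e \<phi> U"
    and \<beta>1: "\<not> 4 dvd \<beta>1" "even \<beta>1" "\<phi> $ \<beta>1 \<noteq> 0" "\<And>k. k < \<beta>1 \<Longrightarrow> \<not> 4 dvd k \<Longrightarrow> \<phi> $ k = 0"
    and \<beta>2: "odd \<beta>2" "\<phi> $ \<beta>2 \<noteq> 0" "\<And>k. k < \<beta>2 \<Longrightarrow> odd k \<Longrightarrow> \<phi> $ k = 0" and less: "\<beta>1 < \<beta>2"
    and polar: "Newton_Puiseux_polar f N w \<gamma>" and ord: "ord2 f = 4"
  defines "\<delta> \<equiv> \<lambda>j. subst_y (ramify N f) (\<gamma> j)"
  shows "\<exists>p q r. {p, q, r} = {1, 2, 3} \<and> p \<noteq> q \<and> p \<noteq> r \<and> q \<noteq> r \<and> has_order (\<delta> p) (N * \<beta>1) \<and>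
    \<delta> q \<noteq> 0 \<and> 2 * subdegree (\<delta> q) = N * (\<beta>1 + \<beta>2) \<and> \<delta> r \<noteq> 0 \<and> 2 * subdegree (\<delta> r) = N * (\<beta>1 + \<beta>2)"
proof -
  interpret puiseux_parametrization f 4 e \<phi> U by (rule param)
  have N: "N > 0" and w: "convergent2 w" "w $ 0 $ 0 \<noteq> 0"
    and \<gamma>: "\<And>j. j \<in> {1, 2, 3} \<Longrightarrow> \<gamma> j $ 0 = 0"
    and fac: "ramify N (fps_deriv f) = ramify N w * (\<Prod>j\<in>{1, 2, 3}. fps_X - fps_const (\<gamma> j))"
  proof -
    have "{1..ord2 f - 1} = {1, 2, 3}" using ord by auto
    then show "N > 0" "convergent2 w" "w $ 0 $ 0 \<noteq> 0" "\<And>j. j \<in> {1, 2, 3} \<Longrightarrow> \<gamma> j $ 0 = 0"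
      "ramify N (fps_deriv f) = ramify N w * (\<Prod>j\<in>{1, 2, 3}. fps_X - fps_const (\<gamma> j))"
      using polar unfolding Newton_Puiseux_polar_def by (auto simp: Units_conv_ring)
  qed
  interpret N: subst_hom "ram N" by (rule subst_hom_ram[OF N])
  \<comment> \<open>The conjugates are series in \<open>x^(1/4)\<close>, the polar roots in
    \<open>x^(1/N)\<close>; both become series in \<open>t\<close> for
    \<open>x = t^(4 N)\<close>.\<close>
  define F where "F = ramify (N * 4) f"
  define U' where "U' = ramify (N * 4) U"
  define w' where "w' = ramify (N * 4) w"
  define \<psi> where "\<psi> k = ram N (conj k)" for k
  define \<eta> where "\<eta> j = ram 4 (\<gamma> j)" for j
  have F1: "F = lift (ram N) (ramify 4 f)" and U1: "U' = lift (ram N) (ramify 4 U)"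
    using ramify_ramify[OF N, of 4] by (simp_all add: F_def U'_def ramify_eq_lift)
  have F2: "F = lift (ram 4) (ramify N f)" and w2: "w' = lift (ram 4) (ramify N w)"
    using ramify_ramify[OF _ N, of 4] by (simp_all add: F_def w'_def ramify_eq_lift mult.commute)
  have \<psi>0: "\<psi> k $ 0 = 0" for k by (simp add: \<psi>_def N.nth_0 \<phi>_0)
  have \<eta>0: "\<eta> j $ 0 = 0" if "j \<in> {1, 2, 3}" for j using \<gamma>[OF that] by (simp add: \<eta>_def ram.nth_0)
  have F: "F = U' * ((fps_X - fps_const (\<psi> 0)) * (fps_X - fps_const (\<psi> 2)) *
      ((fps_X - fps_const (\<psi> 1)) * (fps_X - fps_const (\<psi> 3))))"
  proof -
    have "{..<4 :: nat} = {0, 1, 2, 3}" by auto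
    then show ?thesis
      unfolding F1 U1 factorization by (simp add: N.lift_mult N.lift_diff \<psi>_def mult_ac)
  qed
  have dF: "fps_deriv F = w' * ((fps_X - fps_const (\<eta> 1)) * (fps_X - fps_const (\<eta> 2)) * (fps_X - fps_const (\<eta> 3)))"
  proof -
    have "fps_deriv F = lift (ram 4) (ramify N (fps_deriv f))"
      unfolding F2 ram.lift_deriv[symmetric] by (simp add: ramify_eq_lift N.lift_deriv)
    then show ?thesis unfolding fac w2 by (simp add: ram.lift_mult ram.lift_diff \<eta>_def mult_ac)
  qed
  have U'_0: "U' $ 0 $ 0 \<noteq> 0" and w'_0: "w' $ 0 $ 0 \<noteq> 0"
    using U_0 w N by (simp_all add: U'_def w'_def ramify_eq_lift lift_def subst_hom.nth_0[OF subst_hom_ram])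
  define E where "E g = ((g - \<psi> 0) + (g - \<psi> 2)) * ((g - \<psi> 1) * (g - \<psi> 3)) +
      ((g - \<psi> 0) * (g - \<psi> 2)) * ((g - \<psi> 1) + (g - \<psi> 3))" for g
  define P where "P g = ((g - \<psi> 0) * (g - \<psi> 2)) * ((g - \<psi> 1) * (g - \<psi> 3))" for g
  have subst_F: "subst_y F g = subst_y U' g * P g" if "g $ 0 = 0" for g
    using that by (simp add: F subst_y_mult subst_y_diff P_def)
  have subst_dF: "subst_y (fps_deriv F) g = subst_y (fps_deriv U') g * P g + subst_y U' g * E g"
    if "g $ 0 = 0" for g
  proof -
    have product_rule: "fps_deriv (V * (A * B * (C * D))) =
        fps_deriv V * (A * B * (C * D)) + V * ((A + B) * (C * D) + (A * B) * (C + D))"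
      if "fps_deriv A = 1" "fps_deriv B = 1" "fps_deriv C = 1" "fps_deriv D = 1" for V A B C D :: series2
      using that by (simp add: algebra_simps)
    have "fps_deriv F = fps_deriv U' * ((fps_X - fps_const (\<psi> 0)) * (fps_X - fps_const (\<psi> 2)) *
          ((fps_X - fps_const (\<psi> 1)) * (fps_X - fps_const (\<psi> 3)))) +
        U' * (((fps_X - fps_const (\<psi> 0)) + (fps_X - fps_const (\<psi> 2))) *
          ((fps_X - fps_const (\<psi> 1)) * (fps_X - fps_const (\<psi> 3))) +
          ((fps_X - fps_const (\<psi> 0)) * (fps_X - fps_const (\<psi> 2))) *
          ((fps_X - fps_const (\<psi> 1)) + (fps_X - fps_const (\<psi> 3))))"
      unfolding F by (rule product_rule) simp_all
    then show ?thesis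
      using that by (simp only: subst_y_mult[OF that] subst_y_add subst_y_diff subst_y_X[OF that] subst_y_const P_def E_def)
  qed
  have subst_dF': "subst_y (fps_deriv F) g = subst_y w' g * ((g - \<eta> 1) * (g - \<eta> 2) * (g - \<eta> 3))"
    if "g $ 0 = 0" for g
    unfolding dF using that by (simp add: subst_y_mult subst_y_diff)
  have unit: "has_order (subst_y h g) 0" if "h $ 0 $ 0 \<noteq> 0" "g $ 0 = 0" for h g
    using that by (simp add: has_order_def subst_y_nth_0)
  define \<alpha> where "\<alpha> = N * \<beta>1"
  define \<beta> where "\<beta> = N * \<beta>2"
  have "\<alpha> < \<beta>" using less N by (simp add: \<alpha>_def \<beta>_def)
  have diff: "has_order (\<psi> i - \<psi> j) (if j = i + 2 then \<beta> else \<alpha>)" if "i < j" "j < 4" for i j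
    using has_order_ram[OF N conjugate_difference[OF e that \<beta>1 \<beta>2]]
    by (simp add: \<psi>_def N.diff \<alpha>_def \<beta>_def split: if_splits)
  have d01: "has_order (\<psi> 0 - \<psi> 1) \<alpha>" and d02: "has_order (\<psi> 0 - \<psi> 2) \<beta>" and d03: "has_order (\<psi> 0 - \<psi> 3) \<alpha>"
    and d12: "has_order (\<psi> 1 - \<psi> 2) \<alpha>" and d13: "has_order (\<psi> 1 - \<psi> 3) \<beta>"
    using diff[of 0 1] diff[of 0 2] diff[of 0 3] diff[of 1 2] diff[of 1 3] by simp_all
  have d10: "has_order (\<psi> 1 - \<psi> 0) \<alpha>" using d01 has_order_minus_commute by blast
  \<comment> \<open>At a root of \<open>f\<close> the derivative is the unit times the product of
    the differences to the other roots.\<close>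
  have val0: "has_order (subst_y (fps_deriv F) (\<psi> 0)) (2 * \<alpha> + \<beta>)"
  proof -
    have "subst_y (fps_deriv F) (\<psi> 0) = subst_y U' (\<psi> 0) * ((\<psi> 0 - \<psi> 2) * ((\<psi> 0 - \<psi> 1) * (\<psi> 0 - \<psi> 3)))"
      by (simp add: subst_dF \<psi>0 P_def E_def)
    moreover have "has_order \<dots> (0 + (\<beta> + (\<alpha> + \<alpha>)))"
      by (intro has_order_mult unit U'_0 \<psi>0 d01 d02 d03)
    ultimately show ?thesis by (simp add: mult_2 add_ac)
  qed
  have val1: "has_order (subst_y (fps_deriv F) (\<psi> 1)) (2 * \<alpha> + \<beta>)"
  proof -
    have "subst_y (fps_deriv F) (\<psi> 1) = subst_y U' (\<psi> 1) * (((\<psi> 1 - \<psi> 0) * (\<psi> 1 - \<psi> 2)) * (\<psi> 1 - \<psi> 3))"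
      by (simp add: subst_dF \<psi>0 P_def E_def)
    moreover have "has_order \<dots> (0 + ((\<alpha> + \<alpha>) + \<beta>))"
      by (intro has_order_mult unit U'_0 \<psi>0 d10 d12 d13)
    ultimately show ?thesis by (simp add: mult_2 add_ac)
  qed
  define ord where "ord k j = subdegree (\<eta> j - \<psi> k)" for k j
  have val_sum: "ord k 1 + ord k 2 + ord k 3 = 2 * \<alpha> + \<beta> \<and> \<eta> 1 \<noteq> \<psi> k \<and> \<eta> 2 \<noteq> \<psi> k \<and> \<eta> 3 \<noteq> \<psi> k"
    if "has_order (subst_y (fps_deriv F) (\<psi> k)) (2 * \<alpha> + \<beta>)" for k
  proof -
    have sm: "subdegree (\<psi> k - \<eta> j) = ord k j" for j
      unfolding ord_def by (metis minus_diff_eq subdegree_uminus)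
    have w'k: "has_order (subst_y w' (\<psi> k)) 0" by (rule unit[OF w'_0 \<psi>0])
    have order: "has_order (subst_y w' (\<psi> k) * ((\<psi> k - \<eta> 1) * (\<psi> k - \<eta> 2) * (\<psi> k - \<eta> 3))) (2 * \<alpha> + \<beta>)"
      using that unfolding subst_dF'[OF \<psi>0] .
    then have nz: "\<psi> k - \<eta> 1 \<noteq> 0" "\<psi> k - \<eta> 2 \<noteq> 0" "\<psi> k - \<eta> 3 \<noteq> 0"
      unfolding has_order_iff by (metis mult_zero_left mult_zero_right)+
    have "has_order (subst_y w' (\<psi> k) * ((\<psi> k - \<eta> 1) * (\<psi> k - \<eta> 2) * (\<psi> k - \<eta> 3)))
        (0 + (ord k 1 + ord k 2 + ord k 3))"
      unfolding sm[symmetric] by (intro has_order_mult w'k has_order_subdegree nz)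
    from has_order_unique[OF order this] have "ord k 1 + ord k 2 + ord k 3 = 2 * \<alpha> + \<beta>"
      by linarith
    then show ?thesis using nz by auto
  qed
  have type: "(ord 0 j = \<alpha> \<and> ord 1 j = \<alpha> \<and> has_order (subst_y F (\<eta> j)) (4 * \<alpha>)) \<or>
      (ord 0 j = \<beta> \<and> ord 1 j = \<alpha> \<and> has_order (subst_y F (\<eta> j)) (2 * \<alpha> + 2 * \<beta>)) \<or>
      (ord 0 j = \<alpha> \<and> ord 1 j = \<beta> \<and> has_order (subst_y F (\<eta> j)) (2 * \<alpha> + 2 * \<beta>))"
    if j: "j \<in> {1, 2, 3}" for j
  proof -
    have \<eta>j: "\<eta> j $ 0 = 0" using \<eta>0[OF j] .
    have "subst_y (fps_deriv F) (\<eta> j) = 0" using j by (auto simp: subst_dF' \<eta>j)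
    then have eq: "subst_y U' (\<eta> j) * E (\<eta> j) = - (subst_y (fps_deriv U') (\<eta> j) * P (\<eta> j))"
      by (simp add: subst_dF \<eta>j add_eq_0_iff)
    have v0: "subst_y U' (\<eta> j) $ 0 \<noteq> 0" using unit[OF U'_0 \<eta>j] by (simp add: has_order_def)
    \<comment> \<open>The value of \<open>- U_y / U\<close> at the polar root.\<close>
    define W where "W = - (inverse (subst_y U' (\<eta> j)) * subst_y (fps_deriv U') (\<eta> j))"
    have "E (\<eta> j) = inverse (subst_y U' (\<eta> j)) * (subst_y U' (\<eta> j) * E (\<eta> j))"
      using inverse_mult_eq_1[OF v0] by (simp add: mult.assoc[symmetric])
    also have "\<dots> = W * P (\<eta> j)" unfolding eq W_def by (simp add: mult.assoc)
    finally have e3: "E (\<eta> j) = W * P (\<eta> j)" .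
    have nz0: "\<eta> j - \<psi> 0 \<noteq> 0" using val_sum[OF val0] j by auto
    have nz1: "\<eta> j - \<psi> 1 \<noteq> 0" using val_sum[OF val1] j by auto
    \<comment> \<open>At a conjugate \<open>E\<close> is a product of nonzero differences while
      \<open>P\<close> vanishes, so \<open>e3\<close> fails there.\<close>
    have nz': "\<eta> j - \<psi> 2 \<noteq> 0" "\<eta> j - \<psi> 3 \<noteq> 0"
    proof -
      show "\<eta> j - \<psi> 2 \<noteq> 0"
      proof
        assume 0: "\<eta> j - \<psi> 2 = 0"
        then have "E (\<psi> 2) = 0" using e3 by (simp add: P_def)
        then have "(\<psi> 2 - \<psi> 0) * ((\<psi> 2 - \<psi> 1) * (\<psi> 2 - \<psi> 3)) = 0" by (simp add: E_def)
        then show False using d02 d12 diff[of 2 3] by (auto simp: has_order_iff)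
      qed
      show "\<eta> j - \<psi> 3 \<noteq> 0"
      proof
        assume 0: "\<eta> j - \<psi> 3 = 0"
        then have "E (\<psi> 3) = 0" using e3 by (simp add: P_def)
        then have "((\<psi> 3 - \<psi> 0) * (\<psi> 3 - \<psi> 2)) * (\<psi> 3 - \<psi> 1) = 0" by (simp add: E_def)
        then show False using d03 d13 diff[of 2 3] by (auto simp: has_order_iff)
      qed
    qed
    have dd: "(\<eta> j - \<psi> k) - (\<eta> j - \<psi> l) = - (\<psi> k - \<psi> l)" for k l by simp
    have "(\<eta> j - \<psi> 0) $ 0 = 0" using \<eta>j \<psi>0 by simp
    note contact = polar_contact[of "\<eta> j - \<psi> 0" "\<eta> j - \<psi> 1" \<alpha> "\<eta> j - \<psi> 3" "\<eta> j - \<psi> 2" \<beta> W,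
        unfolded dd has_order_uminus, OF d01 d03 d12 d02 d13 \<open>\<alpha> < \<beta>\<close> e3[unfolded E_def P_def] nz0 nz1 nz' this]
    have F_order: "has_order (subst_y F (\<eta> j)) (0 + ((a + b) + (c + d)))"
      if "has_order (\<eta> j - \<psi> 0) a" "has_order (\<eta> j - \<psi> 2) b" "has_order (\<eta> j - \<psi> 1) c" "has_order (\<eta> j - \<psi> 3) d"
      for a b c d
      unfolding subst_F[OF \<eta>j] P_def by (intro has_order_mult unit U'_0 \<eta>j that)
    from contact show ?thesis
    proof (elim disjE conjE)
      assume "has_order (\<eta> j - \<psi> 0) \<alpha>" "has_order (\<eta> j - \<psi> 1) \<alpha>" "has_order (\<eta> j - \<psi> 2) \<alpha>" "has_order (\<eta> j - \<psi> 3) \<alpha>"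
      then show ?thesis using F_order[of \<alpha> \<alpha> \<alpha> \<alpha>] by (simp add: ord_def has_order_iff)
    next
      assume "has_order (\<eta> j - \<psi> 0) \<beta>" "has_order (\<eta> j - \<psi> 2) \<beta>" "has_order (\<eta> j - \<psi> 1) \<alpha>" "has_order (\<eta> j - \<psi> 3) \<alpha>"
      then show ?thesis using F_order[of \<beta> \<beta> \<alpha> \<alpha>] by (simp add: ord_def has_order_iff)
    next
      assume "has_order (\<eta> j - \<psi> 1) \<beta>" "has_order (\<eta> j - \<psi> 3) \<beta>" "has_order (\<eta> j - \<psi> 0) \<alpha>" "has_order (\<eta> j - \<psi> 2) \<alpha>"
      then show ?thesis using F_order[of \<alpha> \<alpha> \<beta> \<beta>] by (simp add: ord_def has_order_iff)
    qed
  qed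
  \<comment> \<open>Returning to \<open>x = t^N\<close> divides orders by 4:
    \<open>4 \<alpha>\<close> gives \<open>N * \<beta>1\<close>, and
    \<open>2 \<alpha> + 2 \<beta>\<close> gives half of
    \<open>N * (\<beta>1 + \<beta>2)\<close>.\<close>
  have F_\<delta>: "subst_y F (\<eta> j) = ram 4 (\<delta> j)" if "j \<in> {1, 2, 3}" for j
    unfolding F2 \<eta>_def \<delta>_def by (rule ram.subst_y[symmetric]) (rule \<gamma>[OF that])
  have one: "has_order (\<delta> j) (N * \<beta>1)" if "j \<in> {1, 2, 3}" "ord 0 j = \<alpha>" "ord 1 j = \<alpha>" for j
    using type[OF that(1)] that(2,3) \<open>\<alpha> < \<beta>\<close> F_\<delta>[OF that(1)]
    by (auto simp: has_order_iff subdegree_ram \<alpha>_def)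
  have two: "\<delta> j \<noteq> 0 \<and> 2 * subdegree (\<delta> j) = N * (\<beta>1 + \<beta>2)" if "j \<in> {1, 2, 3}" "ord 0 j = \<beta> \<or> ord 1 j = \<beta>" for j
    using type[OF that(1)] that(2) \<open>\<alpha> < \<beta>\<close> F_\<delta>[OF that(1)]
    by (auto simp: has_order_iff subdegree_ram \<alpha>_def \<beta>_def algebra_simps)
  have vals: "ord 0 j = \<alpha> \<and> ord 1 j = \<alpha> \<or> ord 0 j = \<beta> \<and> ord 1 j = \<alpha> \<or> ord 0 j = \<alpha> \<and> ord 1 j = \<beta>"
    if "j \<in> {1, 2, 3}" for j using type[OF that] by blast
  have sums: "ord 0 1 + ord 0 2 + ord 0 3 = 2 * \<alpha> + \<beta>" "ord 1 1 + ord 1 2 + ord 1 3 = 2 * \<alpha> + \<beta>"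
    using val_sum[OF val0] val_sum[OF val1] by auto
  have "\<exists>p q r. {p, q, r} = {1, 2, 3 :: nat} \<and> p \<noteq> q \<and> p \<noteq> r \<and> q \<noteq> r \<and> (ord 0 p = \<alpha> \<and> ord 1 p = \<alpha>) \<and>
      (ord 0 q = \<beta> \<or> ord 1 q = \<beta>) \<and> (ord 0 r = \<beta> \<or> ord 1 r = \<beta>)"
  proof -
    have perms: "{1, 2, 3} = {1, 2, 3 :: nat}" "{2, 1, 3} = {1, 2, 3 :: nat}" "{3, 1, 2} = {1, 2, 3 :: nat}" by auto
    \<comment> \<open>By \<open>sums\<close> exactly one root has contact \<beta> with conjugate 0
      and exactly one with conjugate 1. No root has both, so they differ and the third root has
      neither.\<close>
    have "(ord 0 1 = \<alpha> \<and> ord 1 1 = \<alpha>) \<and> (ord 0 2 = \<beta> \<or> ord 1 2 = \<beta>) \<and> (ord 0 3 = \<beta> \<or> ord 1 3 = \<beta>) \<or>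
        (ord 0 2 = \<alpha> \<and> ord 1 2 = \<alpha>) \<and> (ord 0 1 = \<beta> \<or> ord 1 1 = \<beta>) \<and> (ord 0 3 = \<beta> \<or> ord 1 3 = \<beta>) \<or>
        (ord 0 3 = \<alpha> \<and> ord 1 3 = \<alpha>) \<and> (ord 0 1 = \<beta> \<or> ord 1 1 = \<beta>) \<and> (ord 0 2 = \<beta> \<or> ord 1 2 = \<beta>)"
    proof -
      have v: "(ord 0 j = \<alpha> \<or> ord 0 j = \<beta>) \<and> (ord 1 j = \<alpha> \<or> ord 1 j = \<beta>) \<and> (ord 0 j = \<alpha> \<or> ord 1 j = \<alpha>)"
        if "j \<in> {1, 2, 3}" for j
        using vals[OF that] by blast
      have "\<alpha> \<noteq> \<beta>" using \<open>\<alpha> < \<beta>\<close> by simp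
      from one_of_three[OF \<open>\<alpha> < \<beta>\<close> sums(1)] one_of_three[OF \<open>\<alpha> < \<beta>\<close> sums(2)] v[of 1] v[of 2] v[of 3] this
      show ?thesis by (simp del: One_nat_def) metis
    qed
    then show ?thesis
    proof (elim disjE)
      assume "(ord 0 1 = \<alpha> \<and> ord 1 1 = \<alpha>) \<and> (ord 0 2 = \<beta> \<or> ord 1 2 = \<beta>) \<and> (ord 0 3 = \<beta> \<or> ord 1 3 = \<beta>)"
      then show ?thesis using perms(1) by (intro exI[of _ 1] exI[of _ 2] exI[of _ 3]) simp
    next
      assume "(ord 0 2 = \<alpha> \<and> ord 1 2 = \<alpha>) \<and> (ord 0 1 = \<beta> \<or> ord 1 1 = \<beta>) \<and> (ord 0 3 = \<beta> \<or> ord 1 3 = \<beta>)"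
      then show ?thesis using perms(2) by (intro exI[of _ 2] exI[of _ 1] exI[of _ 3]) simp
    next
      assume "(ord 0 3 = \<alpha> \<and> ord 1 3 = \<alpha>) \<and> (ord 0 1 = \<beta> \<or> ord 1 1 = \<beta>) \<and> (ord 0 2 = \<beta> \<or> ord 1 2 = \<beta>)"
      then show ?thesis using perms(3) by (intro exI[of _ 3] exI[of _ 1] exI[of _ 2]) simp
    qed
  qed
  then obtain p q r where pqr: "{p, q, r} = {1, 2, 3 :: nat}" "p \<noteq> q" "p \<noteq> r" "q \<noteq> r"
    "ord 0 p = \<alpha>" "ord 1 p = \<alpha>" "ord 0 q = \<beta> \<or> ord 1 q = \<beta>" "ord 0 r = \<beta> \<or> ord 1 r = \<beta>" by blast
  then have "p \<in> {1, 2, 3}" "q \<in> {1, 2, 3}" "r \<in> {1, 2, 3}" by blast+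
  then show ?thesis using one two pqr by metis
qed

section \<open>The two branches of the discriminant\<close>

text \<open>A rotation permutes the three roots and preserves orders, so it fixes the only root of
  order \<open>N * s1\<close>, which therefore descends. The cofactor is a series in
  \<open>u\<close>, and its coefficients are the symmetric functions of the other two roots.\<close>

lemma discriminant_factorization:
  assumes D: "convergent2 D" and N: "N > 0"
    and fac: "ramify N D = (fps_X - fps_const a) * ((fps_X - fps_const b) * (fps_X - fps_const c))"
    and a: "conv1 a" "has_order a (N * s1)"
    and b: "b \<noteq> 0" "2 * subdegree b = N * s2" and c: "c \<noteq> 0" "2 * subdegree c = N * s2"
    and s: "odd s2" "2 * s1 < s2" "s1 > 0"
  obtains d1 b1 b2 where "conv1 d1" "conv1 b1" "conv1 b2" "has_order d1 s1" "has_order b2 s2"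
    "\<And>i. 2 * i \<le> s2 \<Longrightarrow> b1 $ i = 0"
    "D = (fps_X - fps_const d1) * (fps_X ^ 2 - fps_const b1 * fps_X + fps_const b2)"
proof -
  interpret N: subst_hom "ram N" by (rule subst_hom_ram[OF N])
  have a0: "a $ 0 = 0" using a(2) s N by (auto simp: has_order_def)
  obtain e where e: "primitive_root N e" using primitive_root_exists[OF N] by blast
  have e': "e ^ N = 1" "e \<noteq> 0" using e primitive_root_nonzero by (auto simp: primitive_root_def)
  interpret e: subst_hom "rot e" by (rule subst_hom_rot[OF e'(2)])
  have "subst_y (ramify N D) a = 0" using a0 by (simp add: fac subst_y_mult subst_y_diff)
  then have "subst_y (ramify N D) (rot e a) = 0"
    using e.subst_y[OF a0, of "ramify N D"] lift_rot_ramify[OF e'(1) N, of D] by simp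
  then have "(rot e a - a) * ((rot e a - b) * (rot e a - c)) = 0"
    using a0 by (simp add: fac subst_y_mult subst_y_diff)
  moreover have ord_rot: "subdegree (rot e a) = N * s1"
    using a(2) by (simp add: has_order_iff subdegree_rot e'(2))
  have "2 * (N * s1) \<noteq> N * s2" using s N by (simp add: mult.left_commute)
  then have "rot e a \<noteq> b" "rot e a \<noteq> c" using ord_rot b(2) c(2) by metis+
  ultimately have "rot e a = a" by simp
  then obtain d1 where d1: "conv1 d1" "a = ram N d1" using descent[OF e a(1)] by blast
  have ord_d1: "has_order d1 s1"
    using a(2) N by (auto simp: d1(2) has_order_iff subdegree_ram)
  have d10: "d1 $ 0 = 0" using a0 by (simp add: d1(2) N.nth_0)
  have "convergent2 (fps_X - fps_const d1)" using d1(1) by (intro convergent2_diff) auto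
  then obtain q r where qr: "convergent2 q" "convergent2 r" "D = q * (fps_X - fps_const d1) + r" "\<forall>j\<ge>1. r $ j = 0"
    using weierstrass_division[OF _ y_order_linear[OF d10] D] by blast
  have lin: "ramify N (fps_X - fps_const d1) = fps_X - fps_const a"
    by (simp add: ramify_eq_lift N.lift_diff d1(2))
  have rD: "ramify N D = ramify N q * (fps_X - fps_const a) + ramify N r"
    by (subst qr(3)) (simp add: ramify_eq_lift N.lift_add N.lift_mult lin[unfolded ramify_eq_lift])
  have "subst_y (ramify N r) a = 0"
    using \<open>subst_y (ramify N D) a = 0\<close> a0 by (simp add: rD subst_y_add subst_y_mult subst_y_diff)
  moreover have "ramify N r = fps_const (ram N (r $ 0))"
    using qr(4) by (intro fps_ext) (simp add: ramify_eq_lift)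
  ultimately have "r = 0" using qr(4) by (metis N.eq_0_iff fps_ext fps_zero_nth not_one_le_zero le_less_linear less_one subst_y_const)
  then have D_eq: "D = (fps_X - fps_const d1) * q" using qr(3) by (simp add: mult.commute)
  have nz: "fps_X - fps_const a \<noteq> 0"
  proof
    assume "fps_X - fps_const a = 0"
    then have "(fps_X - fps_const a) $ 1 = 0" by simp
    then show False by simp
  qed
  have "(fps_X - fps_const a) * ramify N q = (fps_X - fps_const a) * ((fps_X - fps_const b) * (fps_X - fps_const c))"
    using rD fac \<open>r = 0\<close> by (simp add: mult.commute ramify_eq_lift)
  then have rq: "ramify N q = (fps_X - fps_const b) * (fps_X - fps_const c)" using nz by simp
  have rq_nth: "ram N (q $ j) = (if j = 0 then b * c else if j = 1 then - (b + c) else if j = 2 then 1 else 0)" for j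
  proof -
    have "ram N (q $ j) = ((fps_X - fps_const b) * (fps_X - fps_const c)) $ j"
      by (simp add: rq[symmetric] ramify_eq_lift)
    also have "\<dots> = (if j = 0 then b * c else if j = 1 then - (b + c) else if j = 2 then 1 else 0)"
    proof -
      consider "j = 0" | "j = 1" | "j = 2" | "j > 2" by linarith
      then show ?thesis by cases (auto simp: left_diff_distrib fps_X_nth)
    qed
    finally show ?thesis .
  qed
  define b1 where "b1 = - (q $ 1)"
  define b2 where "b2 = q $ 0"
  have rb: "ram N b1 = b + c" "ram N b2 = b * c"
    using rq_nth[of 1] rq_nth[of 0] by (simp_all add: b1_def b2_def N.uminus)
  have q2: "q $ j = (if j = 2 then 1 else 0)" if "j \<ge> 2" for j
  proof -
    have "ram N (q $ j) = ram N (if j = 2 then 1 else 0)" using rq_nth[of j] that by (auto simp: N.one)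
    then show ?thesis using N.eq_iff by blast
  qed
  have "q = fps_X ^ 2 - fps_const b1 * fps_X + fps_const b2"
  proof (rule fps_ext)
    fix j :: nat
    consider "j = 0" | "j = 1" | "j \<ge> 2" by linarith
    then show "q $ j = (fps_X ^ 2 - fps_const b1 * fps_X + fps_const b2) $ j"
      by cases (auto simp: b1_def b2_def q2 fps_X_nth)
  qed
  moreover have "conv1 b1" "conv1 b2"
    using convergent2_nth[OF qr(1)] conv1_diff[of 0 "q $ 1"] by (simp_all add: b1_def b2_def)
  moreover have "has_order b2 s2"
  proof -
    have "b * c \<noteq> 0" "2 * subdegree (b * c) = 2 * (N * s2)" using b c by auto
    then have "ram N b2 \<noteq> 0" "subdegree (ram N b2) = N * s2" by (auto simp: rb)
    then show ?thesis using N by (auto simp: has_order_iff subdegree_ram)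
  qed
  moreover have "b1 $ i = 0" if "2 * i \<le> s2" for i
  proof -
    \<comment> \<open>Equality is impossible for odd \<open>s2\<close>; this places \<open>i\<close>
      strictly below the order of \<open>b\<close> and \<open>c\<close> after ramification.\<close>
    have "2 * i < s2" using that s(1) by (metis dvd_triv_left le_neq_implies_less)
    then have "2 * (N * i) < N * s2" using N by simp
    then have "N * i < subdegree b" "N * i < subdegree c" using b c by linarith+
    then have "b $ (N * i) = 0" "c $ (N * i) = 0" by (simp_all only: nth_less_subdegree_zero)
    then have "ram N b1 $ (N * i) = 0" by (simp add: rb)
    then show ?thesis using N by simp
  qed
  ultimately show ?thesis using that[of d1 b1 b2] d1(1) ord_d1 D_eq by blast
qed

text \<open>The middle coefficient lies above the Newton segment from height 2 to height 0, so at
  any other order of the root a single term would dominate.\<close>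

lemma quadratic_root_order:
  assumes c: "has_order c s" and b: "b = 0 \<or> s < 2 * subdegree b" and eq: "\<psi> ^ 2 - b * \<psi> + c = 0"
  shows "\<psi> \<noteq> 0 \<and> 2 * subdegree \<psi> = s"
proof -
  have "\<psi> \<noteq> 0" using eq c by (auto simp: has_order_def)
  define k where "k = subdegree \<psi>"
  have k: "has_order \<psi> k" using \<open>\<psi> \<noteq> 0\<close> by (simp add: k_def has_order_iff)
  then have k2: "has_order (\<psi> ^ 2) (k + k)" unfolding power2_eq_square by (intro has_order_mult)
  have "2 * k = s"
  proof (cases "b = 0")
    case True
    then have "c = - (\<psi> ^ 2)" using eq by (simp add: eq_neg_iff_add_eq_0 add.commute)
    then have "has_order c (k + k)" using k2 by (simp add: has_order_uminus)
    then show ?thesis using has_order_unique[OF c] by simp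
  next
    case False
    define l where "l = subdegree b"
    have l: "s < 2 * l" using b False by (simp add: l_def)
    have bk: "has_order (b * \<psi>) (l + k)"
      using False k by (intro has_order_mult) (simp_all add: l_def has_order_iff)
    show ?thesis
    proof (rule ccontr)
      assume "2 * k \<noteq> s"
      then consider "2 * k < s" | "2 * k > s" by linarith
      then show False
      proof cases
        case 1
        have "has_order (\<psi> ^ 2 - b * \<psi>) (k + k)" using k2 bk by (rule has_order_diff_less) (use 1 l in linarith)
        then have "has_order (\<psi> ^ 2 - b * \<psi> + c) (k + k)" using c by (rule has_order_add_less) (use 1 in linarith)
        then show False by (simp add: eq has_order_def)
      next
        case 2
        have "has_order (c + \<psi> ^ 2) s" using c k2 by (rule has_order_add_less) (use 2 in linarith)
        then have "has_order (c + \<psi> ^ 2 - b * \<psi>) s" using bk by (rule has_order_diff_less) (use 2 l in linarith)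
        moreover have "c + \<psi> ^ 2 - b * \<psi> = 0" using eq by (simp add: algebra_simps)
        ultimately show False by (simp add: has_order_def)
      qed
    qed
  qed
  then show ?thesis using \<open>\<psi> \<noteq> 0\<close> by (simp add: k_def)
qed

lemma smooth_branch_linear:
  assumes "conv1 d" "d $ 0 = 0"
  shows "smooth_branch (fps_X - fps_const d)"
proof -
  define D where "D = fps_X - fps_const d"
  have nth: "D $ 0 $ 0 = 0" "D $ 1 $ 0 = 1" using assms by (simp_all add: D_def)
  have "plane_branch D"
    unfolding plane_branch_iff
  proof (intro conjI allI impI)
    show "convergent2 D" unfolding D_def using assms by (intro convergent2_diff) auto
    show "D \<noteq> 0" using nth(2) by auto
    show "D $ 0 $ 0 = 0" by (fact nth(1))
    show "a $ 0 $ 0 \<noteq> 0 \<or> b $ 0 $ 0 \<noteq> 0" if "D = a * b" for a b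
    proof (rule ccontr)
      assume "\<not> ?thesis"
      then have "(a * b) $ 1 $ 0 = 0" by (simp add: fps_mult_nth)
      then show False using nth(2) that by simp
    qed
  qed
  moreover have "ord2 D = 1"
    unfolding ord2_def
  proof (rule Least_equality)
    show "\<exists>i j. i + j = 1 \<and> coeff2 D i j \<noteq> 0"
      using nth(2) by (intro exI[of _ 0] exI[of _ 1]) (simp add: coeff2_def)
    show "1 \<le> k" if "\<exists>i j. i + j = k \<and> coeff2 D i j \<noteq> 0" for k
      using that nth(1) by (cases k) (auto simp: coeff2_def)
  qed
  ultimately show ?thesis by (simp add: smooth_branch_def D_def)
qed

text \<open>Quadratics in \<open>v\<close> whose roots have order \<open>s / 2\<close>. The
  condition on \<open>b1\<close> says that its order exceeds \<open>s / 2\<close>, in a form that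
  includes \<open>b1 = 0\<close>.\<close>

locale quadratic_branch =
  fixes b1 b2 :: "complex fps" and s :: nat
  assumes conv: "conv1 b1" "conv1 b2" and b2: "has_order b2 s"
    and b1: "\<And>i. 2 * i \<le> s \<Longrightarrow> b1 $ i = 0" and s: "odd s" "s > 1"
begin

definition quad :: series2 where
  "quad = fps_X ^ 2 - fps_const b1 * fps_X + fps_const b2"

lemma conv_quad: "convergent2 quad"
  unfolding quad_def using conv
  by (intro convergent2_add convergent2_diff convergent2_power convergent2_mult) auto

lemma b1_order: "b1 = 0 \<or> s < 2 * subdegree b1"
proof (rule disjCI)
  assume "\<not> s < 2 * subdegree b1"
  then have "b1 $ subdegree b1 = 0" by (intro b1) simp
  then show "b1 = 0" by simp
qed

lemma subst_quad: "g $ 0 = 0 \<Longrightarrow> subst_y quad g = g ^ 2 - b1 * g + b2"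
  by (simp add: quad_def subst_y_add subst_y_diff subst_y_mult subst_y_power)

lemma quad_nth_0: "quad $ 0 $ 0 = 0" "quad $ 1 $ 0 = 0" "quad $ 0 $ 1 = 0" "quad $ 2 $ 0 = 1"
proof -
  have "b2 $ 0 = 0" "b2 $ 1 = 0" using b2 s(2) by (auto simp: has_order_def)
  moreover have "b1 $ 0 = 0" by (rule b1) simp
  ultimately show "quad $ 0 $ 0 = 0" "quad $ 1 $ 0 = 0" "quad $ 0 $ 1 = 0" "quad $ 2 $ 0 = 1"
    by (simp_all add: quad_def)
qed

lemma y_order_quad: "y_order quad 2"
  unfolding y_order_def using quad_nth_0 by (auto simp: less_2_cases_iff)

text \<open>If both factors vanish at the origin, each has order 1 in \<open>v\<close>, so one gives
  a root that is a series in \<open>u\<close>. Its order would be \<open>s / 2\<close>, impossible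
  for odd \<open>s\<close>.\<close>

lemma plane_branch_quad: "plane_branch quad"
  unfolding plane_branch_iff
proof (intro conjI allI impI)
  show "convergent2 quad" by (rule conv_quad)
  show "quad \<noteq> 0" using quad_nth_0(4) by auto
  show "quad $ 0 $ 0 = 0" by (rule quad_nth_0)
  fix a b assume ab: "convergent2 a" "convergent2 b" "quad = a * b"
  show "a $ 0 $ 0 \<noteq> 0 \<or> b $ 0 $ 0 \<noteq> 0"
  proof (rule ccontr)
    assume "\<not> ?thesis"
    then have 0: "a $ 0 $ 0 = 0" "b $ 0 $ 0 = 0" by auto
    have "(a * b) $ 2 $ 0 = 1" using quad_nth_0(4) ab by simp
    then have "a $ 1 $ 0 * b $ 1 $ 0 = 1" using 0 by (simp add: fps_mult_nth numeral_2_eq_2)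
    then have "y_order a 1" using 0 by (auto simp: y_order_def)
    then obtain q W where q: "q $ 0 $ 0 \<noteq> 0" and W: "weierstrass_poly 1 W" "W = q * a"
      using weierstrass_preparation[OF ab(1)] by blast
    define g where "g = - (W $ 0)"
    have g0: "g $ 0 = 0" using W(1) by (simp add: g_def weierstrass_poly_def)
    have "W = fps_X - fps_const g"
    proof (rule fps_ext)
      fix j :: nat
      consider "j = 0" | "j = 1" | "j > 1" by linarith
      then show "W $ j = (fps_X - fps_const g) $ j"
        using W(1) by cases (auto simp: weierstrass_poly_def g_def fps_X_nth)
    qed
    then have "subst_y W g = 0" using g0 by (simp add: subst_y_diff)
    then have "subst_y q g * subst_y a g = 0" using W(2) g0 by (simp add: subst_y_mult)
    moreover have "subst_y q g \<noteq> 0" using subst_y_nth_0[OF g0, of q] q by auto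
    ultimately have "subst_y quad g = 0" using ab(3) g0 by (simp add: subst_y_mult)
    from quadratic_root_order[OF b2 b1_order this[unfolded subst_quad[OF g0]]]
    have "2 * subdegree g = s" ..
    then show False using s(1) by auto
  qed
qed

lemma singular_branch_quad: "singular_branch quad"
proof -
  have ex: "\<exists>k i j. i + j = k \<and> coeff2 quad i j \<noteq> 0"
    using quad_nth_0(4) by (intro exI[of _ 2] exI[of _ 0] exI[of _ 2]) (simp add: coeff2_def)
  have "\<exists>i j. i + j = ord2 quad \<and> coeff2 quad i j \<noteq> 0"
    unfolding ord2_def using ex by (rule LeastI_ex)
  moreover have "coeff2 quad i j = 0" if "i + j = 1" for i j
  proof -
    have "i = 1 \<and> j = 0 \<or> i = 0 \<and> j = 1" using that by linarith
    then show ?thesis using quad_nth_0(2,3) by (auto simp: coeff2_def)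
  qed
  ultimately have "ord2 quad \<noteq> 1" by metis
  then show ?thesis using plane_branch_quad by (simp add: singular_branch_def)
qed

text \<open>In the parameter \<open>t\<close> with \<open>u = t^2\<close> the root has order
  \<open>s\<close>, so 1 and \<open>v\<close> have values 0 and \<open>s\<close>, an Apery set with
  respect to 2.\<close>

lemma semigroup_quad: "minimally_generated_by (semigroup_of_values quad) [2, s]"
proof -
  obtain e where e: "primitive_root 2 e" using primitive_root_exists[of 2] by auto
  obtain \<phi> U where "puiseux_parametrization quad 2 e \<phi> U"
    using branch_has_parametrization[OF plane_branch_quad y_order_quad _ e] by auto
  then interpret puiseux_parametrization quad 2 e \<phi> U .
  have "\<phi> ^ 2 - ram 2 b1 * \<phi> + ram 2 b2 = 0"
    using val_f by (simp add: quad_def val_add val_diff val_mult val_power del: val_f)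
  moreover have "has_order (ram 2 b2) (2 * s)" by (rule has_order_ram[OF _ b2]) simp
  moreover have "ram 2 b1 = 0 \<or> 2 * s < 2 * subdegree (ram 2 b1)"
    using b1_order by (auto simp: subdegree_ram)
  ultimately have \<phi>: "\<phi> \<noteq> 0" "subdegree \<phi> = s"
    using quadratic_root_order[of "ram 2 b2" "2 * s" "ram 2 b1" \<phi>] by auto
  have "semigroup_of_values quad = {k * s + 2 * m |k m. k < 2}"
  proof (rule semigroup_of_values_apery[where E = "\<lambda>k. fps_X ^ k"])
    show "convergent2 (fps_X ^ k) \<and> fps_X ^ k $ k = (1 :: complex fps) \<and> (\<forall>j>k. fps_X ^ k $ j = (0 :: complex fps))" for k
      by (simp add: convergent2_power)
    show "val (fps_X ^ k) \<noteq> 0 \<and> subdegree (val (fps_X ^ k)) = k * s" for k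
      using \<phi> by (simp add: val_power)
    show "inj_on (\<lambda>k. k * s mod 2) {..<2}"
    proof (rule inj_onI)
      fix k l :: nat assume kl: "k \<in> {..<2}" "l \<in> {..<2}" and eq: "k * s mod 2 = l * s mod 2"
      have "s mod 2 = 1" using s(1) by presburger
      moreover have "k = 0 \<or> k = 1" "l = 0 \<or> l = 1" using kl unfolding lessThan_iff by linarith+
      ultimately show "k = l" using eq by (elim disjE) simp_all
    qed
  qed
  also have "\<dots> = generated_semigroup {2, s}"
  proof -
    have "{k * s + 2 * m |k m. k < 2} = {a * 2 + b * s |a b. True}"
    proof (intro equalityI subsetI)
      fix x assume "x \<in> {k * s + 2 * m |k m. k < 2}"
      then obtain k m where "x = k * s + 2 * m" by blast
      then have "x = m * 2 + k * s" by simp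
      then show "x \<in> {a * 2 + b * s |a b. True}" by blast
    next
      fix x assume "x \<in> {a * 2 + b * s |a b. True}"
      then obtain a b where x: "x = a * 2 + b * s" by blast
      obtain q r where b: "b = r + 2 * q" "r < 2"
        by (metis mod_less_divisor mod_mult_div_eq zero_less_numeral)
      have "x = r * s + 2 * (a + q * s)" unfolding x b(1) by (simp add: algebra_simps)
      then show "x \<in> {k * s + 2 * m |k m. k < 2}" using b(2) by blast
    qed
    then show ?thesis using s by (subst generated_semigroup_2) auto
  qed
  finally have S: "semigroup_of_values quad = generated_semigroup {2, s}" .
  have "2 < s" using s by (cases "s = 2") auto
  have mem: "0 * 2 + 1 * s \<in> generated_semigroup {2, s}" "1 * 2 + 0 * s \<in> generated_semigroup {2, s}"
    using \<open>2 < s\<close> by (subst generated_semigroup_2; blast)+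
  have dvd: "x dvd t" if "t \<in> generated_semigroup B" "B \<subseteq> {x}" for x t B
    using that unfolding generated_semigroup_def by (auto intro!: dvd_sum)
  have "generated_semigroup B \<noteq> generated_semigroup {2, s}" if "B \<subset> {2, s}" for B
  proof
    assume eq: "generated_semigroup B = generated_semigroup {2, s}"
    from \<open>B \<subset> {2, s}\<close> have "B \<subseteq> {2} \<or> B \<subseteq> {s}" by blast
    then show False
    proof
      assume "B \<subseteq> {2}"
      then have "2 dvd s" using dvd[of s B 2] mem(1) eq by simp
      then show False using s(1) by simp
    next
      assume "B \<subseteq> {s}"
      then have "s dvd 2" using dvd[of 2 B s] mem(2) eq by simp
      then show False using \<open>2 < s\<close> by (auto dest: dvd_imp_le)
    qed
  qed
  then show ?thesis using S \<open>2 < s\<close> by (simp add: minimally_generated_by_def)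
qed

text \<open>Substituting \<open>v = d\<close> makes \<open>d^2\<close> dominate: its order
  \<open>2 k\<close> is below \<open>s\<close>, and below that of \<open>b1 * d\<close>, since
  \<open>b1\<close> has order above \<open>s / 2 > k\<close>.\<close>

lemma intersection_number_linear_quad:
  assumes d: "conv1 d" "has_order d k" and k: "k > 0" "2 * k < s"
  shows "intersection_number (fps_X - fps_const d) quad = enat (2 * k)"
proof -
  have d0: "d $ 0 = 0" using d k by (simp add: has_order_def)
  obtain e where e: "primitive_root 1 e" using primitive_root_exists[of 1] by auto
  have "plane_branch (fps_X - fps_const d)"
    using smooth_branch_linear[OF d(1) d0] by (simp add: smooth_branch_def)
  then obtain \<phi> U where "puiseux_parametrization (fps_X - fps_const d) 1 e \<phi> U"
    using branch_has_parametrization[OF _ y_order_linear[OF d0] _ e] by auto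
  then interpret puiseux_parametrization "fps_X - fps_const d" 1 e \<phi> U .
  have "val fps_X - val (fps_const d) = 0" unfolding val_diff[symmetric] by (rule val_f)
  then have "\<phi> - ram 1 d = 0" unfolding val_X val_const .
  then have "\<phi> = d" unfolding ram_1 by simp
  then have \<phi>: "has_order \<phi> k" using d(2) by simp
  have val_quad: "val quad = \<phi> ^ 2 - b1 * \<phi> + b2"
    unfolding quad_def val_add val_diff val_mult val_power val_X val_const ram_1 ..
  have d2: "has_order (\<phi> ^ 2) (k + k)" unfolding power2_eq_square by (intro has_order_mult \<phi>)
  have "has_order (\<phi> ^ 2 - b1 * \<phi>) (k + k)"
  proof (cases "b1 = 0")
    case True
    then show ?thesis using d2 by simp
  next
    case False
    then have "has_order (b1 * \<phi>) (subdegree b1 + k)" by (intro has_order_mult \<phi> has_order_subdegree)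
    then show ?thesis by (rule has_order_diff_less[OF d2]) (use b1_order False k in linarith)
  qed
  then have "has_order (val quad) (k + k)"
    unfolding val_quad using b2 by (rule has_order_add_less) (use k in linarith)
  then have "val quad \<noteq> 0" "subdegree (val quad) = k + k" by (auto simp only: has_order_iff)
  from intersection_number_eq_subdegree[OF conv_quad this(1)] show ?thesis
    unfolding \<open>subdegree (val quad) = k + k\<close> mult_2 .
qed

end

section \<open>The Newton polygon of the discriminant\<close>

text \<open>Cubics in \<open>v\<close> with a corner at \<open>(s1, 2)\<close>. The condition on the
  coefficient of \<open>v\<close> keeps height 1 strictly to the right of the lower edge, which
  passes there at \<open>s1 + s2 / 2\<close>.\<close>

locale cubic_polygon =
  fixes D :: series2 and s1 s2 :: nat
  assumes s: "s1 > 0" "2 * s1 < s2" "odd s2"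
    and D3: "D $ 3 = 1" "\<And>j. j > 3 \<Longrightarrow> D $ j = 0"
    and D2: "has_order (D $ 2) s1"
    and D1: "\<And>i. 2 * i \<le> 2 * s1 + s2 \<Longrightarrow> D $ 1 $ i = 0"
    and D0: "has_order (D $ 0) (s1 + s2)"
begin

text \<open>The broken line through the three vertices, parametrized by height, with its corner at
  height 2.\<close>

definition pt :: "real \<Rightarrow> real \<times> real" where
  "pt b = (if b \<ge> 2 then real s1 * (3 - b) else real s1 + real s2 * (2 - b) / 2, b)" for b :: real

lemma supp_cases:
  assumes "(i, j) \<in> supp2 D"
  shows "i = 0 \<and> j = 3 \<or> j = 2 \<and> i \<ge> s1 \<or> j = 1 \<and> 2 * i > 2 * s1 + s2 \<or> j = 0 \<and> i \<ge> s1 + s2"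
proof -
  have nz: "D $ j $ i \<noteq> 0" using assms by (simp add: supp2_def coeff2_def)
  then have "j \<le> 3" using D3(2)[of j] by (cases "j > 3") auto
  then consider "j = 3" | "j = 2" | "j = 1" | "j = 0" by linarith
  then show ?thesis
  proof cases
    case 1
    then show ?thesis using nz D3(1) by (auto simp: fps_one_nth split: if_splits)
  next
    case 2
    then show ?thesis using nz D2 unfolding has_order_def by (meson not_le)
  next
    case 3
    then show ?thesis using nz D1[of i] by (meson not_le)
  next
    case 4
    then show ?thesis using nz D0 unfolding has_order_def by (meson not_le)
  qed
qed

lemma vertices: "(0, 3) \<in> supp2 D" "(s1, 2) \<in> supp2 D" "(s1 + s2, 0) \<in> supp2 D"
  using D3 D2 D0 by (auto simp: supp2_def coeff2_def has_order_def)

text \<open>The last two inequalities are the half-planes bounded by the lines through the two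
  compact edges.\<close>

lemma polygon_subset:
  "newton_polygon D \<subseteq> {(a, b). 0 \<le> a \<and> 0 \<le> b \<and> 3 * real s1 \<le> a + real s1 * b \<and> 2 * real s1 + 2 * real s2 \<le> 2 * a + real s2 * b}"
  unfolding newton_polygon_def
proof (rule hull_minimal)
  show "convex {(a, b). 0 \<le> a \<and> 0 \<le> b \<and> 3 * real s1 \<le> a + real s1 * b \<and> 2 * real s1 + 2 * real s2 \<le> 2 * a + real s2 * (b :: real)}"
  proof (rule convexI)
    fix x y :: "real \<times> real" and u v :: real
    assume x: "x \<in> {(a, b). 0 \<le> a \<and> 0 \<le> b \<and> 3 * real s1 \<le> a + real s1 * b \<and> 2 * real s1 + 2 * real s2 \<le> 2 * a + real s2 * (b :: real)}"
      and y: "y \<in> {(a, b). 0 \<le> a \<and> 0 \<le> b \<and> 3 * real s1 \<le> a + real s1 * b \<and> 2 * real s1 + 2 * real s2 \<le> 2 * a + real s2 * (b :: real)}"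
      and uv: "0 \<le> u" "0 \<le> v" "u + v = 1"
    obtain a b where xab: "x = (a, b)" by (cases x)
    obtain c d where ycd: "y = (c, d)" by (cases y)
    have combine: "k \<le> u * p + v * q" if "k \<le> p" "k \<le> q" for k p q :: real
    proof -
      have "u * k + v * k \<le> u * p + v * q" using uv that by (intro add_mono mult_left_mono) auto
      then show ?thesis using uv(3) by (simp flip: distrib_right)
    qed
    have "3 * real s1 \<le> u * (a + real s1 * b) + v * (c + real s1 * d)"
      "2 * real s1 + 2 * real s2 \<le> u * (2 * a + real s2 * b) + v * (2 * c + real s2 * d)"
      "0 \<le> u * a + v * c" "0 \<le> u * b + v * d"
      using x y unfolding xab ycd by (auto intro!: combine)
    then show "u *\<^sub>R x + v *\<^sub>R y \<in> {(a, b). 0 \<le> a \<and> 0 \<le> b \<and> 3 * real s1 \<le> a + real s1 * b \<and> 2 * real s1 + 2 * real s2 \<le> 2 * a + real s2 * (b :: real)}"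
      unfolding xab ycd by (simp add: algebra_simps)
  qed
  show "{(real i + a, real j + b) |i j a b. (i, j) \<in> supp2 D \<and> 0 \<le> a \<and> 0 \<le> b}
      \<subseteq> {(a, b). 0 \<le> a \<and> 0 \<le> b \<and> 3 * real s1 \<le> a + real s1 * b \<and> 2 * real s1 + 2 * real s2 \<le> 2 * a + real s2 * b}"
  proof clarify
    fix i j and a b :: real assume ij: "(i, j) \<in> supp2 D" and ab: "0 \<le> a" "0 \<le> b"
    have nat: "3 * s1 \<le> i + s1 * j" "2 * s1 + 2 * s2 \<le> 2 * i + s2 * j"
      using supp_cases[OF ij] s by auto
    have "real (3 * s1) \<le> real (i + s1 * j)" "real (2 * s1 + 2 * s2) \<le> real (2 * i + s2 * j)"
      using nat by (simp_all only: of_nat_le_iff)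
    then have "3 * real s1 \<le> real i + real s1 * real j" "2 * real s1 + 2 * real s2 \<le> 2 * real i + real s2 * real j"
      by simp_all
    moreover have "0 \<le> real s1 * b" "0 \<le> real s2 * b" using ab by simp_all
    ultimately show "0 \<le> real i + a \<and> 0 \<le> real j + b \<and> 3 * real s1 \<le> (real i + a) + real s1 * (real j + b) \<and>
        2 * real s1 + 2 * real s2 \<le> 2 * (real i + a) + real s2 * (real j + b)"
      using ab unfolding distrib_left by linarith
  qed
qed

lemma polygon_add:
  assumes "p \<in> newton_polygon D" "0 \<le> fst w" "0 \<le> snd w"
  shows "p + w \<in> newton_polygon D"
proof -
  let ?G = "{(real i + a, real j + b) |i j a b. (i, j) \<in> supp2 D \<and> 0 \<le> a \<and> 0 \<le> b}"
  have "(\<lambda>x. w + x) ` ?G \<subseteq> ?G"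
  proof
    fix y assume "y \<in> (\<lambda>x. w + x) ` ?G"
    then obtain i j a b where "y = w + (real i + a, real j + b)" and ij: "(i, j) \<in> supp2 D" "0 \<le> a" "0 \<le> b"
      by blast
    then have "y = (real i + (a + fst w), real j + (b + snd w))" by (auto simp: prod_eq_iff)
    moreover have "0 \<le> a + fst w" "0 \<le> b + snd w" using ij assms by auto
    ultimately show "y \<in> ?G" using ij(1) by blast
  qed
  then have "convex hull ((\<lambda>x. w + x) ` ?G) \<subseteq> convex hull ?G" by (rule hull_mono)
  moreover have "w + p \<in> (\<lambda>x. w + x) ` (convex hull ?G)" using assms(1) by (simp add: newton_polygon_def)
  ultimately show ?thesis
    unfolding newton_polygon_def convex_hull_translation by (auto simp: add.commute)
qed

lemma vertex_in_polygon: "(i, j) \<in> supp2 D \<Longrightarrow> (real i, real j) \<in> newton_polygon D"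
  unfolding newton_polygon_def
  by (rule hull_inc, rule CollectI, rule exI[of _ i], rule exI[of _ j], rule exI[of _ 0], rule exI[of _ 0]) simp

lemma pt_vertices: "pt 3 = (0, 3)" "pt 2 = (real s1, 2)" "pt 0 = (real (s1 + s2), 0)"
  by (simp_all add: pt_def)

lemma pt_upper: "2 \<le> b \<Longrightarrow> b \<le> 3 \<Longrightarrow> pt b = (3 - b) *\<^sub>R pt 2 + (1 - (3 - b)) *\<^sub>R pt 3"
  by (simp add: pt_def algebra_simps)

lemma pt_lower: "0 \<le> b \<Longrightarrow> b \<le> 2 \<Longrightarrow> pt b = (1 - b / 2) *\<^sub>R pt 0 + (b / 2) *\<^sub>R pt 2"
  by (auto simp: pt_def field_simps)

lemma convex_polygon: "convex (newton_polygon D)"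
  by (simp add: newton_polygon_def)

lemma pt_in_polygon: assumes "0 \<le> b" "b \<le> 3" shows "pt b \<in> newton_polygon D"
proof -
  have v: "pt 3 \<in> newton_polygon D" "pt 2 \<in> newton_polygon D" "pt 0 \<in> newton_polygon D"
    using vertex_in_polygon[OF vertices(1)] vertex_in_polygon[OF vertices(2)] vertex_in_polygon[OF vertices(3)]
    by (simp_all only: pt_vertices of_nat_0 of_nat_numeral)
  show ?thesis
  proof (cases "2 \<le> b")
    case True
    then show ?thesis using assms v unfolding pt_upper[OF True assms(2)]
      by (intro convexD[OF convex_polygon]) auto
  next
    case False
    then have b: "b \<le> 2" by simp
    show ?thesis using assms b v unfolding pt_lower[OF assms(1) b]
      by (intro convexD[OF convex_polygon]) auto
  qed
qed

text \<open>
  A compact face contains only minimal points of the polygon: if \<open>q \<le> p\<close> differs from \<open>p\<close>, then the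
  ray from \<open>q\<close> through \<open>p\<close> stays in the polygon, hence in the face.
\<close>

lemma compact_face_minimal:
  assumes L: "L face_of newton_polygon D" "compact L"
    and p: "p \<in> L" and q: "q \<in> newton_polygon D" "fst q \<le> fst p" "snd q \<le> snd p"
  shows "q = p"
proof (rule ccontr)
  assume "q \<noteq> p"
  define w where "w = p - q"
  have w: "w \<noteq> 0" "0 \<le> fst w" "0 \<le> snd w" using \<open>q \<noteq> p\<close> q by (auto simp: w_def)
  have ray: "q + t *\<^sub>R w \<in> L" if t: "t > 1" for t
  proof -
    have "q + t *\<^sub>R w \<in> newton_polygon D" using q w t by (intro polygon_add) auto
    moreover have "p \<in> open_segment q (q + t *\<^sub>R w)"
      unfolding in_segment
    proof (intro conjI exI[of _ "1 / t"])
      show "q \<noteq> q + t *\<^sub>R w" using w t by simp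
      have "(1 - 1 / t) *\<^sub>R q + (1 / t) *\<^sub>R (q + t *\<^sub>R w) = q + w"
        using t by (simp add: algebra_simps)
      then show "p = (1 - 1 / t) *\<^sub>R q + (1 / t) *\<^sub>R (q + t *\<^sub>R w)" by (simp add: w_def)
    qed (use t in auto)
    ultimately show ?thesis using face_ofD[OF L(1) _ q(1) _ p] by blast
  qed
  obtain B where B: "\<And>x. x \<in> L \<Longrightarrow> norm x \<le> B" using compact_imp_bounded[OF L(2)] by (auto simp: bounded_iff)
  \<comment> \<open>Chosen so that the norm of \<open>t *\<^sub>R w\<close> exceeds
    \<open>\<bar>B\<bar> + norm q\<close>, which a ray point in the bounded face forbids.\<close>
  define t where "t = (\<bar>B\<bar> + norm q + 1) / norm w + 2"
  have t: "t > 1" using w by (simp add: t_def add_pos_nonneg add_nonneg_pos pos_add_strict)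
  have "t * norm w = (\<bar>B\<bar> + norm q + 1) / norm w * norm w + 2 * norm w" unfolding t_def by (rule distrib_right)
  then have "t * norm w = (\<bar>B\<bar> + norm q + 1) + 2 * norm w" using w(1) by simp
  moreover have "norm (t *\<^sub>R w) \<le> norm (q + t *\<^sub>R w) + norm q"
    using norm_triangle_ineq4[of "q + t *\<^sub>R w" q] by simp
  moreover have "norm (t *\<^sub>R w) = t * norm w" using t by simp
  moreover have "norm (q + t *\<^sub>R w) \<le> B" using ray[OF t] by (rule B)
  ultimately show False using norm_ge_zero[of w] norm_ge_zero[of q] by linarith
qed

text \<open>A point of the polygon lies to the right of the broken line at its height, or above
  \<open>(0, 3)\<close>. Minimality identifies it with the point of the path it dominates.\<close>

lemma compact_face_on_path:
  assumes L: "L face_of newton_polygon D" "compact L" and p: "p \<in> L"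
  shows "p = pt (snd p) \<and> 0 \<le> snd p \<and> snd p \<le> 3"
proof -
  obtain a b where ab: "p = (a, b)" by (cases p)
  have "p \<in> newton_polygon D" using L(1) p face_of_imp_subset by blast
  then have Q: "0 \<le> a" "0 \<le> b" "3 * real s1 \<le> a + real s1 * b" "2 * real s1 + 2 * real s2 \<le> 2 * a + real s2 * b"
    using polygon_subset unfolding ab by auto
  have min: "q = p" if "q \<in> newton_polygon D" "fst q \<le> a" "snd q \<le> b" for q
    using compact_face_minimal[OF L p that(1)] that unfolding ab by simp
  have "b \<le> 3"
  proof (rule ccontr)
    assume "\<not> b \<le> 3"
    then have "pt 3 = p" using Q pt_in_polygon[of 3] by (intro min) (auto simp: pt_vertices)
    then show False using \<open>\<not> b \<le> 3\<close> ab by (simp add: pt_vertices)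
  qed
  moreover have "pt b = p"
    using Q \<open>b \<le> 3\<close> pt_in_polygon[of b] by (intro min) (auto simp: pt_def field_simps)
  ultimately show ?thesis using Q ab by simp
qed

text \<open>An edge has two points of different heights on the path, hence a point inside one of the
  two segments. The face property adds the ends of that segment, and the corner stops the edge
  there.\<close>

lemma compact_edge:
  assumes "L edge_of newton_polygon D" "compact L"
  shows "L = pt ` {2..3} \<or> L = pt ` {0..2}"
proof -
  have L: "L face_of newton_polygon D" "aff_dim L = 1" using assms(1) by (auto simp: edge_of_def)
  note path = compact_face_on_path[OF L(1) assms(2)]
  have "convex L" using face_of_imp_convex[OF L(1)] .
  obtain p q where pq: "p \<in> L" "q \<in> L" "snd p < snd q"
  proof -
    have "\<exists>p q. p \<in> L \<and> q \<in> L \<and> p \<noteq> q"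
    proof (rule ccontr)
      assume "\<not> ?thesis"
      then have "L = {} \<or> (\<exists>p. L = {p})" by blast
      then show False using L(2) by auto
    qed
    then obtain p q where pq: "p \<in> L" "q \<in> L" "p \<noteq> q" by blast
    then have "snd p \<noteq> snd q" using path by metis
    then show ?thesis using that pq by (meson linorder_neqE_linordered_idom)
  qed
  \<comment> \<open>A chord across the corner meets height 2 strictly to the right of
    \<open>(s1, 2)\<close>, because \<open>s2 / 2 > s1\<close>; but its points must lie on the
    path.\<close>
  have same_side: False if x: "x \<in> L" "snd x < 2" and y: "y \<in> L" "2 < snd y" for x y
  proof -
    define l where "l = (snd y - 2) / (snd y - snd x)"
    have l: "0 < l" "l < 1" using x y by (auto simp: l_def)
    define z where "z = l *\<^sub>R x + (1 - l) *\<^sub>R y"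
    have z: "z \<in> L" unfolding z_def using l x y by (intro convexD[OF \<open>convex L\<close>]) auto
    have "l * (snd y - snd x) = snd y - 2" using x y by (simp add: l_def)
    then have sz: "snd z = 2" by (simp add: z_def algebra_simps)
    then have fz: "fst z = real s1" using path[OF z] by (simp add: pt_def prod_eq_iff)
    have fx: "fst x = real s1 + real s2 * (2 - snd x) / 2" and fy: "fst y = real s1 * (3 - snd y)"
      using path[OF x(1)] path[OF y(1)] x(2) y(2) by (auto simp: pt_def prod_eq_iff)
    have "(1 - l) * (snd y - 2) = l * (2 - snd x)"
      using sz by (simp add: z_def algebra_simps)
    have "fst z = l * (real s1 + real s2 * (2 - snd x) / 2) + (1 - l) * (real s1 - real s1 * (snd y - 2))"
      by (simp add: z_def fx fy algebra_simps)
    also have "\<dots> = real s1 + real s2 / 2 * (l * (2 - snd x)) - real s1 * ((1 - l) * (snd y - 2))"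
      by (simp add: field_simps)
    also have "\<dots> = real s1 + (real s2 / 2 - real s1) * (l * (2 - snd x))"
      unfolding \<open>(1 - l) * (snd y - 2) = l * (2 - snd x)\<close> by (simp add: algebra_simps)
    finally have "fst z = real s1 + (real s2 / 2 - real s1) * (l * (2 - snd x))" .
    then have "(real s2 / 2 - real s1) * (l * (2 - snd x)) = 0" using fz by simp
    moreover have "(real s2 / 2 - real s1) * (l * (2 - snd x)) > 0"
      using s(2) l x by (intro mult_pos_pos) auto
    ultimately show False by linarith
  qed
  define m where "m = (1/2) *\<^sub>R p + (1/2) *\<^sub>R q"
  have m: "m \<in> L" unfolding m_def using pq by (intro convexD[OF \<open>convex L\<close>]) auto
  have sm: "snd p < snd m" "snd m < snd q" using pq by (simp_all add: m_def)
  have inj: "pt b \<noteq> pt c" if "b \<noteq> c" for b c using that by (simp add: pt_def)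
  show ?thesis
  proof (cases "snd m > 2")
    case True
    have m3: "snd m < 3" using sm path[OF pq(2)] by linarith
    have "pt (snd m) = (3 - snd m) *\<^sub>R pt 2 + (1 - (3 - snd m)) *\<^sub>R pt 3"
      using True m3 by (intro pt_upper) auto
    then have "m \<in> open_segment (pt 2) (pt 3)"
      unfolding in_segment using path[OF m] True m3 inj[of 2 3]
      by (intro conjI exI[of _ "snd m - 2"]) (auto simp: add.commute)
    then have v: "pt 2 \<in> L" "pt 3 \<in> L"
      using face_ofD[OF L(1) _ pt_in_polygon[of 2] pt_in_polygon[of 3] m] by auto
    have "L = pt ` {2..3}"
    proof (intro equalityI subsetI)
      fix x assume x: "x \<in> L"
      then have "snd x \<ge> 2" using same_side[OF x _ m True] by force
      then show "x \<in> pt ` {2..3}" using path[OF x] by (intro image_eqI[of _ _ "snd x"]) auto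
    next
      fix x assume "x \<in> pt ` {2..3}"
      then obtain b where b: "x = pt b" "2 \<le> b" "b \<le> 3" by auto
      show "x \<in> L" unfolding b(1) pt_upper[OF b(2,3)]
        using v b by (intro convexD[OF \<open>convex L\<close>]) auto
    qed
    then show ?thesis ..
  next
    case False
    \<comment> \<open>The midpoint \<open>m\<close> may be the corner itself, so a second bisection
      yields a point strictly inside the lower segment.\<close>
    define m' where "m' = (1/2) *\<^sub>R p + (1/2) *\<^sub>R m"
    have m': "m' \<in> L" unfolding m'_def using pq m by (intro convexD[OF \<open>convex L\<close>]) auto
    have sm': "snd p < snd m'" "snd m' < 2" using False sm by (simp_all add: m'_def)
    have m'0: "0 < snd m'" using sm' path[OF pq(1)] by linarith
    have "pt (snd m') = (1 - snd m' / 2) *\<^sub>R pt 0 + (snd m' / 2) *\<^sub>R pt 2"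
      using m'0 sm' by (intro pt_lower) auto
    then have "m' \<in> open_segment (pt 0) (pt 2)"
      unfolding in_segment using path[OF m'] m'0 sm' inj[of 0 2]
      by (intro conjI exI[of _ "snd m' / 2"]) auto
    then have v: "pt 0 \<in> L" "pt 2 \<in> L"
      using face_ofD[OF L(1) _ pt_in_polygon[of 0] pt_in_polygon[of 2] m'] by auto
    have "L = pt ` {0..2}"
    proof (intro equalityI subsetI)
      fix x assume x: "x \<in> L"
      then have "snd x \<le> 2" using same_side[OF m' sm'(2) x] by force
      then show "x \<in> pt ` {0..2}" using path[OF x] by (intro image_eqI[of _ _ "snd x"]) auto
    next
      fix x assume "x \<in> pt ` {0..2}"
      then obtain b where b: "x = pt b" "0 \<le> b" "b \<le> 2" by auto
      show "x \<in> L" unfolding b(1) pt_lower[OF b(2,3)]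
        using v b by (intro convexD[OF \<open>convex L\<close>]) auto
    qed
    then show ?thesis ..
  qed
qed

lemma lattice_upper: "(real i, real j) \<in> pt ` {2..3} \<longleftrightarrow> i = 0 \<and> j = 3 \<or> i = s1 \<and> j = 2"
proof -
  have "(real i, real j) \<in> pt ` {2..3} \<longleftrightarrow> 2 \<le> j \<and> j \<le> 3 \<and> real i = real s1 * (3 - real j)"
    by (auto simp: pt_def image_iff)
  also have "\<dots> \<longleftrightarrow> i = 0 \<and> j = 3 \<or> i = s1 \<and> j = 2"
  proof -
    have "2 \<le> j \<and> j \<le> 3 \<longleftrightarrow> j = 2 \<or> j = 3" by linarith
    then show ?thesis by auto
  qed
  finally show ?thesis .
qed

text \<open>At height 1 the edge has abscissa \<open>s1 + s2 / 2\<close>, not an integer for odd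
  \<open>s2\<close>.\<close>

lemma lattice_lower: "(real i, real j) \<in> pt ` {0..2} \<longleftrightarrow> i = s1 + s2 \<and> j = 0 \<or> i = s1 \<and> j = 2"
proof -
  have "(real i, real j) \<in> pt ` {0..2} \<longleftrightarrow> j \<le> 2 \<and> real i = real s1 + real s2 * (2 - real j) / 2"
    by (auto simp: pt_def image_iff)
  also have "\<dots> \<longleftrightarrow> j \<le> 2 \<and> real (2 * i + s2 * j) = real (2 * s1 + 2 * s2)"
    by (auto simp: field_simps)
  also have "\<dots> \<longleftrightarrow> j \<le> 2 \<and> 2 * i + s2 * j = 2 * s1 + 2 * s2"
    by (simp only: of_nat_eq_iff)
  also have "\<dots> \<longleftrightarrow> i = s1 + s2 \<and> j = 0 \<or> i = s1 \<and> j = 2"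
  proof -
    have "j \<le> 2 \<longleftrightarrow> j = 0 \<or> j = 1 \<or> j = 2" by linarith
    moreover have "2 * i + s2 * 1 \<noteq> 2 * s1 + 2 * s2" using s(3) by presburger
    ultimately show ?thesis by auto
  qed
  finally show ?thesis .
qed

theorem non_degenerate: "non_degenerate D"
  unfolding non_degenerate_def
proof (intro allI impI)
  fix L assume "L edge_of newton_polygon D \<and> compact L"
  then consider "L = pt ` {2..3}" | "L = pt ` {0..2}" using compact_edge by blast
  then show "rsquarefree (edge_poly D L div Polynomial.monom 1 (edge_min L))"
  proof cases
    case 1
    have "edge_min L = 2"
      unfolding edge_min_def 1 lattice_upper by (rule Least_equality) auto
    have "{(i, j). (i, j) \<in> supp2 D \<and> (real i, real j) \<in> L} = {(0, 3), (s1, 2)}"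
      unfolding 1 lattice_upper using vertices by auto
    then have "edge_poly D L = Polynomial.monom 1 3 + Polynomial.monom (coeff2 D s1 2) 2"
      using D3(1) by (simp add: edge_poly_def coeff2_def)
    \<comment> \<open>Removing the power \<open>z^2\<close> of the lower end leaves a linear
      polynomial.\<close>
    also have "\<dots> = Polynomial.monom 1 2 * [:coeff2 D s1 2, 1:]"
      by (simp add: poly_eq_iff coeff_monom_mult coeff_pCons split: nat.splits)
    finally have "edge_poly D L = Polynomial.monom 1 2 * [:coeff2 D s1 2, 1:]" .
    then have "edge_poly D L div Polynomial.monom 1 (edge_min L) = [:coeff2 D s1 2, 1:]"
      unfolding \<open>edge_min L = 2\<close> by (simp only:) (rule nonzero_mult_div_cancel_left, simp)
    then show ?thesis by (simp add: rsquarefree_roots pderiv_pCons)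
  next
    case 2
    have "edge_min L = 0"
      unfolding edge_min_def 2 lattice_lower by (rule Least_equality) auto
    have "{(i, j). (i, j) \<in> supp2 D \<and> (real i, real j) \<in> L} = {(s1 + s2, 0), (s1, 2)}"
      unfolding 2 lattice_lower using vertices by auto
    then have "edge_poly D L = Polynomial.monom (coeff2 D (s1 + s2) 0) 0 + Polynomial.monom (coeff2 D s1 2) 2"
      by (simp add: edge_poly_def)
    then have "edge_poly D L div Polynomial.monom 1 (edge_min L) = [:coeff2 D (s1 + s2) 0, 0, coeff2 D s1 2:]"
      unfolding \<open>edge_min L = 0\<close> by (simp add: poly_eq_iff coeff_pCons numeral_2_eq_2 split: nat.splits)
    \<comment> \<open>With both coefficients nonzero, the derivative vanishes only at 0, where the
      polynomial does not.\<close>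
    moreover have "coeff2 D (s1 + s2) 0 \<noteq> 0" "coeff2 D s1 2 \<noteq> 0"
      using vertices by (auto simp: supp2_def)
    ultimately show ?thesis by (auto simp: rsquarefree_roots pderiv_pCons)
  qed
qed

end

section \<open>Transversal branches and the final assembly\<close>

lemma y_regular_of_ord2:
  assumes f: "plane_branch f" and ord: "ord2 f \<noteq> 1"
  shows "at_x0 f \<noteq> 0"
proof
  assume 0: "at_x0 f = 0"
  then have f0: "f $ j $ 0 = 0" for j by (metis at_x0_nth fps_zero_nth)
  define g where "g = Abs_fps (\<lambda>j. fps_shift 1 (f $ j))"
  have conv_f: "convergent2 f" and f00: "f $ 0 $ 0 = 0" using f by (simp_all add: plane_branch_iff)
  obtain C R where CR: "C > 0" "R \<ge> 1"
    "\<And>R' i j. R' \<ge> R \<Longrightarrow> norm (f $ j $ i) \<le> C * R' ^ (i + j)" using conv_f by (rule convergent2E) blast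
  have "convergent2 g"
  proof (rule convergent2I)
    show "0 < R" using CR by simp
    show "norm (g $ j $ i) \<le> C * R * R ^ (i + j)" for i j
      using CR(3)[of R j "i + 1"] by (simp add: g_def mult_ac)
  qed
  moreover have "convergent2 var_x" by (simp add: var_x_def)
  moreover have "f = var_x * g"
  proof (intro fps_ext)
    fix j i
    show "f $ j $ i = (var_x * g) $ j $ i"
      using f0 by (cases i) (auto simp: var_x_def g_def)
  qed
  moreover have "var_x $ 0 $ 0 = 0" by (simp add: var_x_def)
  ultimately have "g $ 0 $ 0 \<noteq> 0" using f unfolding plane_branch_iff by blast
  then have nz: "f $ 0 $ 1 \<noteq> 0" by (simp add: g_def)
  have "ord2 f = 1"
    unfolding ord2_def
  proof (rule Least_equality)
    show "\<exists>i j. i + j = 1 \<and> coeff2 f i j \<noteq> 0"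
      using nz by (intro exI[of _ 1] exI[of _ 0]) (simp add: coeff2_def)
    show "1 \<le> k" if "\<exists>i j. i + j = k \<and> coeff2 f i j \<noteq> 0" for k
      using that f00 by (cases k) (auto simp: coeff2_def)
  qed
  then show False using ord by simp
qed

text \<open>The intersection number with \<open>x\<close> is the order of \<open>x = t^m\<close>
  along the parametrization, where \<open>m\<close> is the order of \<open>f(0, y)\<close>; so
  \<open>m = n\<close>. Order different from 1 excludes \<open>f\<close> being \<open>x\<close>
  times a unit, for which \<open>f(0, y) = 0\<close>.\<close>

lemma parametrization_of_transversal_branch:
  assumes f: "plane_branch f" and i: "intersection_number f var_x = enat n" and ord: "ord2 f \<noteq> 1"
  shows "\<exists>e \<phi> U. puiseux_parametrization f n e \<phi> U"
proof -
  define m where "m = subdegree (at_x0 f)"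
  have nz: "at_x0 f \<noteq> 0" using y_regular_of_ord2[OF f ord] .
  have yo: "y_order f m" using nz by (simp add: y_order_iff m_def)
  have "f $ 0 $ 0 = 0" using f by (simp add: plane_branch_iff)
  then have "m > 0" using yo by (auto simp: y_order_def intro!: gr0I)
  obtain e where e: "primitive_root m e" using primitive_root_exists[OF \<open>m > 0\<close>] by blast
  obtain \<phi> U where param: "puiseux_parametrization f m e \<phi> U"
    using branch_has_parametrization[OF f yo \<open>m > 0\<close> e] by blast
  interpret puiseux_parametrization f m e \<phi> U by (rule param)
  have "val var_x = fps_X ^ m" using n by (simp add: var_x_def ram_X)
  then have "val var_x \<noteq> 0" "subdegree (val var_x) = m" by (simp_all add: fps_X_power_subdegree)
  moreover have "convergent2 var_x" by (simp add: var_x_def)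
  ultimately have "intersection_number f var_x = enat m"
    using intersection_number_eq_subdegree[of var_x] by simp
  then have "m = n" using i by simp
  then show ?thesis using param by blast
qed

theorem proposition3p3:
  fixes f D :: series2 and s1 s2 :: nat
  assumes "plane_branch f"
    and "minimally_generated_by (semigroup_of_values f) [4, s1, s2]"
    and "intersection_number f var_x = enat (ord2 f)" and "ord2 f = 4"
    and "is_discriminant f D"
  shows "non_degenerate D \<and>
    (\<exists>D1 D2. D1 \<in> carrier conv_ring \<and> D2 \<in> carrier conv_ring \<and> D = D1 * D2 \<and>
       smooth_branch D1 \<and> singular_branch D2 \<and>
       minimally_generated_by (semigroup_of_values D2) [2, s2] \<and>
       intersection_number D1 D2 = enat (2 * s1))"
proof -
  have "\<exists>e \<phi> U. puiseux_parametrization f 4 e \<phi> U"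
    by (rule parametrization_of_transversal_branch[OF assms(1)]) (simp_all add: assms(3,4))
  then obtain e \<phi> U where param: "puiseux_parametrization f 4 e \<phi> U" by (elim exE)
  obtain \<beta>1 \<beta>2 where \<beta>: "s1 = \<beta>1" "s2 = \<beta>1 + \<beta>2" "\<beta>1 mod 4 = 2" "odd \<beta>2" "\<beta>1 < \<beta>2"
    "\<phi> $ \<beta>1 \<noteq> 0" "\<phi> $ \<beta>2 \<noteq> 0" "\<And>k. k < \<beta>1 \<Longrightarrow> \<not> 4 dvd k \<Longrightarrow> \<phi> $ k = 0"
    "\<And>k. k < \<beta>2 \<Longrightarrow> odd k \<Longrightarrow> \<phi> $ k = 0"
  proof (rule characteristic_exponents[OF param assms(2)])
    fix \<beta>1 \<beta>2
    assume "s1 = \<beta>1" "s2 = \<beta>1 + \<beta>2" "\<beta>1 mod 4 = 2" "odd \<beta>2" "\<beta>1 < \<beta>2"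
      "\<phi> $ \<beta>1 \<noteq> 0" "\<phi> $ \<beta>2 \<noteq> 0" "\<And>k. k < \<beta>1 \<Longrightarrow> \<not> 4 dvd k \<Longrightarrow> \<phi> $ k = 0"
      "\<And>k. k < \<beta>2 \<Longrightarrow> odd k \<Longrightarrow> \<phi> $ k = 0"
    then show thesis by (rule that)
  qed
  have \<beta>1: "\<not> 4 dvd \<beta>1" "even \<beta>1" using \<beta>(3) by presburger+
  have sizes: "odd s2" "2 * s1 < s2" "s1 > 0" using \<beta>(1-5) \<beta>1 by auto
  obtain N w \<gamma> where D: "convergent2 D" and polar: "Newton_Puiseux_polar f N w \<gamma>"
    and D_fac: "ramify N D = (\<Prod>j=1..ord2 f - 1. fps_X - fps_const (subst_y (ramify N f) (\<gamma> j)))"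
    using assms(5) by (auto simp: is_discriminant_def)
  define \<delta> where "\<delta> j = subst_y (ramify N f) (\<gamma> j)" for j
  obtain p q r where pqr: "{p, q, r} = {1, 2, 3}" "p \<noteq> q" "p \<noteq> r" "q \<noteq> r"
    and \<delta>: "has_order (\<delta> p) (N * s1)" "\<delta> q \<noteq> 0" "2 * subdegree (\<delta> q) = N * s2"
      "\<delta> r \<noteq> 0" "2 * subdegree (\<delta> r) = N * s2"
    using polar_root_orders[OF param \<beta>1 \<beta>(6,8) \<beta>(4,7,9,5) polar assms(4)]
    unfolding \<delta>_def \<beta>(1,2) by blast
  have N: "N > 0" using polar by (simp add: Newton_Puiseux_polar_def)
  have range: "{1..ord2 f - 1} = {p, q, r}" unfolding pqr(1) using assms(4) by auto
  have "convergent2 f" using assms(1) by (simp add: plane_branch_iff)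
  moreover have "p \<in> {1..ord2 f - 1}" unfolding range by simp
  then have "conv1 (\<gamma> p)" "\<gamma> p $ 0 = 0"
    using polar unfolding Newton_Puiseux_polar_def conv1_iff_radius by blast+
  ultimately have "conv1 (\<delta> p)"
    unfolding \<delta>_def using N by (intro conv1_subst_y convergent2_ramify)
  moreover have "ramify N D =
      (fps_X - fps_const (\<delta> p)) * ((fps_X - fps_const (\<delta> q)) * (fps_X - fps_const (\<delta> r)))"
    unfolding D_fac range \<delta>_def using pqr(2-4) by simp
  ultimately obtain d1 b1 b2 where db: "conv1 d1" "conv1 b1" "conv1 b2" "has_order d1 s1" "has_order b2 s2"
      "\<And>i. 2 * i \<le> s2 \<Longrightarrow> b1 $ i = 0"
      and D_eq: "D = (fps_X - fps_const d1) * (fps_X ^ 2 - fps_const b1 * fps_X + fps_const b2)"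
    using discriminant_factorization[OF D N _ _ \<delta> sizes] by blast
  interpret quadratic_branch b1 b2 s2
    by unfold_locales (use db sizes in auto)
  have D_quad: "D = (fps_X - fps_const d1) * quad" by (simp add: D_eq quad_def)
  have quad_nth: "quad $ j = (if j = 0 then b2 else if j = 1 then - b1 else if j = 2 then 1 else 0)" for j
  proof -
    consider "j = 0" | "j = 1" | "j = 2" | "j > 2" by linarith
    then show ?thesis by cases (auto simp: quad_def)
  qed
  have D_nth: "D $ j = (if j = 0 then 0 else quad $ (j - 1)) - d1 * quad $ j" for j
    by (simp add: D_quad left_diff_distrib)
  have D0: "D $ 0 = - (d1 * b2)" and D1: "D $ 1 = b2 + d1 * b1" and D2: "D $ 2 = - (d1 + b1)"
    and D3: "D $ 3 = 1"
    unfolding D_nth quad_nth by simp_all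
  interpret cubic_polygon D s1 s2
  proof
    show "D $ 3 = 1" by (rule D3)
    show "D $ j = 0" if "j > 3" for j
    proof -
      have "j - 1 > 2" using that by linarith
      then show ?thesis unfolding D_nth quad_nth using that by auto
    qed
    \<comment> \<open>As \<open>2 * s1 < s2\<close>, the series \<open>b1\<close> has no terms up to
      degree \<open>s1\<close>, so \<open>d1 + b1\<close> keeps the order of
      \<open>d1\<close>.\<close>
    have b1_low: "b1 $ i = 0" if "i \<le> s1" for i using that sizes by (intro db(6)) simp
    show "has_order (D $ 2) s1"
      unfolding D2 has_order_uminus using db(4) b1_low by (auto simp: has_order_def)
    show "has_order (D $ 0) (s1 + s2)"
      unfolding D0 has_order_uminus by (rule has_order_mult[OF db(4,5)])
    show "D $ 1 $ i = 0" if i: "2 * i \<le> 2 * s1 + s2" for i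
    proof -
      \<comment> \<open>Either \<open>k\<close> is below the order of \<open>d1\<close>, or
        \<open>2 * (i - k) \<le> s2\<close>, where \<open>b1\<close> vanishes.\<close>
      have "d1 $ k * b1 $ (i - k) = 0" if "k \<in> {0..i}" for k
      proof (cases "k < s1")
        case True
        then show ?thesis using db(4) by (simp add: has_order_def)
      next
        case False
        then have "b1 $ (i - k) = 0" using i by (intro db(6)) linarith
        then show ?thesis by simp
      qed
      then have "(d1 * b1) $ i = 0" unfolding fps_mult_nth by (intro sum.neutral ballI)
      \<comment> \<open>Here \<open>2 * i \<le> 2 * s1 + s2 < 2 * s2\<close>, so \<open>i\<close> is
        below the order of \<open>b2\<close>.\<close>
      moreover have "b2 $ i = 0" using db(5) i sizes by (simp add: has_order_def)
      ultimately show ?thesis unfolding D1 by simp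
    qed
  qed (use sizes in auto)
  have d10: "d1 $ 0 = 0" using db(4) sizes by (simp add: has_order_def)
  have "fps_X - fps_const d1 \<in> carrier conv_ring"
    using db(1) by (simp add: convergent2_diff)
  moreover have "smooth_branch (fps_X - fps_const d1)" by (rule smooth_branch_linear[OF db(1) d10])
  moreover have "intersection_number (fps_X - fps_const d1) quad = enat (2 * s1)"
    using db sizes by (intro intersection_number_linear_quad) auto
  ultimately show ?thesis
    using non_degenerate D_quad conv_quad singular_branch_quad semigroup_quad
    by (intro conjI exI[of _ "fps_X - fps_const d1"] exI[of _ quad]) simp_all
qed

end
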